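(* Let $K$ be a field, let $q \geq 4$ be an integer, and let $G$ be a finite connected simple graph. If the edge ring $K[G]$ has a $q$-linear resolution, then $K[G]$ is a hypersurface.
   Context: For a finite simple graph $G$ on the vertex set $\{1,\ldots,n\}$ with edges $e_1,\ldots,e_m$, the edge ring $K[G]$ is the $K$-subalgebra of $K[x_1,\ldots,x_n]$ generated by the monomials $x_ix_j$ with $\{i,j\}$ an edge of $G$. Let $S=K[y_1,\ldots,y_m]$ be the polynomial ring with $\deg y_k=1$, and let $I_G\subset S$ be the kernel of the surjection $S\to K[G]$ sending $y_k$ to $x_ix_j$ where $e_k=\{i,j\}$; $I_G$ is a homogeneous ideal and $K[G]\cong S/I_G$. For a homogeneous ideal $0\neq I\subset S$, with graded minimal free resolution $0 \to \bigoplus_{j} S(-j)^{\beta_{h,j}} \to \cdots \to \bigoplus_{j} S(-j)^{\beta_{1,j}} \to S \to S/I \to 0$, the ring $S/I$ has a $q$-linear resolution if $\beta_{i,j}=0$ for each $1\le i\le h$ and each $j\neq q+i-1$. The notion presupposes $I\neq 0$; "$K[G]$ has a $q$-linear resolution" means that $I_G\neq 0$ and $S/I_G$ has a $q$-linear resolution. $K[G]$ is a hypersurface if its codimension is $1$, where $\operatorname{codim}(K[G]) = m-\dim K[G]$ ($\dim$ is Krull dimension). *)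

theory Defs
  imports
    "HOL-Library.Poly_Mapping"
    "HOL-Library.Extended_Nat"
    "HOL-Algebra.Generated_Rings"
    "HOL-Algebra.Algebraic_Closure_Type"
    "Jordan_Normal_Form.Matrix"
begin

subsection \<open>Polynomial rings\<close>

text \<open>Polynomials with variables indexed by a type, represented as finitely supported
  functions from exponent vectors to coefficients, with the convolution product.\<close>

type_synonym ('i, 'k) mpoly = "('i \<Rightarrow>\<^sub>0 nat) \<Rightarrow>\<^sub>0 'k"

definition PConst :: "'k::comm_ring_1 \<Rightarrow> ('i, 'k) mpoly"
  where "PConst c = Poly_Mapping.single 0 c"

definition PVar :: "'i \<Rightarrow> ('i, 'k::comm_ring_1) mpoly"
  where "PVar i = Poly_Mapping.single (Poly_Mapping.single i 1) 1"

definition mon_deg :: "('i \<Rightarrow>\<^sub>0 nat) \<Rightarrow> nat"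
  where "mon_deg t = (\<Sum>i\<in>Poly_Mapping.keys t. Poly_Mapping.lookup t i)"

text \<open>The polynomial ring over \<open>'k\<close> in the variables indexed by \<open>J\<close>.\<close>

definition polys :: "'i set \<Rightarrow> ('i, 'k::comm_ring_1) mpoly set"
  where "polys J = {p. \<forall>t\<in>Poly_Mapping.keys p. Poly_Mapping.keys t \<subseteq> J}"

definition psubst ::
  "('i \<Rightarrow> ('v, 'k) mpoly) \<Rightarrow> ('i, 'k::comm_ring_1) mpoly \<Rightarrow> ('v, 'k) mpoly"
  where "psubst f p =
    (\<Sum>t\<in>Poly_Mapping.keys p. PConst (Poly_Mapping.lookup p t) *
      (\<Prod>i\<in>Poly_Mapping.keys t. f i ^ Poly_Mapping.lookup t i))"

subsection \<open>Graphs, edge rings and toric ideals\<close>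

text \<open>A finite simple graph with vertex set \<open>V\<close> whose edges are the distinct two-element
  sets \<open>e j\<close>, for \<open>j\<close> in the index set \<open>J\<close>.\<close>

definition simple_graph :: "'v set \<Rightarrow> 'i set \<Rightarrow> ('i \<Rightarrow> 'v set) \<Rightarrow> bool"
  where "simple_graph V J e \<longleftrightarrow>
    finite V \<and> finite J \<and> inj_on e J \<and> (\<forall>j\<in>J. e j \<subseteq> V \<and> card (e j) = 2)"

definition connected_graph :: "'v set \<Rightarrow> 'i set \<Rightarrow> ('i \<Rightarrow> 'v set) \<Rightarrow> bool"
  where "connected_graph V J e \<longleftrightarrow>
    (\<forall>u\<in>V. \<forall>v\<in>V. (u, v) \<in> {(a, b). \<exists>j\<in>J. e j = {a, b}}\<^sup>*)"

definition edge_monomial :: "('i \<Rightarrow> 'v set) \<Rightarrow> 'i \<Rightarrow> ('v, 'k::comm_ring_1) mpoly"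
  where "edge_monomial e j = (\<Prod>v\<in>e j. PVar v)"

text \<open>The subalgebra is generated as a ring by the constants and the edge monomials.\<close>

definition edge_ring :: "'i set \<Rightarrow> ('i \<Rightarrow> 'v set) \<Rightarrow> ('v, 'k::comm_ring_1) mpoly ring"
  where "edge_ring J e = ring_of_type_algebra
    \<lparr>carrier := generate_ring ring_of_type_algebra (PConst ` UNIV \<union> edge_monomial e ` J)\<rparr>"

definition toric_ideal :: "'i set \<Rightarrow> ('i \<Rightarrow> 'v set) \<Rightarrow> ('i, 'k::comm_ring_1) mpoly set"
  where "toric_ideal J e =
    {p \<in> polys J. psubst (edge_monomial e) p = (0 :: ('v, 'k) mpoly)}"

subsection \<open>Krull dimension and hypersurfaces\<close>

definition krull_dim :: "('a, 'b) ring_scheme \<Rightarrow> enat"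
  where "krull_dim R = Sup {enat l | l.
    \<exists>P :: nat \<Rightarrow> 'a set. (\<forall>i\<le>l. primeideal (P i) R) \<and> (\<forall>i<l. P i \<subset> P (Suc i))}"

text \<open>Codimension of a quotient \<open>R\<close> of a polynomial ring in \<open>m\<close> variables.  Subtraction on
  \<open>enat\<close> truncates, which is harmless here since such a quotient has dimension at most \<open>m\<close>;
  in any case the codimension is \<open>1\<close> iff \<open>krull_dim R + 1 = m\<close>.\<close>

definition codim :: "nat \<Rightarrow> ('a, 'b) ring_scheme \<Rightarrow> enat"
  where "codim m R = enat m - krull_dim R"

definition hypersurface :: "nat \<Rightarrow> ('a, 'b) ring_scheme \<Rightarrow> bool"
  where "hypersurface m R \<longleftrightarrow> codim m R = 1"

subsection \<open>Graded minimal free resolutions\<close>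

definition free_mod :: "'i set \<Rightarrow> nat \<Rightarrow> ('i, 'k::comm_ring_1) mpoly vec set"
  where "free_mod J r = {v \<in> carrier_vec r. set\<^sub>v v \<subseteq> polys J}"

text \<open>Write \<open>S = polys J\<close>.  The predicate below says that
  \<open>0 \<rightarrow> F\<^sub>h \<rightarrow> \<dots> \<rightarrow> F\<^sub>1 \<rightarrow> F\<^sub>0 = S \<rightarrow> S/I \<rightarrow> 0\<close>
  is a graded minimal free resolution, where \<open>F\<^sub>i\<close> is the direct sum of the modules \<open>S(-j)\<close>
  with \<open>j\<close> running through the list \<open>d i\<close> (the degrees of the basis elements), and
  \<open>D i : F\<^sub>i \<rightarrow> F\<^sub>i\<^sub>-\<^sub>1\<close> is the matrix of the differential.  The condition on the keys
  of the entries says that \<open>D i\<close> preserves degrees; minimality says that no entry has a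
  constant term, i.e. that \<open>D i\<close> maps \<open>F\<^sub>i\<close> into the product of the graded maximal ideal
  with \<open>F\<^sub>i\<^sub>-\<^sub>1\<close>.\<close>

definition minimal_graded_resolution ::
  "'i set \<Rightarrow> ('i, 'k::comm_ring_1) mpoly set \<Rightarrow> nat \<Rightarrow> (nat \<Rightarrow> nat list) \<Rightarrow>
    (nat \<Rightarrow> ('i, 'k) mpoly mat) \<Rightarrow> bool"
  where "minimal_graded_resolution J I h d D \<longleftrightarrow>
    1 \<le> h \<and> d 0 = [0] \<and>
    (\<forall>i\<in>{1..h}.
      D i \<in> carrier_mat (length (d (i - 1))) (length (d i)) \<and>
      elements_mat (D i) \<subseteq> polys J \<and>
      (\<forall>a < length (d (i - 1)). \<forall>b < length (d i). \<forall>t \<in> Poly_Mapping.keys (D i $$ (a, b)).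
        mon_deg t + d (i - 1) ! a = d i ! b) \<and>
      (\<forall>p \<in> elements_mat (D i). Poly_Mapping.lookup p 0 = 0)) \<and>
    I = (\<lambda>w. (D 1 *\<^sub>v w) $ 0) ` free_mod J (length (d 1)) \<and>
    (\<forall>i\<in>{1..<h}.
      {v \<in> free_mod J (length (d i)). D i *\<^sub>v v = 0\<^sub>v (length (d (i - 1)))} =
      (\<lambda>w. D (i + 1) *\<^sub>v w) ` free_mod J (length (d (i + 1)))) \<and>
    {v \<in> free_mod J (length (d h)). D h *\<^sub>v v = 0\<^sub>v (length (d (h - 1)))} =
      {0\<^sub>v (length (d h))}"

text \<open>The number of summands \<open>S(-j)\<close> in \<open>F\<^sub>i\<close>.\<close>

definition graded_betti :: "(nat \<Rightarrow> nat list) \<Rightarrow> nat \<Rightarrow> nat \<Rightarrow> nat"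
  where "graded_betti d i j = count_list (d i) j"

text \<open>\<open>S/I\<close> has a \<open>q\<close>-linear resolution.  A graded minimal free resolution is unique up to
  isomorphism, so the existential quantifier refers to ``the'' resolution.\<close>

definition has_linear_resolution ::
  "nat \<Rightarrow> 'i set \<Rightarrow> ('i, 'k::comm_ring_1) mpoly set \<Rightarrow> bool"
  where "has_linear_resolution q J I \<longleftrightarrow> I \<noteq> {0} \<and>
    (\<exists>h d D. minimal_graded_resolution J I h d D \<and>
      (\<forall>i\<in>{1..h}. \<forall>j. j \<noteq> q + i - 1 \<longrightarrow> graded_betti d i j = 0))"

end

theory Submission
  imports Defs
begin

text \<open>
  Let \<open>D(t)\<close> be the vector of vertex degrees of a monomial \<open>t\<close> in the edges (\<open>vdeg\<close> below).
  A binomial \<open>u - v\<close> with \<open>D(u) = D(v)\<close> is an even closed walk whose edges alternate between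
  \<open>u\<close> and \<open>v\<close>; a \<open>q\<close>-linear resolution forces all nontrivial such walks to have length at
  least \<open>2 q\<close>. Let \<open>f1\<close>, \<open>f2\<close> be elements of degree \<open>q\<close> of the toric ideal \<open>I\<close> such that the
  monomial \<open>u\<close> occurs in \<open>f1\<close> but not in \<open>f2\<close>. Applying the coefficient functional at \<open>u\<close> to
  the Koszul syzygy of \<open>f1\<close> and \<open>f2\<close> shows that \<open>f2\<close> lies in an ideal generated by linear
  forms, and hence that each monomial of \<open>f2\<close> is divisible by an edge \<open>y\<close> that occurs in a
  linear syzygy: there are three distinct monomials \<open>u y\<close>, \<open>v y\<close>, \<open>a Q\<close> of degree \<open>q + 1\<close> with
  the same vertex degrees, where the edge \<open>a \<noteq> y\<close> divides \<open>u\<close>.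

  The edges of \<open>Q\<close> are chords of the closed walk \<open>u\<close>, \<open>v\<close> of length \<open>2 q\<close>, up to a path of length
  three through \<open>y\<close>. A chord of length less than \<open>q\<close> closes up both arcs of the walk, and one of
  the two resulting closed walks is too short. For \<open>q \<ge> 5\<close> this excludes such a \<open>Q\<close> by parity,
  and for \<open>q = 4\<close> it shows that \<open>y\<close> is disjoint from the support of \<open>D(u)\<close>. Take \<open>f2\<close> first
  arbitrary and then equal to \<open>Q - u y / a\<close>: the edge \<open>y'\<close> obtained the second time divides
  \<open>Q\<close>, is disjoint from \<open>D(u)\<close>, and lies in the support of \<open>D(u y / a)\<close>, so \<open>y' = y\<close>; but \<open>y\<close>
  does not divide \<open>Q\<close>. Hence \<open>I\<close> is generated by a single binomial.

  Such an \<open>I\<close> is contained in an ideal generated by two variables, which starts a chain of \<open>m\<close>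
  prime ideals of \<open>K[G]\<close>. No chain is longer, because a binomial in \<open>I\<close> already makes the
  Hilbert function of \<open>K[G]\<close> (in degrees at most \<open>N\<close>) grow at most like \<open>N^(m - 1)\<close>.
\<close>

subsection \<open>Even closed walks and edge vectors\<close>

text \<open>Peel off two-element orbits. Used contrapositively: on a set of odd size a
  fixed-point-free involution must lead out of the set, which produces chords below.\<close>

lemma even_card_fpf_involution:
  assumes "finite U" and "\<And>x. x \<in> U \<Longrightarrow> f x \<in> U" "\<And>x. x \<in> U \<Longrightarrow> f x \<noteq> x"
    "\<And>x. x \<in> U \<Longrightarrow> f (f x) = x"
  shows "even (card U)"
  using assms
proof (induction "card U" arbitrary: U rule: less_induct)
  case less
  show ?case
  proof (cases "U = {}")
    case False
    then obtain x where x: "x \<in> U" by blast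
    let ?Y = "U - {x, f x}"
    have c: "card U = card ?Y + 2"
    proof -
      have "card {x, f x} = 2" "{x, f x} \<subseteq> U" using less.prems(2,3) x by (auto simp: card_insert_if, metis)
      then show ?thesis using less.prems(1) card_mono[of U "{x, f x}"] by (subst card_Diff_subset) auto
    qed
    have "even (card ?Y)"
    proof (rule less.hyps)
      show "card ?Y < card U" using c by simp
      fix z assume z: "z \<in> ?Y"
      then show "f z \<in> ?Y" using less.prems x by (metis DiffE DiffI insertCI insertE singletonD)
    qed (use less.prems in auto)
    then show ?thesis using c by simp
  qed simp
qed

definition delta :: "'i \<Rightarrow> 'i \<Rightarrow> int" where "delta i j = of_bool (j = i)"

text \<open>The lattice is the kernel of the unsigned vertex-edge incidence matrix; the positive and
  negative parts of a vector \<open>w\<close> are the exponents of a binomial in the toric ideal.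
  Both parts have equal degree, as every edge has two ends, so \<open>min_mass\<close> excludes
  nonzero binomials of degree less than \<open>q\<close>.\<close>

locale edge_lattice =
  fixes J :: "'i set" and e :: "'i \<Rightarrow> 'v set" and q :: nat
  assumes finite_J: "finite J"
    and card_edge: "j \<in> J \<Longrightarrow> card (e j) = 2"
    and inj_e: "inj_on e J"
    and min_mass: "(\<And>x. (\<Sum>j\<in>J. w j * of_bool (x \<in> e j)) = (0::int)) \<Longrightarrow>
      (\<Sum>j\<in>J. \<bar>w j\<bar>) < 2 * int q \<Longrightarrow> j \<in> J \<Longrightarrow> w j = 0"
begin

definition boundary :: "('i \<Rightarrow> int) \<Rightarrow> 'v \<Rightarrow> int" where
  "boundary w x = (\<Sum>j\<in>J. w j * of_bool (x \<in> e j))"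

definition mass :: "('i \<Rightarrow> int) \<Rightarrow> int" where
  "mass w = (\<Sum>j\<in>J. \<bar>w j\<bar>)"

definition vertex_deg :: "'i multiset \<Rightarrow> 'v \<Rightarrow> nat" where
  "vertex_deg A x = size {#j \<in># A. x \<in> e j#}"

lemma boundary_add: "boundary (\<lambda>j. f j + g j) x = boundary f x + boundary g x"
  by (simp add: boundary_def sum.distrib algebra_simps)

lemma boundary_diff: "boundary (\<lambda>j. f j - g j) x = boundary f x - boundary g x"
  by (simp add: boundary_def sum_subtractf algebra_simps)

lemma boundary_mult: "boundary (\<lambda>j. c * f j) x = c * boundary f x"
  by (simp add: boundary_def sum_distrib_left algebra_simps)

lemma boundary_delta: "j \<in> J \<Longrightarrow> boundary (delta j) x = of_bool (x \<in> e j)"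
proof -
  assume j: "j \<in> J"
  have "boundary (delta j) x = (\<Sum>i\<in>J. if i = j then of_bool (x \<in> e j) else 0)"
    unfolding boundary_def delta_def by (intro sum.cong) auto
  then show ?thesis using finite_J j by simp
qed

lemma mass_add: "mass (\<lambda>j. f j + g j) \<le> mass f + mass g"
  unfolding mass_def sum.distrib[symmetric] by (intro sum_mono) auto

lemma mass_diff: "mass (\<lambda>j. f j - g j) \<le> mass f + mass g"
  unfolding mass_def sum.distrib[symmetric] by (intro sum_mono) auto

lemma mass_sgn: "\<bar>c\<bar> = 1 \<Longrightarrow> mass (\<lambda>j. c * f j) = mass f"
  by (simp add: mass_def abs_mult)

lemma mass_delta: "mass (delta j) \<le> 1"
proof -
  have "mass (delta j) = (\<Sum>i\<in>J. if i = j then 1 else 0)"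
    unfolding mass_def delta_def by (intro sum.cong) auto
  then show ?thesis using finite_J by simp
qed

lemma min_massD: "(\<And>x. boundary w x = 0) \<Longrightarrow> mass w < 2 * int q \<Longrightarrow> j \<in> J \<Longrightarrow> w j = 0"
  unfolding boundary_def mass_def by (rule min_mass)

lemma edge_pair: "j \<in> J \<Longrightarrow> x \<in> e j \<Longrightarrow> \<exists>z. z \<noteq> x \<and> e j = {x, z}"
  using card_edge[of j] by (auto simp: card_2_iff)

lemma edge_eqI: "i \<in> J \<Longrightarrow> j \<in> J \<Longrightarrow> e i = e j \<Longrightarrow> i = j"
  using inj_e by (auto dest: inj_onD)

lemma vertex_deg_empty [simp]: "vertex_deg {#} x = 0"
  and vertex_deg_add_mset: "vertex_deg (add_mset j A) x = of_bool (x \<in> e j) + vertex_deg A x"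
  by (auto simp: vertex_deg_def)

lemma boundary_count: "set_mset A \<subseteq> J \<Longrightarrow> boundary (\<lambda>j. int (count A j)) x = int (vertex_deg A x)"
proof (induction A)
  case empty
  then show ?case by (simp add: boundary_def)
next
  case (add j A)
  have "(\<lambda>i. int (count (add_mset j A) i)) = (\<lambda>i. delta j i + int (count A i))"
    by (auto simp: delta_def)
  then show ?case using add boundary_delta[of j x] by (simp add: boundary_add vertex_deg_add_mset)
qed

lemma vertex_deg_pos: "0 < vertex_deg A x \<longleftrightarrow> (\<exists>j\<in>#A. x \<in> e j)"
proof -
  have "0 < vertex_deg A x \<longleftrightarrow> {#j \<in># A. x \<in> e j#} \<noteq> {#}" unfolding vertex_deg_def by (rule nonempty_has_size[symmetric])
  then show ?thesis by (auto simp: multiset_eq_iff not_in_iff)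
qed

lemma sum_vertex_deg: 
  assumes "set_mset A \<subseteq> J" "finite U" "(\<Union>j\<in>J. e j) \<subseteq> U"
  shows "(\<Sum>x\<in>U. vertex_deg A x) = 2 * size A"
  using assms(1)
proof (induction A)
  case (add j A)
  have "(\<Sum>x\<in>U. of_bool (x \<in> e j)::nat) = card (U \<inter> e j)"
    using assms(2) by (simp add: Int_def)
  also have "U \<inter> e j = e j" using assms(3) add by auto
  finally show ?case using add card_edge[of j] by (simp add: vertex_deg_add_mset sum.distrib)
qed simp

lemma size_eq_if_vertex_deg_eq:
  assumes "set_mset A \<subseteq> J" "set_mset B \<subseteq> J" "\<And>x. vertex_deg A x = vertex_deg B x"
  shows "size A = size B"
proof -
  let ?X = "\<Union>j\<in>J. e j"
  have "finite ?X" using finite_J card_edge by (auto intro!: finite_UN_I card_ge_0_finite)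
  then show ?thesis using sum_vertex_deg[OF assms(1), of ?X] sum_vertex_deg[OF assms(2), of ?X] assms(3) by simp
qed

text \<open>The common part cancels in the difference vector, so its mass is twice the size of
  \<open>A\<close> without the intersection; a nonzero lattice vector has mass at least
  \<open>2 * q\<close>.\<close>

lemma vertex_deg_eq_size_ge:
  assumes "set_mset A \<subseteq> J" "set_mset B \<subseteq> J" "\<And>x. vertex_deg A x = vertex_deg B x" "A \<noteq> B"
  shows "q + size (A \<inter># B) \<le> size A"
proof (rule ccontr)
  assume *: "\<not> ?thesis"
  define w where "w = (\<lambda>j. int (count A j) - int (count B j))"
  have b: "boundary w x = 0" for x
    unfolding w_def by (simp add: boundary_diff boundary_count assms)
  have sz: "(\<Sum>j\<in>J. int (count C j)) = int (size C)" if "set_mset C \<subseteq> J" for C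
  proof -
    have "(\<Sum>j\<in>J. count C j) = size C"
      unfolding size_multiset_overloaded_eq
      by (rule sum.mono_neutral_right) (use that finite_J in \<open>auto simp: not_in_iff\<close>)
    then show ?thesis by (metis int_sum)
  qed
  have "mass w = (\<Sum>j\<in>J. int (count A j) + int (count B j) - 2 * int (count (A \<inter># B) j))"
    unfolding mass_def w_def by (intro sum.cong) auto
  also have "\<dots> = int (size A) + int (size B) - 2 * int (size (A \<inter># B))"
    using sz[of A] sz[of B] sz[of "A \<inter># B"] assms
    by (auto simp: sum.distrib sum_subtractf sum_distrib_left[symmetric])
  also have "\<dots> < 2 * int q" using * size_eq_if_vertex_deg_eq[OF assms(1-3)] by simp
  finally have "w j = 0" if "j \<in> J" for j using min_massD[OF b] that by blast
  then have "count A j = count B j" if "j \<in> J" for j using that by (simp add: w_def)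
  moreover have "count A j = count B j" if "j \<notin> J" for j
    using assms(1,2) that by (metis count_inI subsetD)
  ultimately have "count A j = count B j" for j by blast
  then show False using assms(4) by (auto simp: multiset_eq_iff)
qed

section \<open>Alternating walks and matchings in multisets of edges\<close>

text \<open>Greedy construction: leave the current vertex \<open>x\<close> along an edge of
  \<open>u\<close>, then continue along an edge of \<open>v\<close>. Deleting both edges keeps the
  degrees balanced except at \<open>x0\<close> and the current vertex, so the walk can only stop at
  \<open>x0\<close>.\<close>

lemma alternating_walk:
  assumes "set_mset u \<subseteq> J" "set_mset v \<subseteq> J"
    "\<And>z. vertex_deg u z + of_bool (z = x0) = vertex_deg v z + of_bool (z = x)"
    "a \<in># u" "x \<in> e a"
  shows "\<exists>as bs xs ys. length bs = length as \<and> length xs = length as \<and> length ys = length as \<and>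
    mset as \<subseteq># u \<and> mset bs \<subseteq># v \<and> as \<noteq> [] \<and> as ! 0 = a \<and> xs ! 0 = x \<and>
    (\<forall>i<length as. e (as ! i) = {xs ! i, ys ! i} \<and> e (bs ! i) = {ys ! i, (xs @ [x0]) ! Suc i})"
  using assms
proof (induction "size u" arbitrary: u v x a rule: less_induct)
  case less
  obtain x1 where x1: "x1 \<noteq> x" "e a = {x, x1}"
    using edge_pair[of a x] less.prems by auto
  define u' where "u' = u - {#a#}"
  have u: "u = add_mset a u'" using less.prems by (simp add: u'_def)
  have "0 < vertex_deg v x1"
    using less.prems(3)[of x1] x1 by (simp add: u vertex_deg_add_mset split: if_splits)
  then obtain b where b: "b \<in># v" "x1 \<in> e b" by (auto simp: vertex_deg_pos)
  obtain x2 where x2: "x2 \<noteq> x1" "e b = {x1, x2}"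
    using edge_pair[of b x1] less.prems b by auto
  define v' where "v' = v - {#b#}"
  have v: "v = add_mset b v'" using b by (simp add: v'_def)
  have bal: "vertex_deg u' z + of_bool (z = x0) = vertex_deg v' z + of_bool (z = x2)" for z
    using less.prems(3)[of z] x1 x2 by (auto simp: u v vertex_deg_add_mset of_bool_def split: if_splits)
  show ?case
  proof (cases "x2 = x0")
    case True
    then show ?thesis
      by (intro exI[of _ "[a]"] exI[of _ "[b]"] exI[of _ "[x]"] exI[of _ "[x1]"])
        (use x1 x2 less.prems b in auto)
  next
    case False
    \<comment> \<open>Away from \<open>x0\<close>, the balance gives \<open>u'\<close> one more edge
      end at \<open>x2\<close> than \<open>v'\<close>.\<close>
    have "0 < vertex_deg u' x2" using bal[of x2] False by simp
    then obtain a' where a': "a' \<in># u'" "x2 \<in> e a'" by (auto simp: vertex_deg_pos)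
    have "size u' < size u" by (simp add: u)
    from less.hyps[OF this _ _ bal a'] less.prems(1,2) obtain as bs xs ys where
      w: "length bs = length as" "length xs = length as" "length ys = length as"
      "mset as \<subseteq># u'" "mset bs \<subseteq># v'" "as \<noteq> []" "as ! 0 = a'" "xs ! 0 = x2"
      "\<And>i. i<length as \<Longrightarrow> e (as ! i) = {xs ! i, ys ! i} \<and> e (bs ! i) = {ys ! i, (xs @ [x0]) ! Suc i}"
      by (auto simp: u v)
    have xs0: "(xs @ [x0]) ! 0 = x2" using w(2,6,8) by (cases xs) auto
    have "e ((a # as) ! i) = {(x # xs) ! i, (x1 # ys) ! i} \<and>
        e ((b # bs) ! i) = {(x1 # ys) ! i, ((x # xs) @ [x0]) ! Suc i}" if "i < Suc (length as)" for i
    proof (cases i)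
      case 0
      then show ?thesis using x1 x2 xs0 by (simp add: insert_commute)
    next
      case (Suc i')
      then show ?thesis using w(9)[of i'] that by simp
    qed
    moreover have "mset (a # as) \<subseteq># u" "mset (b # bs) \<subseteq># v"
      using w(4,5) by (simp_all add: u v)
    ultimately show ?thesis
      by (intro exI[of _ "a # as"] exI[of _ "b # bs"] exI[of _ "x # xs"] exI[of _ "x1 # ys"])
        (simp add: w(1-3))
  qed
qed

text \<open>The indices in \<open>I\<close> are slots, several of which may lie at the same vertex.
  Each occurrence of an edge in \<open>Q\<close> takes one free slot at each of its ends:
  \<open>\<tau>\<close> pairs the slots and \<open>lab\<close> names the joining edge. The last
  conjunct says that different pairs use different occurrences, even of the same edge.\<close>

lemma edge_matching:
  assumes "finite I" "set_mset Q \<subseteq> J" "\<And>x. vertex_deg Q x = card {i \<in> I. pt i = x}"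
  shows "\<exists>\<tau> lab. (\<forall>i\<in>I. \<tau> i \<in> I \<and> \<tau> i \<noteq> i \<and> \<tau> (\<tau> i) = i \<and> lab (\<tau> i) = lab i \<and>
      e (lab i) = {pt i, pt (\<tau> i)} \<and> lab i \<in># Q) \<and>
    (\<forall>i\<in>I. \<forall>k\<in>I. k \<noteq> i \<longrightarrow> k \<noteq> \<tau> i \<longrightarrow> {#lab i, lab k#} \<subseteq># Q)"
  using assms
proof (induction Q arbitrary: I)
  case empty
  then have "I = {}" by force
  then show ?case by auto
next
  case (add j Q)
  have j: "j \<in> J" using add by simp
  then obtain x z where xz: "x \<noteq> z" "e j = {x, z}"
    using card_edge[of j] by (auto simp: card_2_iff)
  have pos: "0 < card {i \<in> I. pt i = x}" "0 < card {i \<in> I. pt i = z}"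
    using add.prems(3)[of x] add.prems(3)[of z] xz by (simp_all add: vertex_deg_add_mset)
  then obtain a b where ab: "a \<in> I" "pt a = x" "b \<in> I" "pt b = z"
    by (auto simp: card_gt_0_iff)
  then have "a \<noteq> b" using xz by auto
  have "vertex_deg Q y = card {i \<in> I - {a,b}. pt i = y}" for y
  proof -
    have *: "{i \<in> I - {a,b}. pt i = y} = {i \<in> I. pt i = y} - (if y = x then {a} else if y = z then {b} else {})"
      using ab xz by auto
    have "card {i \<in> I - {a,b}. pt i = y} + of_bool (y \<in> e j) = card {i \<in> I. pt i = y}"
      unfolding * using ab xz add.prems(1) pos by auto
    then show ?thesis using add.prems(3)[of y] by (simp add: vertex_deg_add_mset)
  qed
  from add.IH[OF _ _ this] add.prems obtain \<tau> lab where
    t: "\<forall>i\<in>I - {a,b}. \<tau> i \<in> I - {a,b} \<and> \<tau> i \<noteq> i \<and> \<tau> (\<tau> i) = i \<and> lab (\<tau> i) = lab i \<and>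
      e (lab i) = {pt i, pt (\<tau> i)} \<and> lab i \<in># Q"
    "\<forall>i\<in>I - {a,b}. \<forall>k\<in>I - {a,b}. k \<noteq> i \<longrightarrow> k \<noteq> \<tau> i \<longrightarrow> {#lab i, lab k#} \<subseteq># Q"
    by auto
  have sub: "{#lab i, lab k#} \<subseteq># add_mset j Q"
    if "i\<in>I - {a,b}" "k\<in>I - {a,b}" "k \<noteq> i" "k \<noteq> \<tau> i" for i k
  proof -
    have "{#lab i, lab k#} \<subseteq># Q" using t(2) that by blast
    also have "Q \<subseteq># add_mset j Q" by simp
    finally show ?thesis .
  qed
  define \<tau>' where "\<tau>' = \<tau>(a := b, b := a)"
  define lab' where "lab' = lab(a := j, b := j)"
  have new: "\<tau>' a = b" "\<tau>' b = a" "lab' a = j" "lab' b = j"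
    using \<open>a \<noteq> b\<close> by (auto simp: \<tau>'_def lab'_def)
  have old: "\<tau>' i = \<tau> i" "lab' i = lab i" if "i \<in> I - {a,b}" for i
    using that by (auto simp: \<tau>'_def lab'_def)
  have "\<tau>' i \<in> I \<and> \<tau>' i \<noteq> i \<and> \<tau>' (\<tau>' i) = i \<and> lab' (\<tau>' i) = lab' i \<and>
      e (lab' i) = {pt i, pt (\<tau>' i)} \<and> lab' i \<in># add_mset j Q" if "i \<in> I" for i
  proof (cases "i \<in> {a, b}")
    case True
    then show ?thesis using new ab xz \<open>a \<noteq> b\<close> by (auto simp: insert_commute)
  next
    case False
    then have i: "i \<in> I - {a, b}" using that by blast
    with t(1) have "\<tau> i \<in> I - {a,b}" by blast
    then show ?thesis using t(1) i by (simp add: old)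
  qed
  moreover have "{#lab' i, lab' k#} \<subseteq># add_mset j Q"
    if "i \<in> I" "k \<in> I" "k \<noteq> i" "k \<noteq> \<tau>' i" for i k
  proof (cases "i \<in> {a, b}"; cases "k \<in> {a, b}")
    assume "i \<in> {a, b}" "k \<in> {a, b}"
    then show ?thesis using that new by auto
  next
    assume "i \<in> {a, b}" and k: "k \<notin> {a, b}"
    then have "lab' i = j" using new by auto
    moreover have "lab' k \<in># Q" using t(1) k that by (simp add: old)
    ultimately show ?thesis by simp
  next
    assume i: "i \<notin> {a, b}" and "k \<in> {a, b}"
    then have "lab' k = j" using new by auto
    moreover have "lab' i \<in># Q" using t(1) i that by (simp add: old)
    ultimately show ?thesis by (simp add: add_mset_commute[of _ j])
  next
    assume "i \<notin> {a, b}" "k \<notin> {a, b}"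
    then have "i \<in> I - {a,b}" "k \<in> I - {a,b}" using that by auto
    then show ?thesis using sub[of i k] that by (simp add: old)
  qed
  ultimately show ?case by blast
qed

end

subsection \<open>Chords of an alternating cycle\<close>

locale alternating_cycle = edge_lattice J e q
  for J :: "'i set" and e :: "'i \<Rightarrow> 'v set" and q :: nat +
  fixes E :: "nat \<Rightarrow> 'i" and P :: "nat \<Rightarrow> 'v" and u v :: "'i multiset"
  assumes E_J: "k < 2 * q \<Longrightarrow> E k \<in> J"
    and E_edge: "k < 2 * q \<Longrightarrow> e (E k) = {P k, P (Suc k)}"
    and P_closed: "P (2 * q) = P 0"
    and u_eq: "u = image_mset E (mset_set {k. k < 2 * q \<and> even k})"
    and v_eq: "v = image_mset E (mset_set {k. k < 2 * q \<and> odd k})"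
    and disjoint: "u \<inter># v = {#}"
begin

definition alt :: "nat set \<Rightarrow> 'i \<Rightarrow> int" where
  "alt T j = (\<Sum>k\<in>T. (-1) ^ k * delta (E k) j)"

lemma count_image_delta:
  "finite S \<Longrightarrow> int (count (image_mset E (mset_set S)) j) = (\<Sum>k\<in>S. delta (E k) j)"
  by (induction S rule: finite_induct) (auto simp: delta_def)

lemma alt_le_u: assumes "T \<subseteq> {..<2 * q}" shows "alt T j \<le> int (count u j)"
proof -
  have f: "finite T" using assms finite_subset by blast
  have "alt T j \<le> (\<Sum>k\<in>T. if even k then delta (E k) j else 0)"
    unfolding alt_def by (intro sum_mono) (auto simp: delta_def)
  also have "\<dots> = (\<Sum>k\<in>{k \<in> T. even k}. delta (E k) j)"
    using f by (simp add: sum.If_cases Int_def)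
  also have "\<dots> \<le> (\<Sum>k\<in>{k. k < 2 * q \<and> even k}. delta (E k) j)"
    using assms by (intro sum_mono2) (auto simp: delta_def)
  also have "\<dots> = int (count u j)" unfolding u_eq by (rule count_image_delta[symmetric]) simp
  finally show ?thesis .
qed

lemma alt_le_v: assumes "T \<subseteq> {..<2 * q}" shows "- alt T j \<le> int (count v j)"
proof -
  have f: "finite T" using assms finite_subset by blast
  have "- alt T j \<le> (\<Sum>k\<in>T. if odd k then delta (E k) j else 0)"
    unfolding alt_def sum_negf[symmetric] by (intro sum_mono) (auto simp: delta_def)
  also have "\<dots> = (\<Sum>k\<in>{k \<in> T. odd k}. delta (E k) j)"
    using f by (simp add: sum.If_cases Int_def)
  also have "\<dots> \<le> (\<Sum>k\<in>{k. k < 2 * q \<and> odd k}. delta (E k) j)"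
    using assms by (intro sum_mono2) (auto simp: delta_def)
  also have "\<dots> = int (count v j)" unfolding v_eq by (rule count_image_delta[symmetric]) simp
  finally show ?thesis .
qed

lemma E_even_neq_odd:
  assumes "k < 2 * q" "l < 2 * q" "even k" "odd l" shows "E k \<noteq> E l"
proof
  assume *: "E k = E l"
  have "E k \<in># u" "E l \<in># v" using assms by (auto simp: u_eq v_eq)
  then have "E k \<in># u \<inter># v" using * by simp
  then show False using disjoint by simp
qed

lemma P_neq_Suc: "k < 2 * q \<Longrightarrow> P k \<noteq> P (Suc k)"
  using E_J E_edge card_edge[of "E k"] by fastforce

text \<open>Nothing cancels: an edge may occupy several positions, but all of the same parity, since
  \<open>u\<close> and \<open>v\<close> are disjoint.\<close>

lemma mass_alt: assumes "T \<subseteq> {..<2 * q}" shows "mass (alt T) = int (card T)"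
proof -
  have f: "finite T" using assms finite_subset by blast
  have "\<bar>alt T j\<bar> = (\<Sum>k\<in>T. delta (E k) j)" for j
  proof (cases "\<exists>k\<in>T. even k \<and> E k = j")
    case True
    then have "even k" if "k \<in> T" "j = E k" for k
      using E_even_neq_odd assms that by blast
    then have "alt T j = (\<Sum>k\<in>T. delta (E k) j)"
      unfolding alt_def by (intro sum.cong refl) (auto simp: delta_def)
    moreover have "0 \<le> (\<Sum>k\<in>T. delta (E k) j)" by (intro sum_nonneg) (simp add: delta_def)
    ultimately show ?thesis by simp
  next
    case False
    then have "odd k" if "k \<in> T" "j = E k" for k using that by blast
    then have "alt T j = (\<Sum>k\<in>T. - delta (E k) j)"
      unfolding alt_def by (intro sum.cong refl) (auto simp: delta_def)
    moreover have "0 \<le> (\<Sum>k\<in>T. delta (E k) j)" by (intro sum_nonneg) (simp add: delta_def)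
    ultimately show ?thesis by (simp add: sum_negf)
  qed
  then have "mass (alt T) = (\<Sum>k\<in>T. \<Sum>j\<in>J. delta (E k) j)"
    unfolding mass_def by (simp, subst sum.swap, simp)
  also have "\<dots> = (\<Sum>k\<in>T. 1)"
  proof (intro sum.cong refl)
    fix k assume "k \<in> T"
    then have "E k \<in> J" using assms E_J by auto
    have "(\<Sum>j\<in>J. delta (E k) j) = (\<Sum>j\<in>J. if j = E k then 1 else 0)"
      unfolding delta_def by (intro sum.cong) auto
    then show "(\<Sum>j\<in>J. delta (E k) j) = 1" using \<open>E k \<in> J\<close> finite_J by simp
  qed
  finally show ?thesis by simp
qed

text \<open>Telescoping: consecutive edges have opposite signs, so only the two ends of the arc
  survive. The sign at the far end makes the parity of \<open>i + j\<close> decisive below.\<close>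

lemma boundary_alt_interval:
  assumes "i \<le> j" "j \<le> 2 * q"
  shows "boundary (alt {i..<j}) x = (-1) ^ i * of_bool (P i = x) - (-1) ^ j * of_bool (P j = x)"
  using assms
proof (induction j rule: dec_induct)
  case base
  then show ?case by (simp add: alt_def[abs_def] boundary_def)
next
  case (step n)
  have "alt {i..<Suc n} = (\<lambda>j. alt {i..<n} j + (-1) ^ n * delta (E n) j)"
    using step by (auto simp: alt_def fun_eq_iff)
  then have "boundary (alt {i..<Suc n}) x = boundary (alt {i..<n}) x + (-1) ^ n * of_bool (x \<in> e (E n))"
    using step E_J[of n] by (simp add: boundary_add boundary_mult boundary_delta)
  also have "of_bool (x \<in> e (E n)) = (of_bool (P n = x) + of_bool (P (Suc n) = x) :: int)"
    using E_edge[of n] P_neq_Suc[of n] step by auto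
  finally show ?case using step by (simp add: algebra_simps)
qed

lemma alt_union:
  "finite A \<Longrightarrow> finite B \<Longrightarrow> A \<inter> B = {} \<Longrightarrow> alt (A \<union> B) = (\<lambda>j. alt A j + alt B j)"
  by (auto simp: alt_def sum.union_disjoint)

text \<open>The whole closed walk has boundary zero, because its length is even.\<close>

lemma alt_compl:
  assumes "T \<subseteq> {..<2 * q}" shows "boundary (alt ({..<2 * q} - T)) x = - boundary (alt T) x"
proof -
  have "alt {..<2 * q} = (\<lambda>j. alt T j + alt ({..<2 * q} - T) j)"
    using alt_union[of T "{..<2 * q} - T"] assms finite_subset[OF assms]
    by (simp add: Un_absorb1)
  moreover have "boundary (alt {..<2 * q}) x = 0"
    using boundary_alt_interval[of 0 "2 * q" x] P_closed by (simp add: atLeast0LessThan)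
  ultimately show ?thesis by (simp add: boundary_add)
qed

text \<open>A chord of mass less than \<open>q\<close> closing up an arc of the cycle closes up the
  complementary arc as well; the two closed walks have total mass less than \<open>4q\<close>, so one of
  them is trivial.\<close>

lemma short_chord:
  assumes T: "T \<subseteq> {..<2 * q}" and m: "mass \<chi> < int q"
    and b: "\<And>x. boundary (alt T) x + boundary \<chi> x = 0"
  shows "(\<forall>j\<in>J. \<chi> j = - alt T j) \<or> (\<forall>j\<in>J. \<chi> j = alt ({..<2 * q} - T) j)"
proof (rule ccontr)
  let ?C = "{..<2 * q} - T"
  assume *: "\<not> ?thesis"
  have 1: "mass (\<lambda>j. alt T j + \<chi> j) \<ge> 2 * int q"
  proof (rule ccontr)
    assume "\<not> ?thesis"
    then have "alt T j + \<chi> j = 0" if "j \<in> J" for j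
      using min_massD[of "\<lambda>j. alt T j + \<chi> j" j] b that by (auto simp: boundary_add)
    then show False using * by (auto simp: eq_neg_iff_add_eq_0 add.commute)
  qed
  have 2: "mass (\<lambda>j. alt ?C j - \<chi> j) \<ge> 2 * int q"
  proof (rule ccontr)
    assume "\<not> ?thesis"
    then have "alt ?C j - \<chi> j = 0" if "j \<in> J" for j
      using min_massD[of "\<lambda>j. alt ?C j - \<chi> j" j] b[simplified add_eq_0_iff2] that
      by (auto simp: boundary_diff alt_compl[OF T])
    then show False using * by auto
  qed
  have "card T + card ?C = 2 * q"
    using T card_Diff_subset[OF finite_subset[OF T]] card_mono[OF _ T] by simp
  then show False
    using 1 2 mass_add[of "alt T" \<chi>] mass_diff[of "alt ?C" \<chi>] mass_alt[OF T] mass_alt[of ?C] m by auto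
qed

lemma two_v:
  assumes "k < 2 * q" "l < 2 * q" "odd k" "odd l" "k \<noteq> l" shows "{#E k, E l#} \<subseteq># v"
proof -
  have "mset_set {k, l} \<subseteq># mset_set {k. k < 2 * q \<and> odd k}"
    using assms by (intro subset_imp_msubset_mset_set) auto
  then have "image_mset E (mset_set {k, l}) \<subseteq># v" unfolding v_eq by (rule image_mset_subseteq_mono)
  then show ?thesis using assms by simp
qed

text \<open>Taking \<open>- c * \<psi>\<close> as the chord in \<open>short_chord\<close> absorbs
  the sign with which an arc starts.\<close>

lemma short_chord_sgn:
  assumes T: "T \<subseteq> {..<2 * q}" and m: "mass \<psi> < int q" and c: "\<bar>c\<bar> = 1"
    and b: "\<And>x. boundary (alt T) x = c * boundary \<psi> x"
  obtains "\<forall>j\<in>J. alt T j = c * \<psi> j" | "\<forall>j\<in>J. alt ({..<2 * q} - T) j = - c * \<psi> j"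
proof -
  have "mass (\<lambda>j. - c * \<psi> j) < int q" using mass_sgn[of "- c" \<psi>] c m by simp
  moreover have "boundary (alt T) x + boundary (\<lambda>j. - c * \<psi> j) x = 0" for x
    using b[of x] boundary_mult[of "- c" \<psi> x] by simp
  ultimately have "(\<forall>j\<in>J. - c * \<psi> j = - alt T j) \<or> (\<forall>j\<in>J. - c * \<psi> j = alt ({..<2 * q} - T) j)"
    by (rule short_chord[OF T])
  then show ?thesis using that by fastforce
qed

end

text \<open>The relation \<open>u\<close>, \<open>v\<close> traverses a closed walk \<open>P\<close>; the monomial \<open>Q\<close> matches
  the vertices of the walk outside the edge \<open>E 0\<close>, together with the two end points of \<open>y\<close>.\<close>

locale chorded_cycle = alternating_cycle J e q E P u v
  for J :: "'i set" and e :: "'i \<Rightarrow> 'v set" and q E P u v +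
  fixes Q :: "'i multiset" and y :: 'i
  assumes q4: "4 \<le> q" and y_J: "y \<in> J" and Q_J: "set_mset Q \<subseteq> J" and y_Q: "y \<notin># Q"
    and u_Q: "size (u \<inter># Q) \<le> 1" and v_Q: "size (v \<inter># Q) \<le> 1"
    and E_Q: "\<And>k. even k \<Longrightarrow> 0 < k \<Longrightarrow> k < 2 * q \<Longrightarrow> E k \<notin># Q"
begin

lemma not_two_u: "{#c, d#} \<subseteq># Q \<Longrightarrow> \<not> {#c, d#} \<subseteq># u"
  and not_two_v: "{#c, d#} \<subseteq># Q \<Longrightarrow> \<not> {#c, d#} \<subseteq># v"
  using u_Q v_Q size_mset_mono[of "{#c, d#}" "u \<inter># Q"] size_mset_mono[of "{#c, d#}" "v \<inter># Q"]
  by auto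

text \<open>Both edges would be covered by the positive part of \<open>alt T\<close>, which lies in
  \<open>u\<close>, or by its negative part, which lies in \<open>v\<close>; but \<open>Q\<close>
  shares at most one occurrence with either.\<close>

lemma not_two_sgn:
  assumes cd: "{#c, d#} \<subseteq># Q" and T: "T \<subseteq> {..<2 * q}" and \<epsilon>: "\<bar>\<epsilon>\<bar> = 1"
    and le: "\<And>j. j \<in> {c, d} \<Longrightarrow> delta c j + delta d j \<le> \<epsilon> * alt T j"
  shows False
proof -
  have cnt: "int (count {#c, d#} j) = delta c j + delta d j" for j by (auto simp: delta_def)
  have sub: "{#c, d#} \<subseteq># A" if "\<And>j. j \<in> {c, d} \<Longrightarrow> \<epsilon> * alt T j \<le> int (count A j)" for A
  proof (rule mset_subset_eqI)
    fix j show "count {#c, d#} j \<le> count A j"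
    proof (cases "j \<in> {c, d}")
      case True
      then show ?thesis using le[OF True] that[OF True] cnt[of j] by linarith
    qed auto
  qed
  from \<epsilon> have "\<epsilon> = 1 \<or> \<epsilon> = -1" by auto
  then show False
  proof
    assume "\<epsilon> = 1"
    then show False using sub[of u] alt_le_u[OF T] not_two_u[OF cd] by simp
  next
    assume "\<epsilon> = -1"
    then show False using sub[of v] alt_le_v[OF T] not_two_v[OF cd] by simp
  qed
qed

lemma chord_boundary:
  assumes "c \<in># Q" "e c = {x1, x2}"
  shows "boundary (delta c) x = of_bool (x1 = x) + of_bool (x2 = x)"
  using assms boundary_delta[of c x] card_edge[of c] Q_J by fastforce

lemma y_boundary:
  assumes "e y = {x1, x2}"
  shows "boundary (delta y) x = of_bool (x1 = x) + of_bool (x2 = x)"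
  using assms boundary_delta[of y x] card_edge[of y] y_J by fastforce

text \<open>Between positions of opposite parity a single edge closes up the arc, so up to sign it
  equals the arc or its complement, which by mass consists of one position. The second alternative
  is the edge that wraps around from \<open>P (2 * q - 1)\<close> to \<open>P 0\<close>.\<close>

lemma odd_chord:
  assumes ij: "i < j" "j < 2 * q" "odd (i + j)" and c: "c \<in># Q" "e c = {P i, P j}"
  shows "E i = c \<and> j = Suc i \<or> i = 0 \<and> j = 2 * q - 1 \<and> E j = c"
proof -
  have T: "{i..<j} \<subseteq> {..<2 * q}" using ij by auto
  have cJ: "c \<in> J" using c Q_J by auto
  have b: "boundary (alt {i..<j}) x = (-1) ^ i * boundary (delta c) x" for x
  proof -
    have "(-1) ^ j = (- ((-1) ^ i) :: int)" using ij(3) by (cases "even i") auto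
    then show ?thesis using boundary_alt_interval[of i j x] chord_boundary[OF c] ij by (simp add: algebra_simps)
  qed
  have m: "mass (delta c) < int q" using mass_delta[of c] q4 by linarith
  have s: "\<bar>(-1) ^ i :: int\<bar> = 1" by (simp add: power_abs)
  show ?thesis
  proof (rule short_chord_sgn[OF T m s b])
    assume *: "\<forall>l\<in>J. alt {i..<j} l = (-1) ^ i * delta c l"
    then have "mass (alt {i..<j}) = mass (\<lambda>l. (-1) ^ i * delta c l)" unfolding mass_def by simp
    also have "\<dots> \<le> 1" using mass_sgn[OF s, of "delta c"] mass_delta[of c] by simp
    finally have "j = Suc i" using mass_alt[OF T] ij by simp
    moreover have "alt {i..<j} c \<noteq> 0" using * cJ by (simp add: delta_def)
    ultimately have "E i = c" by (cases "E i = c") (auto simp: alt_def delta_def)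
    then show ?thesis using \<open>j = Suc i\<close> by blast
  next
    let ?C = "{..<2 * q} - {i..<j}"
    assume *: "\<forall>l\<in>J. alt ?C l = - ((-1) ^ i) * delta c l"
    then have "mass (alt ?C) = mass (\<lambda>l. - ((-1) ^ i) * delta c l)" unfolding mass_def by simp
    also have "\<dots> \<le> 1" using mass_sgn[of "- ((-1) ^ i)" "delta c"] s mass_delta[of c] by simp
    finally have "card ?C \<le> 1" using mass_alt[of ?C] by simp
    moreover have "card ?C = 2 * q - (j - i)" using T by (subst card_Diff_subset) auto
    ultimately have ij0: "i = 0" "j = 2 * q - 1" using ij by auto
    then have "?C = {j}" using ij by auto
    moreover have "alt ?C c \<noteq> 0" using * cJ by (simp add: delta_def)
    ultimately have "alt {j} c \<noteq> 0" by simp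
    then have "E j = c" by (cases "E j = c") (auto simp: alt_def delta_def)
    then show ?thesis using ij0 by blast
  qed
qed

text \<open>The signed edge vector of a path with edges \<open>c\<close>, \<open>y\<close>, \<open>d\<close>, which serves as a chord of
  length three.\<close>

definition hop :: "'i \<Rightarrow> 'i \<Rightarrow> 'i \<Rightarrow> int" where
  "hop c d j = delta c j + delta d j - delta y j"

lemma mass_hop: "mass (hop c d) \<le> 3"
proof -
  have "hop c d = (\<lambda>j. (delta c j + delta d j) - delta y j)" by (simp add: hop_def[abs_def])
  then show ?thesis
    using mass_diff[of "\<lambda>j. delta c j + delta d j" "delta y"] mass_add[of "delta c" "delta d"]
      mass_delta[of c] mass_delta[of d] mass_delta[of y] by simp
qed

lemma hop_boundary:
  assumes "{#c, d#} \<subseteq># Q" "e c = {x1, z1}" "e d = {x2, z2}" "e y = {z1, z2}"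
  shows "boundary (hop c d) x = of_bool (x1 = x) + of_bool (x2 = x)"
proof -
  have "c \<in># Q" "d \<in># Q" using assms(1) by (auto dest: mset_subset_eqD)
  then show ?thesis
    using chord_boundary[of c x1 z1 x] chord_boundary[of d x2 z2 x] y_boundary[of z1 z2 x] assms
    by (simp add: hop_def[abs_def] boundary_add boundary_diff)
qed

text \<open>With opposite parity the path \<open>c\<close>, \<open>y\<close>, \<open>d\<close> would
  close up an arc. As \<open>3 < q\<close>, the arc or its complement equals the path up to sign and
  carries \<open>c\<close> and \<open>d\<close> with the same sign, against
  \<open>not_two_sgn\<close>.\<close>

lemma hop_even:
  assumes ij: "i < j" "j < 2 * q" and cd: "{#c, d#} \<subseteq># Q"
    and e: "e c = {P i, z1}" "e d = {P j, z2}" "e y = {z1, z2}"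
  shows "even (i + j)"
proof (rule ccontr)
  assume odd: "odd (i + j)"
  have T: "{i..<j} \<subseteq> {..<2 * q}" using ij by auto
  have cdy: "c \<in> J" "d \<in> J" "c \<noteq> y" "d \<noteq> y" using cd Q_J y_Q by (auto dest: mset_subset_eqD)
  have b: "boundary (alt {i..<j}) x = (-1) ^ i * boundary (hop c d) x" for x
  proof -
    have "(-1) ^ j = (- ((-1) ^ i) :: int)" using odd by (cases "even i") auto
    then show ?thesis using boundary_alt_interval[of i j x] hop_boundary[OF cd e] ij by (simp add: algebra_simps)
  qed
  have m: "mass (hop c d) < int q" using mass_hop[of c d] q4 by linarith
  have s: "\<bar>(-1) ^ i :: int\<bar> = 1" by (simp add: power_abs)
  have ss: "(-1) ^ i * (-1) ^ i = (1::int)" by (simp flip: power_mult_distrib)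
  \<comment> \<open>\<open>y\<close> does not occur in \<open>Q\<close>, so its negative entry does
    not interfere at \<open>c\<close> and \<open>d\<close>.\<close>
  have hop: "hop c d j = delta c j + delta d j" if "j \<in> {c, d}" for j
    using that cdy by (auto simp: hop_def delta_def)
  show False
  proof (rule short_chord_sgn[OF T m s b])
    assume *: "\<forall>l\<in>J. alt {i..<j} l = (-1) ^ i * hop c d l"
    show False
      by (rule not_two_sgn[OF cd T s]) (use * hop cdy ss in \<open>auto simp: mult.assoc[symmetric]\<close>)
  next
    let ?C = "{..<2 * q} - {i..<j}"
    assume *: "\<forall>l\<in>J. alt ?C l = - ((-1) ^ i) * hop c d l"
    show False
      by (rule not_two_sgn[OF cd, of ?C "- ((-1) ^ i)"])
        (use * hop cdy ss s in \<open>auto simp: mult.assoc[symmetric]\<close>)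
  qed
qed

text \<open>A chord between positions of equal parity does not close up an arc alone, as the
  boundary of the arc has opposite signs at its ends. Two crossing chords do close up the union of
  the arcs \<open>{p1..<p2}\<close> and \<open>{p3..<p4}\<close>, whose signs agree at
  \<open>p1\<close>, \<open>p3\<close> and at \<open>p2\<close>, \<open>p4\<close>. The parity
  clause serves the degenerate case in which the chords partly cancel.\<close>

lemma crossing:
  assumes p: "2 \<le> p1" "p1 < p2" "p2 < p3" "p3 < p4" "p4 < 2 * q" "even (p1 + p3)" "even (p2 + p4)"
    and b1: "\<And>x. boundary \<psi>1 x = of_bool (P p1 = x) + of_bool (P p3 = x)"
    and b2: "\<And>x. boundary \<psi>2 x = of_bool (P p2 = x) + of_bool (P p4 = x)"
    and m: "mass \<psi>1 + mass \<psi>2 < int q"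
  obtains T \<epsilon>1 \<epsilon>2 where "T \<subseteq> {..<2 * q}" "\<bar>\<epsilon>1\<bar> = 1" "\<bar>\<epsilon>2\<bar> = 1"
    "\<forall>j\<in>J. alt T j = \<epsilon>1 * \<psi>1 j + \<epsilon>2 * \<psi>2 j"
    "\<And>k l. card T \<le> 2 \<Longrightarrow> k \<in> T \<Longrightarrow> l \<in> T \<Longrightarrow> even k = even l"
proof -
  let ?T = "{p1..<p2} \<union> {p3..<p4}"
  let ?\<psi> = "\<lambda>j. (-1) ^ p1 * \<psi>1 j - ((-1) ^ p2) * \<psi>2 j"
  have T: "?T \<subseteq> {..<2 * q}" using p by auto
  have par: "(-1) ^ p3 = ((-1) ^ p1 :: int)" "(-1) ^ p4 = ((-1) ^ p2 :: int)"
    using p(6,7) by (auto simp: minus_one_power_iff)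
  have "boundary (alt ?T) x = boundary (alt {p1..<p2}) x + boundary (alt {p3..<p4}) x" for x
    using p by (subst alt_union) (auto simp: boundary_add)
  moreover have "boundary ?\<psi> x = (-1) ^ p1 * (of_bool (P p1 = x) + of_bool (P p3 = x)) -
      (-1) ^ p2 * (of_bool (P p2 = x) + of_bool (P p4 = x))" for x
    by (simp add: boundary_diff boundary_mult b1 b2)
  ultimately have b: "boundary (alt ?T) x = 1 * boundary ?\<psi> x" for x
    using boundary_alt_interval[of p1 p2 x] boundary_alt_interval[of p3 p4 x] p
    by (simp add: par distrib_left)
  have s: "\<bar>(-1) ^ i :: int\<bar> = 1" for i by (simp add: power_abs)
  have m': "mass ?\<psi> < int q"
    using mass_diff[of "\<lambda>j. (-1) ^ p1 * \<psi>1 j" "\<lambda>j. (-1) ^ p2 * \<psi>2 j"] m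
      mass_sgn[OF s, of p1 \<psi>1] mass_sgn[OF s, of p2 \<psi>2] by simp
  show ?thesis
  proof (rule short_chord_sgn[OF T m' _ b])
    assume *: "\<forall>j\<in>J. alt ?T j = 1 * ?\<psi> j"
    show ?thesis
    proof (rule that[OF T s[of p1], of "- ((-1) ^ p2)"])
      fix k l assume c: "card ?T \<le> 2" and kl: "k \<in> ?T" "l \<in> ?T"
      \<comment> \<open>At most two positions means that both arcs have length one.\<close>
      have "card ?T = (p2 - p1) + (p4 - p3)" using p by (subst card_Un_disjoint) auto
      with c p have "?T = {p1, p3}" by auto
      then show "even k = even l" using kl p by auto
    qed (use * s in auto)
  next
    let ?C = "{..<2 * q} - ?T"
    assume *: "\<forall>j\<in>J. alt ?C j = - 1 * ?\<psi> j"
    show ?thesis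
    proof (rule that[of ?C "- ((-1) ^ p1)" "(-1) ^ p2"])
      fix k l assume c: "card ?C \<le> 2"
      \<comment> \<open>The complement has at least three positions, so the clause is vacuous; here
        \<open>2 \<le> p1\<close> enters.\<close>
      have "{0, 1, p2} \<subseteq> ?C" using p by auto
      then have "card {0, 1, p2} \<le> card ?C" by (intro card_mono) auto
      then show "even k = even l" using c p by auto
    qed (use * s in auto)
  qed simp
qed

text \<open>The edges \<open>c\<close> and \<open>d\<close> survive in \<open>alt T\<close> with
  equal sign, against \<open>not_two_sgn\<close>, unless \<open>b\<close> cancels one of them. Then
  only the other one, \<open>w\<close>, and \<open>y\<close> remain, with opposite signs, so
  \<open>T\<close> has at most two positions and contains both parities, which \<open>par\<close>
  forbids.\<close>

lemma no_crossing:
  assumes T: "T \<subseteq> {..<2 * q}" and \<epsilon>: "\<bar>\<epsilon>1\<bar> = 1" "\<bar>\<epsilon>2\<bar> = 1"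
    and alt: "\<forall>j\<in>J. alt T j = \<epsilon>1 * hop c d j + \<epsilon>2 * delta b j"
    and par: "\<And>k l. card T \<le> 2 \<Longrightarrow> k \<in> T \<Longrightarrow> l \<in> T \<Longrightarrow> even k = even l"
    and Q: "{#c, d#} \<subseteq># Q" "b \<in># Q"
  shows False
proof -
  have cdy: "c \<in> J" "d \<in> J" "b \<in> J" "c \<noteq> y" "d \<noteq> y" "b \<noteq> y"
    using Q Q_J y_Q by (auto dest: mset_subset_eqD)
  have one: "\<epsilon>1 = 1 \<or> \<epsilon>1 = -1" "\<epsilon>2 = 1 \<or> \<epsilon>2 = -1" using \<epsilon> by arith+
  then have e1: "\<epsilon>1 = 1 \<or> \<epsilon>1 = -1" "\<epsilon>2 = \<epsilon>1 \<or> \<epsilon>2 = -\<epsilon>1" "\<epsilon>1 * \<epsilon>1 = 1" by auto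
  have alt': "\<epsilon>1 * alt T j = delta c j + delta d j - delta y j + \<epsilon>1 * \<epsilon>2 * delta b j" if "j \<in> J" for j
    using alt that one(1) by (auto simp: hop_def)
  consider "\<epsilon>2 = \<epsilon>1" | "\<epsilon>2 = -\<epsilon>1" "b \<noteq> c" "b \<noteq> d" |
    w where "\<epsilon>2 = -\<epsilon>1" "w \<in> J" "w \<noteq> y" "\<And>j. delta c j + delta d j = delta b j + delta w j"
    using e1(2) cdy by (metis add.commute)
  then show False
  proof cases
    case 1
    show False
      by (rule not_two_sgn[OF Q(1) T \<epsilon>(1)]) (use alt' cdy e1 1 in \<open>auto simp: delta_def\<close>)
  next
    case 2
    show False
      by (rule not_two_sgn[OF Q(1) T \<epsilon>(1)]) (use alt' cdy e1 2 in \<open>auto simp: delta_def\<close>)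
  next
    case 3
    have al2: "\<epsilon>1 * alt T j = delta w j - delta y j" if "j \<in> J" for j
      using alt'[OF that] 3 e1(3) by simp
    have "mass (alt T) = mass (\<lambda>j. \<epsilon>1 * alt T j)" using mass_sgn[OF \<epsilon>(1)] by simp
    also have "\<dots> = mass (\<lambda>j. delta w j - delta y j)" unfolding mass_def using al2 by simp
    also have "\<dots> \<le> 2" using mass_diff[of "delta w" "delta y"] mass_delta[of w] mass_delta[of y] by simp
    finally have cT: "card T \<le> 2" using mass_alt[OF T] by simp
    have 1: "\<epsilon>1 * alt T w = 1" "\<epsilon>1 * alt T y = -1" using al2 3 y_J by (auto simp: delta_def)
    have "\<not> (\<forall>k\<in>T. even k)"
    proof
      assume "\<forall>k\<in>T. even k"
      then have "0 \<le> alt T j" for j unfolding alt_def by (intro sum_nonneg) (auto simp: delta_def)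
      then have "0 \<le> alt T w" "0 \<le> alt T y" by auto
      then show False using 1 e1(1) by auto
    qed
    moreover have "\<not> (\<forall>k\<in>T. odd k)"
    proof
      assume "\<forall>k\<in>T. odd k"
      then have "alt T j \<le> 0" for j unfolding alt_def by (intro sum_nonpos) (auto simp: delta_def)
      then have "alt T w \<le> 0" "alt T y \<le> 0" by auto
      then show False using 1 e1(1) by auto
    qed
    ultimately show False using par[OF cT] by blast
  qed
qed

end

subsection \<open>Linear syzygies of edge rings\<close>

context chorded_cycle begin

text \<open>If \<open>P k0\<close> were the end \<open>z1\<close> of \<open>y\<close>, then,
  depending on the parity of \<open>s + k0\<close>, the edge \<open>c\<close> or the path
  \<open>d\<close>, \<open>y\<close> would be a short chord ending there. It must run along the
  walk, so \<open>c\<close> or \<open>d\<close> is an edge of the walk next to \<open>s\<close> or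
  \<open>t\<close>, at an odd position by \<open>E_Q\<close>. Together with \<open>E kb\<close> this
  puts two edges of \<open>Q\<close> into \<open>v\<close>.\<close>

lemma no_return:
  assumes s: "2 \<le> s" "s < 2 * q" and t: "2 \<le> t" "t < 2 * q" and st: "even (s + t)"
    and e: "e c = {P s, z1}" "e d = {P t, z2}" "e y = {z1, z2}"
    and kb: "odd kb" "kb < 2 * q" "s \<notin> {kb, Suc kb}" "t \<notin> {kb, Suc kb}"
    and Q: "{#c, d#} \<subseteq># Q" "{#c, E kb#} \<subseteq># Q" "{#d, E kb#} \<subseteq># Q"
    and k0: "k0 < 2 * q"
  shows "P k0 \<noteq> z1"
proof
  assume z1: "P k0 = z1"
  have cdQ: "c \<in># Q" "d \<in># Q" using Q(1) by (auto dest: mset_subset_eqD)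
  have cdJ: "c \<in> J" "d \<in> J" "c \<noteq> y" "d \<noteq> y" using cdQ Q_J y_Q by auto
  have incident: False if "f \<in># Q" "{#f, E kb#} \<subseteq># Q" "E k = f" "0 < k" "k < 2 * q" "k \<noteq> kb" for f k
  proof -
    have "odd k" using E_Q[of k] that by auto
    then have "{#E k, E kb#} \<subseteq># v" using two_v[of k kb] that kb by auto
    then show False using not_two_v[OF that(2)] that(3) by simp
  qed
  have sk: "s \<noteq> k0" using z1 e(1) card_edge[of c] cdJ by auto
  show False
  proof (cases "even (s + k0)")
    case False
    have "\<exists>k. E k = c \<and> 0 < k \<and> k < 2 * q \<and> (k = s \<or> Suc k = s)"
    proof (cases "k0 < s")
      case True
      have "E k0 = c \<and> s = Suc k0 \<or> k0 = 0 \<and> s = 2 * q - 1 \<and> E s = c"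
        using odd_chord[OF True s(2) _ cdQ(1)] False e(1) z1 by (auto simp: insert_commute add.commute)
      then show ?thesis using s k0 by auto
    next
      case False2: False
      then have "s < k0" using sk by simp
      then have "E s = c \<and> k0 = Suc s \<or> s = 0 \<and> k0 = 2 * q - 1 \<and> E k0 = c"
        using odd_chord[OF _ k0 _ cdQ(1)] False e(1) z1 by auto
      then show ?thesis using s k0 by auto
    qed
    then show False using incident[OF cdQ(1) Q(2)] kb by auto
  next
    case True
    then have tk: "even (t + k0)" using st by presburger
    have "t \<noteq> k0"
    proof
      assume "t = k0"
      then have "e d = e y" using e z1 by auto
      then show False using edge_eqI cdJ y_J by blast
    qed
    let ?\<psi> = "\<lambda>j. delta d j - delta y j"
    have boundary: "boundary ?\<psi> x = of_bool (P t = x) - of_bool (P k0 = x)" for x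
      using chord_boundary[OF cdQ(2) e(2), of x] y_boundary[OF e(3), of x] z1 by (simp add: boundary_diff)
    have m2: "mass ?\<psi> \<le> 2" using mass_diff[of "delta d" "delta y"] mass_delta[of d] mass_delta[of y] by simp
    then have m: "mass ?\<psi> < int q" using q4 by linarith
    have \<psi>d: "?\<psi> d = 1" using cdJ by (simp add: delta_def)
    have "\<exists>k. E k = d \<and> 0 < k \<and> k < 2 * q \<and> (k = t \<or> Suc k = t)"
    proof -
      define i where "i = min t k0"
      define j where "j = max t k0"
      \<comment> \<open>The arc from \<open>i\<close> to \<open>j\<close> may run from
        \<open>t\<close> to \<open>k0\<close> or backwards; \<open>\<epsilon>\<close> records the
        direction.\<close>
      define \<epsilon> :: int where "\<epsilon> = (if t < k0 then 1 else -1)"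
      have ij: "i < j" "j < 2 * q" "even (i + j)"
        using \<open>t \<noteq> k0\<close> t k0 tk by (auto simp: i_def j_def min_def max_def add.commute)
      have T: "{i..<j} \<subseteq> {..<2 * q}" using ij by auto
      have \<epsilon>: "\<bar>\<epsilon> * (-1) ^ i\<bar> = 1" by (simp add: \<epsilon>_def abs_mult power_abs)
      have "(-1) ^ j = ((-1) ^ i :: int)" using ij(3) by (auto simp: minus_one_power_iff)
      then have b: "boundary (alt {i..<j}) x = \<epsilon> * (-1) ^ i * boundary ?\<psi> x" for x
        using boundary_alt_interval[of i j x] ij
        by (auto simp: boundary \<epsilon>_def i_def j_def min_def max_def algebra_simps)
      have card2: "card T' \<le> 2" if "T' \<subseteq> {..<2 * q}" "\<bar>\<delta>\<bar> = 1" "\<forall>j\<in>J. alt T' j = \<delta> * ?\<psi> j" for T' \<delta>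
      proof -
        have "mass (alt T') = mass (\<lambda>j. \<delta> * ?\<psi> j)" unfolding mass_def using that by simp
        then show ?thesis using mass_sgn[OF that(2), of ?\<psi>] m2 mass_alt[OF that(1)] by simp
      qed
      show ?thesis
      proof (rule short_chord_sgn[OF T m \<epsilon> b])
        assume *: "\<forall>l\<in>J. alt {i..<j} l = \<epsilon> * (-1) ^ i * ?\<psi> l"
        have "j - i \<le> 2" using card2[OF T \<epsilon> *] by simp
        then have j: "j = Suc (Suc i)" using ij by presburger
        then have "{i..<j} = {i, Suc i}" by auto
        then have "alt {i..<j} d = (-1) ^ i * (delta (E i) d - delta (E (Suc i)) d)"
          by (simp add: alt_def algebra_simps)
        with * cdJ \<psi>d have "(-1) ^ i * (delta (E i) d - delta (E (Suc i)) d) = (-1) ^ i * \<epsilon>" by simp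
        then have "delta (E i) d - delta (E (Suc i)) d = \<epsilon>" by simp
        then have "if t < k0 then E i = d else E (Suc i) = d"
          by (auto simp: delta_def \<epsilon>_def of_bool_def split: if_splits)
        moreover have "if t < k0 then i = t else Suc i = t - 1 \<and> 0 < t - 1 \<and> Suc (Suc i) = t"
          using j \<open>t \<noteq> k0\<close> t by (auto simp: i_def j_def min_def max_def)
        ultimately show ?thesis using t by (cases "t < k0") auto
      next
        let ?C = "{..<2 * q} - {i..<j}"
        assume *: "\<forall>l\<in>J. alt ?C l = - (\<epsilon> * (-1) ^ i) * ?\<psi> l"
        have "card ?C \<le> 2" by (rule card2[OF _ _ *]) (use \<epsilon> in auto)
        moreover have "card ?C = 2 * q - (j - i)" using T by (subst card_Diff_subset) auto
        \<comment> \<open>The arc has even length and its complement at most two positions. As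
          \<open>2 \<le> t\<close>, the end at \<open>i\<close> is then \<open>k0\<close>.\<close>
        ultimately have "j = 2 * q - 2 + i \<and> i \<le> 1" using ij by presburger
        then have i: "i = 0 \<and> j = 2 * q - 2 \<or> i = 1 \<and> j = 2 * q - 1" using q4 by arith
        then have ti: "t = j" "k0 = i" "\<epsilon> = -1"
          using t ij q4 by (auto simp: i_def j_def \<epsilon>_def min_def max_def split: if_splits)
        have d: "alt ?C d = (-1) ^ i" using * cdJ \<psi>d ti by simp
        from i show ?thesis
        proof
          assume i: "i = 0 \<and> j = 2 * q - 2"
          then have "?C = {j, Suc j}" using q4 by auto
          with d i have "delta (E j) d - delta (E (Suc j)) d = 1" by (simp add: alt_def)
          then have "E j = d" by (auto simp: delta_def of_bool_def split: if_splits)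
          then show ?thesis using ti t by auto
        next
          assume i: "i = 1 \<and> j = 2 * q - 1"
          then have "?C = {0, j}" "odd j" using q4 by auto
          with d i have "delta (E j) d - delta (E 0) d = 1" using q4 by (simp add: alt_def)
          then have "E j = d" by (auto simp: delta_def of_bool_def split: if_splits)
          then show ?thesis using ti t by auto
        qed
      qed
    qed
    then show False using incident[OF cdQ(2) Q(3)] kb by auto
  qed
qed

text \<open>The slots below \<open>2 * q\<close> are the positions of the walk without the ends of
  \<open>E 0\<close>, the last two slots are the ends of \<open>y\<close>; \<open>\<tau>\<close> and
  \<open>lab\<close> come from \<open>edge_matching\<close> applied to \<open>Q\<close>. For
  \<open>q = 4\<close> parity yields an edge of the walk in \<open>Q\<close>, and
  \<open>no_return\<close> applies. For larger \<open>q\<close> some chord crosses the path through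
  \<open>y\<close>, and the hypotheses are contradictory.\<close>

theorem y_off_walk:
  fixes y1 y2 :: 'v and \<tau> :: "nat \<Rightarrow> nat" and lab :: "nat \<Rightarrow> 'i" and pt
  defines "pt \<equiv> \<lambda>i. if i < 2 * q then P i else if i = 2 * q then y1 else y2"
  assumes ey: "e y = {y1, y2}"
    and \<tau>: "\<And>i. i \<in> {2..<2 * q + 2} \<Longrightarrow> \<tau> i \<in> {2..<2 * q + 2} \<and> \<tau> i \<noteq> i \<and> \<tau> (\<tau> i) = i \<and>
      lab (\<tau> i) = lab i \<and> e (lab i) = {pt i, pt (\<tau> i)} \<and> lab i \<in># Q"
    and orb: "\<And>i k. i \<in> {2..<2 * q + 2} \<Longrightarrow> k \<in> {2..<2 * q + 2} \<Longrightarrow> k \<noteq> i \<Longrightarrow> k \<noteq> \<tau> i \<Longrightarrow>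
      {#lab i, lab k#} \<subseteq># Q"
    and k0: "k0 < 2 * q"
  shows "P k0 \<notin> e y"
proof -
  let ?I = "{2..<2 * q + 2}"
  define s where "s = \<tau> (2 * q)"
  define t where "t = \<tau> (Suc (2 * q))"
  have ends: "2 * q \<in> ?I" "Suc (2 * q) \<in> ?I" using q4 by auto
  have sI: "s \<in> ?I" "t \<in> ?I" "\<tau> s = 2 * q" "\<tau> t = Suc (2 * q)"
    using \<tau>[OF ends(1)] \<tau>[OF ends(2)] by (auto simp: s_def t_def)
  \<comment> \<open>Otherwise the two ends of \<open>y\<close> would be joined by an edge of
    \<open>Q\<close>, which could only be \<open>y\<close>.\<close>
  have "s \<noteq> Suc (2 * q)"
  proof
    assume "s = Suc (2 * q)"
    then have "e (lab (2 * q)) = e y" "lab (2 * q) \<in># Q"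
      using \<tau>[OF ends(1)] ey by (auto simp: s_def pt_def)
    then show False using edge_eqI[of "lab (2 * q)" y] y_J y_Q Q_J by auto
  qed
  then have st: "2 \<le> s" "s < 2 * q" "2 \<le> t" "t < 2 * q" "s \<noteq> t"
    using sI \<tau>[OF ends(1)] \<tau>[OF ends(2)] by (auto simp: s_def t_def less_Suc_eq)
  define c where "c = lab s"
  define d where "d = lab t"
  have cd: "{#c, d#} \<subseteq># Q" unfolding c_def d_def by (rule orb) (use sI st in auto)
  have ec: "e c = {P s, y1}" "e d = {P t, y2}"
    using \<tau>[OF sI(1)] \<tau>[OF sI(2)] st sI by (auto simp: c_def d_def pt_def)
  have st_even: "even (s + t)"
  proof (cases "s < t")
    case True
    show ?thesis by (rule hop_even[OF True st(4) cd ec ey])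
  next
    case False
    then have "t < s" using st by simp
    have "even (t + s)"
      by (rule hop_even[OF \<open>t < s\<close> st(2) _ ec(2,1), of])
        (use cd ey in \<open>auto simp: add_mset_commute insert_commute\<close>)
    then show ?thesis by (simp add: add.commute)
  qed
  have inner: "\<tau> k \<in> {2..<2 * q} - {s, t}" if "k \<in> {2..<2 * q} - {s, t}" for k
  proof -
    have "k \<in> ?I" using that by auto
    then have "\<tau> k \<in> ?I" "\<tau> (\<tau> k) = k" using \<tau> by auto
    moreover have "\<tau> k \<noteq> 2 * q" "\<tau> k \<noteq> Suc (2 * q)" "\<tau> k \<noteq> s" "\<tau> k \<noteq> t"
      using \<open>\<tau> (\<tau> k) = k\<close> that sI by (auto simp: s_def t_def)
    ultimately show ?thesis by auto
  qed
  have chord: "\<tau> k \<noteq> k" "\<tau> (\<tau> k) = k" "e (lab k) = {P k, P (\<tau> k)}" "lab k \<in># Q" "lab (\<tau> k) = lab k"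
    if "k \<in> {2..<2 * q} - {s, t}" for k
    using \<tau>[of k] that inner[OF that] by (auto simp: pt_def)
  have parallel: "(E k = lab k \<and> \<tau> k = Suc k) \<or> (E (\<tau> k) = lab k \<and> k = Suc (\<tau> k))"
    if k: "k \<in> {2..<2 * q} - {s, t}" and o: "odd (k + \<tau> k)" for k
  proof (cases "k < \<tau> k")
    case True
    then show ?thesis
      using odd_chord[OF True _ o chord(4)[OF k] chord(3)[OF k]] inner[OF k] k by auto
  next
    case False
    then have lt: "\<tau> k < k" using chord(1)[OF k] by simp
    then show ?thesis
      using odd_chord[OF lt _ _ chord(4)[OF k]] chord(3)[OF k] o inner[OF k] k
      by (auto simp: insert_commute add.commute)
  qed
  show ?thesis
  proof (cases "q = 4")
    case True
    \<comment> \<open>\<open>f\<close> is \<open>\<tau>\<close> with \<open>s\<close> and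
      \<open>t\<close> matched to each other. If no even position had an odd partner,
      \<open>f\<close> would be a fixed-point-free involution of the three even positions.\<close>
    define f where "f k = (if k = s then t else if k = t then s else \<tau> k)" for k
    have "\<exists>k\<in>{2,4,6} - {s, t}. odd (\<tau> k)"
    proof (rule ccontr)
      assume *: "\<not> ?thesis"
      have X: "k \<in> {2, 4, 6::nat} \<longleftrightarrow> even k \<and> 2 \<le> k \<and> k < 2 * q" for k
        unfolding True insert_iff empty_iff by presburger
      have "even (card {2, 4, 6::nat})"
      proof (rule even_card_fpf_involution[of _ f])
        fix k assume k: "k \<in> {2, 4, 6::nat}"
        have kk: "k \<in> {2..<2 * q} - {s, t}" if "k \<noteq> s" "k \<noteq> t" using k that X by auto
        show "f k \<in> {2, 4, 6}"
        proof (cases "k = s \<or> k = t")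
          case True
          then show ?thesis using k st st_even unfolding X by (auto simp: f_def)
        next
          case False
          then have "\<tau> k \<in> {2..<2 * q}" using inner kk by auto
          moreover have "even (\<tau> k)" using * k False by auto
          ultimately have "\<tau> k \<in> {2, 4, 6}" unfolding X by auto
          then show ?thesis using False by (simp add: f_def)
        qed
        show "f k \<noteq> k" using st kk chord(1) by (auto simp: f_def)
        show "f (f k) = k" using st kk chord(2) inner by (auto simp: f_def)
      qed simp
      then show False by simp
    qed
    then obtain k where "k \<in> {2,4,6} - {s, t}" "odd (\<tau> k)" by blast
    then have k: "k \<in> {2..<2 * q} - {s, t}" "odd (k + \<tau> k)" using True by auto
    \<comment> \<open>By \<open>parallel\<close> the two partners are adjacent on the walk; the
      smaller one is the position of the edge between them.\<close>
    define kb where "kb = min k (\<tau> k)"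
    have kb: "kb \<in> {2..<2 * q} - {s, t}" "\<tau> kb = Suc kb" "E kb = lab kb"
      using parallel[OF k] k inner[OF k(1)] chord[OF k(1)] by (auto simp: kb_def min_def)
    have "E kb \<in># Q" using kb chord(4) by auto
    then have "odd kb" using E_Q[of kb] kb by auto
    have kbs: "s \<notin> {kb, Suc kb}" "t \<notin> {kb, Suc kb}" using inner[OF kb(1)] kb by auto
    have ck: "{#c, E kb#} \<subseteq># Q" "{#d, E kb#} \<subseteq># Q"
      unfolding c_def d_def kb(3) by (rule orb; use kb sI in auto)+
    have 1: "P k0 \<noteq> y1"
      by (rule no_return[OF st(1-4) st_even ec ey \<open>odd kb\<close> _ kbs cd ck k0]) (use kb in auto)
    have 2: "P k0 \<noteq> y2"
      by (rule no_return[OF st(3,4,1,2) _ ec(2,1) _ \<open>odd kb\<close> _ kbs(2,1) _ ck(2,1) k0])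
        (use kb st_even ey cd in \<open>auto simp: insert_commute add_mset_commute add.commute\<close>)
    show ?thesis using 1 2 ey by auto
  next
    case False
    then have q5: "5 \<le> q" using q4 by simp
    define i where "i = min s t"
    define j where "j = max s t"
    have ij: "2 \<le> i" "i < j" "j < 2 * q" "even (i + j)" "{s, t} = {i, j}"
      using st st_even by (auto simp: i_def j_def min_def max_def add.commute)
    have boundary_hop: "boundary (hop c d) x = of_bool (P i = x) + of_bool (P j = x)" for x
      using hop_boundary[OF cd ec ey] ij(5) by (auto simp: doubleton_eq_iff add.commute)
    \<comment> \<open>As \<open>i + j\<close> is even, an odd number of positions lies strictly
      between the two ends of the path, so some chord leads out of this interval.\<close>
    let ?X = "{i<..<j}"
    have X: "k \<in> {2..<2 * q} - {s, t}" if "k \<in> ?X" for k using that ij by auto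
    have "card ?X = j - i - 1" by simp
    then have "odd (card ?X)" using ij by presburger
    then have "\<exists>k\<in>?X. \<tau> k \<notin> ?X"
      using even_card_fpf_involution[of ?X \<tau>] chord(1,2) X by (metis finite_greaterThanLessThan)
    then obtain k where k: "k \<in> ?X" "\<tau> k \<notin> ?X" by blast
    define l where "l = \<tau> k"
    have l: "2 \<le> l" "l < 2 * q" "l \<noteq> i" "l \<noteq> j" using inner[OF X[OF k(1)]] ij(5) by (auto simp: l_def)
    then have lout: "l < i \<or> j < l" using k(2) by (auto simp: l_def)
    have "\<not> (\<tau> k = Suc k \<or> k = Suc (\<tau> k))" using lout k(1) by (auto simp: l_def)
    then have kl: "even (k + l)" using parallel[OF X[OF k(1)]] unfolding l_def by blast
    have kQ: "lab k \<in># Q" by (rule chord(4)[OF X[OF k(1)]])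
    have boundary_k: "boundary (delta (lab k)) x = of_bool (P k = x) + of_bool (P l = x)" for x
      by (rule chord_boundary[OF kQ]) (use chord(3)[OF X[OF k(1)]] in \<open>simp add: l_def\<close>)
    \<comment> \<open>The total mass can be four, hence the restriction to
      \<open>5 \<le> q\<close>.\<close>
    have m: "mass (hop c d) + mass (delta (lab k)) < int q"
      using mass_hop[of c d] mass_delta[of "lab k"] q5 by linarith
    from lout have False
    proof
      assume "j < l"
      show False
      proof (rule crossing[of i k j l "hop c d" "delta (lab k)"])
        fix T \<epsilon>1 \<epsilon>2
        assume *: "T \<subseteq> {..<2 * q}" "\<bar>\<epsilon>1\<bar> = 1" "\<bar>\<epsilon>2\<bar> = 1"
          "\<forall>j\<in>J. alt T j = \<epsilon>1 * hop c d j + \<epsilon>2 * delta (lab k) j"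
          "\<And>k l. card T \<le> 2 \<Longrightarrow> k \<in> T \<Longrightarrow> l \<in> T \<Longrightarrow> even k = even l"
        show False by (rule no_crossing[OF *(1-4) *(5) cd kQ])
      qed (use \<open>j < l\<close> k(1) ij l kl boundary_hop boundary_k m in auto)
    next
      assume "l < i"
      show False
      proof (rule crossing[of l i k j "delta (lab k)" "hop c d"])
        fix T \<epsilon>1 \<epsilon>2
        assume *: "T \<subseteq> {..<2 * q}" "\<bar>\<epsilon>1\<bar> = 1" "\<bar>\<epsilon>2\<bar> = 1"
          "\<forall>j\<in>J. alt T j = \<epsilon>1 * delta (lab k) j + \<epsilon>2 * hop c d j"
          "\<And>k l. card T \<le> 2 \<Longrightarrow> k \<in> T \<Longrightarrow> l \<in> T \<Longrightarrow> even k = even l"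
        show False
          by (rule no_crossing[OF *(1,3,2) _ *(5) cd kQ]) (use *(4) in \<open>auto simp: add.commute\<close>)
      qed (use \<open>l < i\<close> k(1) ij l kl boundary_hop boundary_k m in \<open>auto simp: add.commute\<close>)
    qed
    then show ?thesis ..
  qed
qed

end

section \<open>Chorded cycles obtained from linear syzygies\<close>

context edge_lattice begin

text \<open>The greedy walk returns to its start, so it uses submultisets of \<open>u\<close> and
  \<open>v\<close> with equal vertex degrees. By minimality these have at least \<open>q\<close>
  elements, hence they are all of \<open>u\<close> and \<open>v\<close>.\<close>

lemma alternating_closed_walk:
  assumes u: "set_mset u \<subseteq> J" and v: "set_mset v \<subseteq> J" and sz: "size u = q"
    and uv: "u \<inter># v = {#}" and vertex_deg: "\<And>x. vertex_deg u x = vertex_deg v x" and a: "a \<in># u"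
  obtains E P where "alternating_cycle J e q E P u v" "E 0 = a"
proof -
  obtain x where x: "x \<in> e a" using a u card_edge[of a] by (fastforce simp: card_2_iff)
  obtain as bs xs ys where w: "length bs = length as" "length xs = length as" "length ys = length as"
    "mset as \<subseteq># u" "mset bs \<subseteq># v" "as \<noteq> []" "as ! 0 = a" "xs ! 0 = x" and
    e: "\<And>i. i < length as \<Longrightarrow> e (as ! i) = {xs ! i, ys ! i} \<and> e (bs ! i) = {ys ! i, (xs @ [x]) ! Suc i}"
    using alternating_walk[OF u v _ a x, of x] vertex_deg by auto
  define k where "k = length as"
  have J: "as ! i \<in> J" "bs ! i \<in> J" if "i < k" for i
  proof -
    have "as ! i \<in> set as" "bs ! i \<in> set bs" using that w(1) by (simp_all add: k_def)
    then show "as ! i \<in> J" "bs ! i \<in> J"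
      using u v set_mset_mono[OF w(4)] set_mset_mono[OF w(5)] by auto
  qed
  have vertex_deg_list: "vertex_deg (mset cs) z = (\<Sum>i<length cs. of_bool (z \<in> e (cs ! i)))" for cs z
  proof (induction cs)
    case (Cons c cs)
    then show ?case by (simp add: vertex_deg_add_mset sum.lessThan_Suc_shift del: sum.lessThan_Suc)
  qed simp
  have bool: "of_bool (z \<in> e c) = (of_bool (p = z) + of_bool (p' = z) :: nat)"
    if "e c = {p, p'}" "c \<in> J" for c p p' z
    using that card_edge[of c] by fastforce
  \<comment> \<open>Both sides count the vertices of the walk, with \<open>xs\<close> shifted by one
    on the right; the shift is harmless because the walk is closed.\<close>
  have "vertex_deg (mset as) z = vertex_deg (mset bs) z" for z
  proof -
    define g :: "nat \<Rightarrow> nat" where "g i = of_bool ((xs @ [x]) ! i = z)" for i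
    have as_i: "of_bool (z \<in> e (as ! i)) = g i + of_bool (ys ! i = z)"
      and bs_i: "of_bool (z \<in> e (bs ! i)) = of_bool (ys ! i = z) + g (Suc i)" if "i < k" for i
      using bool[of "as ! i" "xs ! i" "ys ! i" z] bool[of "bs ! i" "ys ! i" "(xs @ [x]) ! Suc i" z]
        e[of i] J[of i] that w(2) by (simp_all add: g_def k_def nth_append)
    have "vertex_deg (mset as) z = (\<Sum>i<k. g i + of_bool (ys ! i = z))"
      unfolding vertex_deg_list k_def[symmetric]
      by (intro sum.cong refl) (use as_i in auto)
    also have "\<dots> = (\<Sum>i<k. g i) + (\<Sum>i<k. of_bool (ys ! i = z))" by (rule sum.distrib)
    also have "(\<Sum>i<k. g i) = (\<Sum>i<k. g (Suc i))"
    proof -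
      have "g 0 = g k" using w by (simp add: g_def k_def nth_append)
      then show ?thesis using sum.lessThan_Suc_shift[of g k] sum.lessThan_Suc[of g k] by simp
    qed
    also have "\<dots> + (\<Sum>i<k. of_bool (ys ! i = z)) = (\<Sum>i<k. of_bool (ys ! i = z) + g (Suc i))"
      by (simp add: sum.distrib)
    also have "\<dots> = vertex_deg (mset bs) z"
      unfolding vertex_deg_list w(1) k_def[symmetric]
      by (intro sum.cong refl) (use bs_i in auto)
    finally show ?thesis .
  qed
  moreover have "mset as \<noteq> mset bs"
  proof
    assume "mset as = mset bs"
    then have "a \<in># u \<inter># v" using w by (metis mset_subset_eqD nth_mem_mset length_greater_0_conv inter_iff)
    then show False using uv by simp
  qed
  moreover have "set_mset (mset as) \<subseteq> J" "set_mset (mset bs) \<subseteq> J"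
    using w(4,5) u v set_mset_mono by (metis subset_trans)+
  ultimately have "q \<le> k" using vertex_deg_eq_size_ge[of "mset as" "mset bs"] by (simp add: k_def)
  moreover have "size v = q" using size_eq_if_vertex_deg_eq[OF u v vertex_deg] sz by simp
  ultimately have as: "mset as = u" "mset bs = v" and k: "k = q"
    using w sz size_mset_mono[OF w(4)] mset_subset_size[of "mset as" u] mset_subset_size[of "mset bs" v]
    by (auto simp: k_def subset_mset.less_le)
  define E where "E i = (if even i then as ! (i div 2) else bs ! (i div 2))" for i
  define P where "P i = (if i = 2 * q then x else if even i then xs ! (i div 2) else ys ! (i div 2))" for i
  have evens: "{k. k < 2 * q \<and> even k} = (\<lambda>i. 2 * i) ` {..<q}" by (auto elim!: evenE)
  have odds: "{k. k < 2 * q \<and> odd k} = (\<lambda>i. 2 * i + 1) ` {..<q}" by (auto elim!: oddE)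
  have list: "mset cs = image_mset ((!) cs) (mset_set {..<length cs})" for cs
    by (metis lessThan_atLeast0 map_nth mset_map mset_upt)
  have "alternating_cycle J e q E P u v"
  proof
    fix i assume i: "i < 2 * q"
    then have i2: "i div 2 < k" using k by auto
    then show "E i \<in> J" using J by (simp add: E_def)
    show "e (E i) = {P i, P (Suc i)}"
    proof (cases "even i")
      case True
      then have "Suc i \<noteq> 2 * q" by presburger
      then show ?thesis using True i e[of "i div 2"] i2 by (simp add: E_def P_def k_def)
    next
      case False
      have "(xs @ [x]) ! Suc (i div 2) = P (Suc i)"
        using False i k w(2) by (auto simp: P_def nth_append k_def elim!: oddE)
      then show ?thesis using False i e[of "i div 2"] i2 by (simp add: E_def P_def k_def)
    qed
  next
    show "P (2 * q) = P 0" using w by (simp add: P_def)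
  next
    show "u = image_mset E (mset_set {k. k < 2 * q \<and> even k})"
      unfolding evens as(1)[symmetric] list[of as] k[unfolded k_def]
      by (subst image_mset_mset_set[symmetric]) (auto simp: inj_on_def E_def multiset.map_comp intro!: image_mset_cong)
  next
    show "v = image_mset E (mset_set {k. k < 2 * q \<and> odd k})"
      unfolding odds as(2)[symmetric] list[of bs] w(1) k[unfolded k_def]
      by (subst image_mset_mset_set[symmetric]) (auto simp: inj_on_def E_def multiset.map_comp intro!: image_mset_cong)
  qed (rule uv)
  moreover have "E 0 = a" using w by (simp add: E_def)
  ultimately show ?thesis by (rule that)
qed

text \<open>The monomials \<open>u y\<close>, \<open>v y\<close> and \<open>a Q\<close> have degree
  \<open>q + 1\<close> and equal vertex degrees, so by minimality distinct ones share at most one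
  edge occurrence. This makes the closed walk through \<open>u\<close> and \<open>v\<close>, started
  at \<open>a\<close>, a chorded cycle for \<open>Q\<close> and \<open>y\<close>.\<close>

theorem linear_syzygy_disjoint:
  assumes q4: "4 \<le> q" and J: "set_mset u \<subseteq> J" "set_mset v \<subseteq> J" "set_mset Q \<subseteq> J" "y \<in> J"
    and sz: "size u = q" and uv: "u \<noteq> v" "\<And>x. vertex_deg u x = vertex_deg v x"
    and a: "a \<in># u" "a \<noteq> y"
    and Q: "Q \<noteq> add_mset y (u - {#a#})" "\<And>x. vertex_deg Q x = vertex_deg (add_mset y (u - {#a#})) x"
  shows "y \<notin># Q" "j \<in># u \<Longrightarrow> e j \<inter> e y = {}"
proof -
  let ?u = "u - {#a#}"
  have u: "u = add_mset a ?u" using a by simp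
  have uJ: "set_mset (add_mset y ?u) \<subseteq> J" using J by (auto dest: in_diffD)
  have aJ: "a \<in> J" using a J by auto
  have disj: "u \<inter># v = {#}"
    using vertex_deg_eq_size_ge[OF J(1,2) uv(2,1)] sz by simp
  have szQ: "size Q = q" using size_eq_if_vertex_deg_eq[OF J(3) uJ Q(2)] sz a by (simp add: size_Diff_singleton_if)
      (metis Suc_pred gr0I size_eq_0_iff_empty empty_iff set_mset_empty)
  \<comment> \<open>Distinct monomials of the minimal degree \<open>q\<close> with equal vertex
    degrees are coprime.\<close>
  have Qu: "Q \<inter># add_mset y ?u = {#}"
    using vertex_deg_eq_size_ge[OF J(3) uJ Q(2,1)] szQ by simp
  then show yQ: "y \<notin># Q" by (metis inter_iff union_single_eq_member empty_not_add_mset add_mset_remove_trivial_eq multi_member_last set_mset_empty empty_iff)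
  have vertex_deg: "vertex_deg (add_mset y u) x = vertex_deg (add_mset a Q) x" for x
  proof -
    have "vertex_deg u x = of_bool (x \<in> e a) + vertex_deg ?u x" using vertex_deg_add_mset[of a ?u x] u by simp
    then show ?thesis by (simp add: vertex_deg_add_mset Q(2))
  qed
  have q: "size (A \<inter># Q) \<le> 1"
    if A: "set_mset A \<subseteq> J" "size A = q" "\<And>x. vertex_deg A x = vertex_deg u x" "add_mset y A \<noteq> add_mset a Q" for A
  proof -
    have "q + size (add_mset y A \<inter># add_mset a Q) \<le> size (add_mset y A)"
      by (rule vertex_deg_eq_size_ge) (use A J aJ vertex_deg in \<open>auto simp: vertex_deg_add_mset\<close>)
    moreover have "A \<inter># Q \<subseteq># add_mset y A \<inter># add_mset a Q"
      by (rule subset_mset.inf_mono) simp_all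
    then have "size (A \<inter># Q) \<le> size (add_mset y A \<inter># add_mset a Q)" by (rule size_mset_mono)
    ultimately show ?thesis using A(2) by simp
  qed
  have "add_mset y u \<noteq> add_mset a Q"
  proof
    assume "add_mset y u = add_mset a Q"
    then have "add_mset y (add_mset a ?u) = add_mset a Q" using u by simp
    then show False using Q(1) by (simp add: add_mset_commute)
  qed
  then have uQ: "size (u \<inter># Q) \<le> 1" by (intro q) (use J sz in auto)
  have "add_mset y v \<noteq> add_mset a Q"
  proof
    assume "add_mset y v = add_mset a Q"
    then have "a \<in># add_mset y v" by simp
    then have "a \<in># u \<inter># v" using a by simp
    then show False using disj by simp
  qed
  then have vQ: "size (v \<inter># Q) \<le> 1"
    by (intro q) (use J sz size_eq_if_vertex_deg_eq[OF J(1,2) uv(2)] uv(2) in auto)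
  assume j: "j \<in># u"
  obtain E P where cyc: "alternating_cycle J e q E P u v" and E0: "E 0 = a"
    by (rule alternating_closed_walk[OF J(1,2) sz disj uv(2) a(1)])
  interpret C: alternating_cycle J e q E P u v by (rule cyc)
  interpret C: chorded_cycle J e q E P u v Q y
  proof
    fix k assume k: "even k" "0 < k" "k < 2 * q"
    let ?S = "{k. k < 2 * q \<and> even k}"
    have "mset_set ?S = add_mset 0 (mset_set (?S - {0}))" using k by (subst mset_set.remove[of _ 0]) auto
    then have "u = add_mset a (image_mset E (mset_set (?S - {0})))" using C.u_eq E0 by simp
    then have "?u = image_mset E (mset_set (?S - {0}))" by simp
    then have "E k \<in># ?u" using k by auto
    then show "E k \<notin># Q" using Qu by (metis add_mset_remove_trivial_eq empty_iff inter_iff insert_iff set_mset_add_mset_insert set_mset_empty)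
  qed (use q4 J yQ uQ vQ in auto)
  obtain y1 y2 where ey: "e y = {y1, y2}" "y1 \<noteq> y2" using card_edge[OF J(4)] by (auto simp: card_2_iff)
  define pt where "pt = (\<lambda>i. if i < 2 * q then P i else if i = 2 * q then y1 else y2)"
  let ?I = "{2..<2 * q + 2}"
  \<comment> \<open>The vertex degrees of \<open>Q\<close> are those of \<open>u\<close>, plus the
    ends of \<open>y\<close>, minus the ends of \<open>a\<close>; as \<open>a = E 0\<close>, the
    latter are the positions \<open>0\<close> and \<open>1\<close>.\<close>
  have "vertex_deg Q x = card {i \<in> ?I. pt i = x}" for x
  proof -
    have dgu: "vertex_deg u x = (\<Sum>i<2 * q. of_bool (P i = x))"
    proof -
      have "vertex_deg (image_mset E (mset_set S)) x = (\<Sum>k\<in>S. of_bool (x \<in> e (E k)))" if "finite S" for S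
        using that by (induction S rule: finite_induct) (auto simp: vertex_deg_add_mset)
      then have "vertex_deg u x = (\<Sum>k | k < 2 * q \<and> even k. of_bool (x \<in> e (E k)))"
        by (subst C.u_eq) simp
      also have "{k. k < 2 * q \<and> even k} = (\<lambda>i. 2 * i) ` {..<q}" by (auto elim!: evenE)
      also have "(\<Sum>k\<in>(\<lambda>i. 2 * i) ` {..<q}. of_bool (x \<in> e (E k)))
          = (\<Sum>i<q. of_bool (P (2 * i) = x) + of_bool (P (Suc (2 * i)) = x) :: nat)"
      proof -
        have "of_bool (x \<in> e (E (2 * i))) = (of_bool (P (2 * i) = x) + of_bool (P (Suc (2 * i)) = x) :: nat)"
          if "i < q" for i
          using that C.E_edge[of "2 * i"] C.P_neq_Suc[of "2 * i"] by auto
        then show ?thesis by (subst sum.reindex) (auto simp: inj_on_def intro!: sum.cong)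
      qed
      also have "\<dots> = (\<Sum>i<2 * q. of_bool (P i = x))"
        by (induction q) auto
      finally show ?thesis .
    qed
    have all: "(\<Sum>i<2 * q + 2. of_bool (pt i = x)) = vertex_deg u x + of_bool (x \<in> e y)"
      using ey by (auto simp: dgu pt_def)
    define g :: "nat \<Rightarrow> nat" where "g i = of_bool (pt i = x)" for i
    have "{..<2 * q + 2} = insert 0 (insert 1 ?I)" by auto
    then have "sum g {..<2 * q + 2} = g 0 + g 1 + sum g ?I" by simp
    then have "(\<Sum>i<2 * q + 2. of_bool (pt i = x) :: nat) =
        of_bool (P 0 = x) + of_bool (P 1 = x) + (\<Sum>i\<in>?I. of_bool (pt i = x))"
      using q4 by (simp add: pt_def g_def del: sum_of_bool_eq)
    moreover have "of_bool (x \<in> e a) = (of_bool (P 0 = x) + of_bool (P 1 = x) :: nat)"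
      using C.E_edge[of 0] C.P_neq_Suc[of 0] q4 E0 by auto
    ultimately have "(\<Sum>i\<in>?I. of_bool (pt i = x)) = vertex_deg Q x"
      using all vertex_deg[of x] by (simp add: vertex_deg_add_mset del: sum_of_bool_eq)
    moreover have "(\<Sum>i\<in>A. of_bool (pt i = x)) = card {i \<in> A. pt i = x}" if "finite A" for A
      using that by (simp add: Int_def)
    ultimately show ?thesis by (metis finite_atLeastLessThan)
  qed
  from edge_matching[OF _ J(3) this] obtain \<tau> lab where
    \<tau>: "\<forall>i\<in>?I. \<tau> i \<in> ?I \<and> \<tau> i \<noteq> i \<and> \<tau> (\<tau> i) = i \<and> lab (\<tau> i) = lab i \<and>
      e (lab i) = {pt i, pt (\<tau> i)} \<and> lab i \<in># Q"
    "\<forall>i\<in>?I. \<forall>k\<in>?I. k \<noteq> i \<longrightarrow> k \<noteq> \<tau> i \<longrightarrow> {#lab i, lab k#} \<subseteq># Q"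
    by auto
  have off: "P k \<notin> e y" if "k < 2 * q" for k
    by (rule C.y_off_walk[of y1 y2 \<tau> lab, OF ey(1)]) (use \<tau> that in \<open>auto simp: pt_def\<close>)
  obtain k where k: "k < 2 * q" "even k" "E k = j"
    using j unfolding C.u_eq by auto
  then have "Suc k < 2 * q" by presburger
  then show "e j \<inter> e y = {}" using C.E_edge[OF k(1)] k off by auto
qed

end

subsection \<open>Polynomials and the toric ideal\<close>

abbreviation coef :: "('a \<Rightarrow>\<^sub>0 'b::zero) \<Rightarrow> 'a \<Rightarrow> 'b" where "coef \<equiv> Poly_Mapping.lookup"
abbreviation supp :: "('a \<Rightarrow>\<^sub>0 'b::zero) \<Rightarrow> 'a set" where "supp \<equiv> Poly_Mapping.keys"
abbreviation mon :: "'a \<Rightarrow> 'b \<Rightarrow> 'a \<Rightarrow>\<^sub>0 'b::zero" where "mon \<equiv> Poly_Mapping.single"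

lemma coef_mon: "coef (mon s c) t = (if s = t then c else 0)"
  by (simp add: lookup_single when_def)

lemma supp_mon_subset: "supp (mon s c) \<subseteq> {s}"
  by simp

lemma supp_sum: "supp (sum f A) \<subseteq> (\<Union>i\<in>A. supp (f i))"
proof
  fix t assume "t \<in> supp (sum f A)"
  then have "(\<Sum>i\<in>A. coef (f i) t) \<noteq> 0" by (simp add: in_keys_iff lookup_sum)
  then obtain i where "i \<in> A" "coef (f i) t \<noteq> 0" by (meson sum.neutral)
  then show "t \<in> (\<Union>i\<in>A. supp (f i))" by (auto simp: in_keys_iff)
qed

lemma supp_add_nat: "supp (s + t :: 'a \<Rightarrow>\<^sub>0 nat) = supp s \<union> supp t"
  by (auto simp: in_keys_iff lookup_add)

lemma supp_multE:
  assumes "t \<in> supp (p * q)"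
  obtains a b where "a \<in> supp p" "b \<in> supp q" "t = a + b"
  using assms keys_mult[of p q] by blast

lemma sum_mon: "finite A \<Longrightarrow> supp p \<subseteq> A \<Longrightarrow> (\<Sum>t\<in>A. mon t (coef p t)) = p"
  by (rule poly_mapping_eqI) (auto simp: lookup_sum coef_mon in_keys_iff)

lemma coef_PConst_mult: "coef (PConst c * p) t = c * coef p t"
proof -
  have "PConst c * p = Poly_Mapping.map ((*) c) p"
    unfolding PConst_def by (rule mult_map_scale_conv_mult[symmetric])
  then show ?thesis by (simp add: Poly_Mapping.map.rep_eq when_def)
qed

lemma PConst_add: "PConst (a + b) = PConst a + PConst b"
  and PConst_mult: "PConst (a * b) = PConst a * PConst b"
  and PConst_0 [simp]: "PConst 0 = 0" and PConst_1 [simp]: "PConst 1 = 1"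
  by (simp_all add: PConst_def single_add mult_single)

lemma polysI: "(\<And>t. t \<in> supp p \<Longrightarrow> supp t \<subseteq> J) \<Longrightarrow> p \<in> polys J"
  and polysD: "p \<in> polys J \<Longrightarrow> t \<in> supp p \<Longrightarrow> supp t \<subseteq> J"
  by (auto simp: polys_def)

lemma polys_mon: "supp t \<subseteq> J \<Longrightarrow> mon t c \<in> polys J"
  by (simp add: polys_def)

lemma polys_0 [simp]: "0 \<in> polys J" and polys_1 [simp]: "1 \<in> polys J"
  and polys_PConst [simp]: "PConst c \<in> polys J"
  by (auto intro: polysI simp: PConst_def split: if_splits)

lemma polys_PVar [simp]: "j \<in> J \<Longrightarrow> PVar j \<in> polys J"
  by (simp add: PVar_def polys_mon)

lemma polys_add [intro]: "p \<in> polys J \<Longrightarrow> q \<in> polys J \<Longrightarrow> p + q \<in> polys J"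
  using keys_add[of p q] by (fastforce simp: polys_def)

lemma polys_uminus [intro]: "p \<in> polys J \<Longrightarrow> - p \<in> polys J"
  by (auto simp: polys_def in_keys_iff)

lemma polys_diff [intro]: "p \<in> polys J \<Longrightarrow> q \<in> polys J \<Longrightarrow> p - q \<in> polys J"
  using polys_add[of p J "- q"] polys_uminus[of q J] by simp

lemma polys_mult [intro]: assumes "p \<in> polys J" "q \<in> polys J" shows "p * q \<in> polys J"
proof (rule polysI)
  fix t assume "t \<in> supp (p * q)"
  then obtain a b where "a \<in> supp p" "b \<in> supp q" "t = a + b" by (rule supp_multE)
  then show "supp t \<subseteq> J" using assms by (auto simp: supp_add_nat dest: polysD)
qed

lemma polys_sum [intro]: "(\<And>i. i \<in> A \<Longrightarrow> f i \<in> polys J) \<Longrightarrow> sum f A \<in> polys J"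
  by (induction A rule: infinite_finite_induct) auto

lemma polys_prod [intro]: "(\<And>i. i \<in> A \<Longrightarrow> f i \<in> polys J) \<Longrightarrow> prod f A \<in> polys J"
  by (induction A rule: infinite_finite_induct) auto

lemma polys_power [intro]: "p \<in> polys J \<Longrightarrow> p ^ n \<in> polys J"
  by (induction n) auto

lemma polys_mono: "J \<subseteq> J' \<Longrightarrow> polys J \<subseteq> polys J'"
  by (auto simp: polys_def)

section \<open>Substitution homomorphisms and the grading by vertex degrees\<close>

definition meval :: "('i \<Rightarrow> ('v, 'k::comm_ring_1) mpoly) \<Rightarrow> ('i \<Rightarrow>\<^sub>0 nat) \<Rightarrow> ('v, 'k) mpoly" where
  "meval f t = (\<Prod>i\<in>supp t. f i ^ coef t i)"

lemma meval_superset: "finite A \<Longrightarrow> supp t \<subseteq> A \<Longrightarrow> meval f t = (\<Prod>i\<in>A. f i ^ coef t i)"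
  unfolding meval_def by (rule prod.mono_neutral_left) (auto simp: in_keys_iff)

lemma meval_add: "meval f (s + t) = meval f s * meval f t"
proof -
  let ?A = "supp s \<union> supp t"
  have "meval f (s + t) = (\<Prod>i\<in>?A. f i ^ coef (s + t) i)"
    by (rule meval_superset) (auto simp: supp_add_nat)
  also have "\<dots> = meval f s * meval f t"
    by (subst (1 2) meval_superset[of ?A]) (auto simp: lookup_add power_add prod.distrib)
  finally show ?thesis .
qed

lemma psubst_superset:
  assumes "finite A" "supp p \<subseteq> A" shows "psubst f p = (\<Sum>t\<in>A. PConst (coef p t) * meval f t)"
  unfolding psubst_def meval_def[symmetric]
  by (rule sum.mono_neutral_left) (use assms in \<open>auto simp: in_keys_iff\<close>)

lemma psubst_add: "psubst f (p + q) = psubst f p + psubst f q"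
proof -
  let ?A = "supp p \<union> supp q"
  have "psubst f (p + q) = (\<Sum>t\<in>?A. PConst (coef (p + q) t) * meval f t)"
    by (rule psubst_superset) (use keys_add[of p q] in auto)
  also have "\<dots> = psubst f p + psubst f q"
    by (subst (1 2) psubst_superset[of ?A])
      (auto simp: lookup_add PConst_add sum.distrib distrib_right)
  finally show ?thesis .
qed

lemma psubst_0 [simp]: "psubst f 0 = 0"
  by (simp add: psubst_def)

lemma psubst_uminus: "psubst f (- p) = - psubst f p"
  using psubst_add[of f p "- p"] by (simp add: eq_neg_iff_add_eq_0 add.commute)

lemma psubst_diff: "psubst f (p - q) = psubst f p - psubst f q"
  using psubst_add[of f p "- q"] by (simp add: psubst_uminus)

lemma psubst_mon: "psubst f (mon t c) = PConst c * meval f t"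
  by (subst psubst_superset[of "{t}"]) auto

lemma psubst_sum: "psubst f (sum g A) = (\<Sum>i\<in>A. psubst f (g i))"
  by (induction A rule: infinite_finite_induct) (auto simp: psubst_add)

lemma psubst_mult: "psubst f (p * q) = psubst f p * psubst f q"
proof -
  have "p * q = (\<Sum>s\<in>supp p. mon s (coef p s)) * (\<Sum>t\<in>supp q. mon t (coef q t))"
    by (simp add: sum_mon)
  also have "\<dots> = (\<Sum>s\<in>supp p. \<Sum>t\<in>supp q. mon (s + t) (coef p s * coef q t))"
    by (simp add: sum_product mult_single)
  finally have "psubst f (p * q) = (\<Sum>s\<in>supp p. \<Sum>t\<in>supp q.
      (PConst (coef p s) * meval f s) * (PConst (coef q t) * meval f t))"
    by (simp add: psubst_sum psubst_mon PConst_mult meval_add mult_ac)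
  then show ?thesis by (simp add: psubst_def meval_def[symmetric] sum_product)
qed

lemma meval_0 [simp]: "meval f 0 = 1" by (simp add: meval_def)

lemma psubst_PConst [simp]: "psubst f (PConst c) = PConst c"
  unfolding PConst_def by (subst psubst_mon) (simp add: PConst_def)

lemma psubst_1 [simp]: "psubst f 1 = 1"
  using psubst_PConst[of f 1] by simp

lemma meval_var: "meval f (mon i n) = f i ^ n"
  by (subst meval_superset[of "{i}"]) auto

lemma psubst_PVar [simp]: "psubst f (PVar i) = f i"
  unfolding PVar_def by (simp add: psubst_mon meval_var)

lemma psubst_power: "psubst f (p ^ n) = psubst f p ^ n"
  by (induction n) (auto simp: psubst_mult)

lemma psubst_prod: "psubst f (prod g A) = (\<Prod>i\<in>A. psubst f (g i))"
  by (induction A rule: infinite_finite_induct) (auto simp: psubst_mult)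

lemma psubst_psubst: "psubst f (psubst g p) = psubst (\<lambda>i. psubst f (g i)) p"
  by (simp add: psubst_def[of g p] psubst_def[of "\<lambda>i. psubst f (g i)" p]
      psubst_sum psubst_mult psubst_prod psubst_power)

lemma psubst_polys:
  assumes "p \<in> polys I" "\<And>i. i \<in> I \<Longrightarrow> f i \<in> polys J" shows "psubst f p \<in> polys J"
  unfolding psubst_def
  by (intro polys_sum polys_mult polys_prod polys_power polys_PConst) (use assms in \<open>blast dest: polysD\<close>)

lemma psubst_cong:
  assumes "p \<in> polys I" "\<And>i. i \<in> I \<Longrightarrow> f i = g i" shows "psubst f p = psubst g p"
  unfolding psubst_def
  by (intro sum.cong prod.cong refl arg_cong2[of _ _ _ _ "(*)"] arg_cong2[of _ _ _ _ "(^)"])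
    (use assms in \<open>blast dest: polysD\<close>)

text \<open>\<open>vdeg e t\<close> is the exponent vector of the image of the monomial with exponents \<open>t\<close>.\<close>

definition vdeg :: "('i \<Rightarrow> 'v set) \<Rightarrow> ('i \<Rightarrow>\<^sub>0 nat) \<Rightarrow> ('v \<Rightarrow>\<^sub>0 nat)" where
  "vdeg e t = (\<Sum>i\<in>supp t. \<Sum>v\<in>e i. mon v (coef t i))"

lemma vdeg_superset: "finite A \<Longrightarrow> supp t \<subseteq> A \<Longrightarrow> vdeg e t = (\<Sum>i\<in>A. \<Sum>v\<in>e i. mon v (coef t i))"
  unfolding vdeg_def by (rule sum.mono_neutral_left) (auto simp: in_keys_iff)

lemma vdeg_add: "vdeg e (s + t) = vdeg e s + vdeg e t"
proof -
  let ?A = "supp s \<union> supp t"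
  have "vdeg e (s + t) = (\<Sum>i\<in>?A. \<Sum>v\<in>e i. mon v (coef (s + t) i))"
    by (rule vdeg_superset) (auto simp: supp_add_nat)
  also have "\<dots> = vdeg e s + vdeg e t"
    by (subst (1 2) vdeg_superset[of ?A]) (auto simp: lookup_add single_add sum.distrib)
  finally show ?thesis .
qed

lemma edge_monomial_power: "edge_monomial e j ^ n = (mon (\<Sum>v\<in>e j. mon v n) 1 :: ('v, 'k::comm_ring_1) mpoly)"
proof -
  have prod: "(\<Prod>v\<in>A. mon (f v) 1) = (mon (\<Sum>v\<in>A. f v) 1 :: ('v, 'k) mpoly)" for A and f :: "'v \<Rightarrow> 'v \<Rightarrow>\<^sub>0 nat"
    by (induction A rule: infinite_finite_induct) (auto simp: mult_single)
  have pow: "mon s 1 ^ n = (mon (\<Sum>i<n. s) 1 :: ('v, 'k) mpoly)" for s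
    by (induction n) (auto simp: mult_single add.commute)
  have "(\<Sum>i<n. mon v 1) = (mon v n :: 'v \<Rightarrow>\<^sub>0 nat)" for v
    by (rule poly_mapping_eqI) (auto simp: lookup_sum coef_mon)
  then have "(\<Sum>i<n. \<Sum>v\<in>e j. mon v 1) = (\<Sum>v\<in>e j. mon v n :: 'v \<Rightarrow>\<^sub>0 nat)"
    by (subst sum.swap) simp
  then show ?thesis by (simp add: edge_monomial_def PVar_def prod pow)
qed

lemma meval_edge: "meval (edge_monomial e) t = mon (vdeg e t) 1"
proof -
  have prod: "(\<Prod>v\<in>A. mon (f v) 1) = (mon (\<Sum>v\<in>A. f v) 1 :: ('v, 'k::comm_ring_1) mpoly)"
    for A and f :: "'w \<Rightarrow> 'v \<Rightarrow>\<^sub>0 nat"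
    by (induction A rule: infinite_finite_induct) (auto simp: mult_single)
  show ?thesis by (simp add: meval_def edge_monomial_power prod vdeg_def)
qed

lemma coef_psubst_edge:
  "coef (psubst (edge_monomial e) p) s = (\<Sum>t\<in>supp p. if vdeg e t = s then coef p t else 0)"
  unfolding psubst_def meval_def[symmetric] meval_edge
  by (auto simp: lookup_sum PConst_def mult_single coef_mon intro!: sum.cong)

text \<open>The coefficient of the image at \<open>vdeg e t\<close> is the sum of the coefficients
  over the fibre of \<open>t\<close>; it can vanish only if a second monomial of the fibre
  occurs.\<close>

lemma toric_ideal_partner:
  assumes "p \<in> toric_ideal J e" "t \<in> supp p"
  obtains s where "s \<in> supp p" "s \<noteq> t" "vdeg e s = vdeg e t"
proof (rule ccontr)
  assume no: "\<not> thesis"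
  have "coef (psubst (edge_monomial e) p) (vdeg e t) = (\<Sum>s\<in>supp p. if s = t then coef p t else 0)"
    unfolding coef_psubst_edge by (intro sum.cong) (use that no in auto)
  also have "\<dots> \<noteq> 0" using assms(2) by (simp add: in_keys_iff)
  finally show False using assms(1) by (simp add: toric_ideal_def)
qed

lemma toric_ideal_binomial:
  assumes "supp s \<subseteq> J" "supp t \<subseteq> J" "vdeg e s = vdeg e t"
  shows "mon s 1 - mon t 1 \<in> toric_ideal J e"
  using assms by (auto simp: toric_ideal_def psubst_diff psubst_mon meval_edge polys_mon)

lemma toric_ideal_polys: "p \<in> toric_ideal J e \<Longrightarrow> p \<in> polys J"
  by (simp add: toric_ideal_def)

lemma toric_ideal_sum: "(\<And>i. i \<in> A \<Longrightarrow> f i \<in> toric_ideal J e) \<Longrightarrow> sum f A \<in> toric_ideal J e"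
  by (auto simp: toric_ideal_def psubst_sum)

lemma toric_ideal_mult: "f \<in> toric_ideal J e \<Longrightarrow> p \<in> polys J \<Longrightarrow> p * f \<in> toric_ideal J e"
  by (auto simp: toric_ideal_def psubst_mult)

lemma toric_ideal_diff: "f \<in> toric_ideal J e \<Longrightarrow> g \<in> toric_ideal J e \<Longrightarrow> f - g \<in> toric_ideal J e"
  by (auto simp: toric_ideal_def psubst_diff)

subsection \<open>The linear strand\<close>

text \<open>Translates exponent vectors into the multisets of edges used in the combinatorial
  part.\<close>

definition exps :: "('i \<Rightarrow>\<^sub>0 nat) \<Rightarrow> 'i multiset" where "exps t = Abs_multiset (coef t)"

lemma count_exps [simp]: "count (exps t) = coef t"
  unfolding exps_def by (subst count_Abs_multiset) auto

lemma set_exps [simp]: "set_mset (exps t) = supp t"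
  by (auto simp: set_mset_def in_keys_iff)

lemma exps_add: "exps (s + t) = exps s + exps t"
  and exps_diff: "exps (s - t) = exps s - exps t"
  and exps_single: "exps (mon j 1) = {#j#}"
  by (auto simp: multiset_eq_iff lookup_add lookup_minus coef_mon)

lemma exps_eq_iff: "exps s = exps t \<longleftrightarrow> s = t"
  by (auto simp: multiset_eq_iff intro: poly_mapping_eqI)

lemma size_exps: "size (exps t) = mon_deg t"
  by (simp add: size_multiset_overloaded_eq mon_deg_def)

lemma coef_vdeg:
  assumes "\<And>j. j \<in> supp t \<Longrightarrow> finite (e j)"
  shows "coef (vdeg e t) x = (\<Sum>j\<in>supp t. if x \<in> e j then coef t j else 0)"
  using assms by (auto simp: vdeg_def lookup_sum coef_mon intro!: sum.cong)

context edge_lattice begin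

lemma vertex_deg_exps:
  assumes "supp t \<subseteq> J" shows "vertex_deg (exps t) x = coef (vdeg e t) x"
proof -
  have "finite (e j)" if "j \<in> supp t" for j
  proof (rule card_ge_0_finite)
    have "j \<in> J" using that assms by blast
    then show "0 < card (e j)" by (simp add: card_edge)
  qed
  then have "coef (vdeg e t) x = (\<Sum>j\<in>supp t. if x \<in> e j then coef t j else 0)" by (rule coef_vdeg)
  also have "\<dots> = (\<Sum>j\<in>{j \<in> supp t. x \<in> e j}. coef t j)"
    by (simp add: sum.If_cases Int_def)
  also have "\<dots> = vertex_deg (exps t) x"
    by (simp add: vertex_deg_def size_multiset_overloaded_eq)
  finally show ?thesis by simp
qed

lemma vertex_deg_exps_eq: "supp s \<subseteq> J \<Longrightarrow> supp t \<subseteq> J \<Longrightarrow> vdeg e s = vdeg e t \<Longrightarrow> vertex_deg (exps s) x = vertex_deg (exps t) x"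
  by (simp add: vertex_deg_exps)

end

text \<open>The positive and negative parts of a lattice vector give a binomial of the toric ideal.
  Their degrees add up to the mass, so a nonzero vector of mass below \<open>2 * q\<close> would
  yield a monomial of degree below \<open>q\<close>.\<close>

lemma edge_lattice_if_min_degree:
  fixes e :: "'i \<Rightarrow> 'v set"
  assumes J: "finite J" "\<And>j. j \<in> J \<Longrightarrow> card (e j) = 2" "inj_on e J"
    and min: "\<And>p t. p \<in> (toric_ideal J e :: ('i, 'k::field) mpoly set) \<Longrightarrow> t \<in> supp p \<Longrightarrow> q \<le> mon_deg t"
  shows "edge_lattice J e q"
proof
  fix w :: "'i \<Rightarrow> int" and j
  assume boundary: "\<And>x. (\<Sum>j\<in>J. w j * of_bool (x \<in> e j)) = 0"
    and mass: "(\<Sum>j\<in>J. \<bar>w j\<bar>) < 2 * int q" and j: "j \<in> J"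
  define pos where "pos f = Abs_poly_mapping (\<lambda>j. if j \<in> J then nat (f j) else 0)" for f :: "'i \<Rightarrow> int"
  have pos: "coef (pos f) j = (if j \<in> J then nat (f j) else 0)" for f j
    unfolding pos_def by (subst lookup_Abs_poly_mapping) (auto intro: finite_subset[OF _ J(1)])
  have supp: "supp (pos f) \<subseteq> J" for f by (auto simp: in_keys_iff pos split: if_splits)
  define s where "s = pos w"
  define t where "t = pos (\<lambda>j. - w j)"
  have fin: "finite (e j)" if "j \<in> J" for j
    by (rule card_ge_0_finite) (simp add: J(2)[OF that])
  have vdeg: "int (coef (vdeg e (pos f)) x) = (\<Sum>j\<in>J. int (nat (f j)) * of_bool (x \<in> e j))" for f x
  proof -
    have "coef (vdeg e (pos f)) x = (\<Sum>j\<in>supp (pos f). if x \<in> e j then coef (pos f) j else 0)"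
      by (rule coef_vdeg) (use supp[of f] fin in blast)
    also have "\<dots> = (\<Sum>j\<in>J. if x \<in> e j then coef (pos f) j else 0)"
      by (rule sum.mono_neutral_left) (use supp[of f] J(1) in \<open>auto simp: in_keys_iff\<close>)
    finally show ?thesis by (auto simp: pos intro!: sum.cong)
  qed
  have deg: "int (mon_deg (pos f)) = (\<Sum>j\<in>J. int (nat (f j)))" for f
  proof -
    have "mon_deg (pos f) = (\<Sum>j\<in>J. coef (pos f) j)"
      unfolding mon_deg_def by (rule sum.mono_neutral_left) (use supp[of f] J(1) in \<open>auto simp: in_keys_iff\<close>)
    then show ?thesis by (simp add: pos)
  qed
  have "vdeg e s = vdeg e t"
  proof (rule poly_mapping_eqI)
    fix x
    have "int (coef (vdeg e s) x) - int (coef (vdeg e t) x)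
        = (\<Sum>j\<in>J. (int (nat (w j)) - int (nat (- w j))) * of_bool (x \<in> e j))"
      by (simp add: s_def t_def vdeg sum_subtractf left_diff_distrib)
    also have "\<dots> = 0" by (subst boundary[of x, symmetric]) (intro sum.cong, auto)
    finally show "coef (vdeg e s) x = coef (vdeg e t) x" by simp
  qed
  then have I: "mon s 1 - mon t 1 \<in> (toric_ideal J e :: ('i, 'k) mpoly set)"
    by (intro toric_ideal_binomial) (simp_all add: s_def t_def supp)
  have "int (mon_deg s) + int (mon_deg t) = (\<Sum>j\<in>J. int (nat (w j)) + int (nat (- w j)))"
    by (simp add: s_def t_def deg sum.distrib)
  also have "\<dots> = (\<Sum>j\<in>J. \<bar>w j\<bar>)" by (intro sum.cong) auto
  finally have lt: "\<not> (q \<le> mon_deg s \<and> q \<le> mon_deg t)" using mass by linarith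
  have "s = t"
  proof (rule ccontr)
    assume "s \<noteq> t"
    then have "s \<in> supp (mon s 1 - mon t 1 :: ('i, 'k) mpoly)" "t \<in> supp (mon s 1 - mon t 1 :: ('i, 'k) mpoly)"
      by (auto simp: in_keys_iff lookup_minus coef_mon)
    then show False using min[OF I] lt by blast
  qed
  then have "coef s j = coef t j" by simp
  then show "w j = 0" using j by (auto simp: s_def t_def pos)
qed (use J in auto)

lemma mon_deg_add: "mon_deg (s + t) = mon_deg s + mon_deg t"
  by (simp flip: size_exps add: exps_add)

lemma mon_deg_eq_0: "mon_deg t = 0 \<longleftrightarrow> t = 0"
  by (auto simp: mon_deg_def in_keys_iff intro: poly_mapping_eqI)

lemma mon_1_eq_iff: "mon x (Suc 0) = mon z (Suc 0) \<longleftrightarrow> x = z"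
proof
  assume "mon x (Suc 0) = mon z (Suc 0)"
  then have "coef (mon x (Suc 0)) x = coef (mon z (Suc 0)) x" by simp
  then show "x = z" by (simp add: coef_mon split: if_splits)
qed simp

lemma mon_deg_eq_1: "mon_deg t = 1 \<longleftrightarrow> (\<exists>j. t = mon j 1)"
proof
  assume "mon_deg t = 1"
  then have "size (exps t) = 1" by (simp add: size_exps)
  then obtain j where "exps t = {#j#}" using size_1_singleton_mset by blast
  then have "exps t = exps (mon j 1)" by (simp only: exps_single)
  then show "\<exists>j. t = mon j 1" unfolding exps_eq_iff by blast
qed (auto simp flip: size_exps simp: exps_single[simplified])

lemma coef_PVar_mult:
  "coef (PVar j * p) t = (if j \<in> supp t then coef p (t - mon j 1) else (0::'k::comm_ring_1))"
proof -
  have "PVar j * p = (\<Sum>s\<in>supp p. mon (mon j 1 + s) (coef p s))"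
    by (subst sum_mon[of "supp p" p, symmetric])
      (simp_all add: PVar_def sum_distrib_left mult_single del: sum_mon)
  then have c: "coef (PVar j * p) t = (\<Sum>s\<in>supp p. if mon j 1 + s = t then coef p s else 0)"
    by (simp add: lookup_sum coef_mon)
  show ?thesis
  proof (cases "j \<in> supp t")
    case True
    then have "mon j 1 + (t - mon j 1) = t"
      by (intro poly_mapping_eqI) (auto simp: lookup_add lookup_minus coef_mon in_keys_iff)
    then have "mon j 1 + s = t \<longleftrightarrow> s = t - mon j 1" for s by auto
    then show ?thesis using True by (simp add: c in_keys_iff)
  next
    case False
    then have "mon j 1 + s \<noteq> t" for s by (auto simp: supp_add_nat)
    then show ?thesis using False by (simp add: c)
  qed
qed

text \<open>The columns \<open>L _ c\<close> are syzygies with linear forms as entries, and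
  \<open>\<kappa>\<close> is their combination with coefficients \<open>w c\<close>. The choice
  \<open>r = 0\<close> covers the zero syzygy.\<close>

definition linear_syzygies ::
  "'i set \<Rightarrow> nat \<Rightarrow> (nat \<Rightarrow> ('i, 'k::field) mpoly) \<Rightarrow> bool" where
  "linear_syzygies J g f \<longleftrightarrow>
    (\<forall>\<kappa>. (\<forall>b<g. \<kappa> b \<in> polys J) \<and> (\<Sum>b<g. f b * \<kappa> b) = 0 \<longrightarrow>
      (\<exists>(r::nat) L w. (\<forall>b<g. \<kappa> b = (\<Sum>c<r. L b c * w c)) \<and>
        (\<forall>b<g. \<forall>c<r. L b c \<in> polys J \<and> (\<forall>t\<in>supp (L b c). mon_deg t = 1)) \<and>
        (\<forall>c<r. (\<Sum>b<g. f b * L b c) = 0)))"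

lemma linear_form_eq:
  assumes "finite J" "p \<in> polys J" "\<And>t. t \<in> supp p \<Longrightarrow> mon_deg t = 1"
  shows "p = (\<Sum>z\<in>J. PVar z * PConst (coef p (mon z 1)))"
proof (rule poly_mapping_eqI)
  fix t
  have PP: "PVar z * PConst c = mon (mon z 1) c" for z c
    by (simp add: PVar_def PConst_def mult_single)
  show "coef p t = coef (\<Sum>z\<in>J. PVar z * PConst (coef p (mon z 1))) t"
  proof (cases "\<exists>z\<in>J. t = mon z 1")
    case True
    then obtain z where z: "z \<in> J" "t = mon z 1" by blast
    have "coef (\<Sum>z\<in>J. PVar z * PConst (coef p (mon z 1))) t
        = (\<Sum>z'\<in>J. coef (mon (mon z' 1) (coef p (mon z' 1))) t)"
      by (simp only: lookup_sum PP)
    also have "\<dots> = (\<Sum>z'\<in>J. if z' = z then coef p t else 0)"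
      using z by (intro sum.cong refl) (auto simp: coef_mon mon_1_eq_iff)
    also have "\<dots> = coef p t" using sum.delta[OF assms(1), of z "\<lambda>_. coef p t"] z(1) by simp
    finally show ?thesis by (rule sym)
  next
    case False
    have "t \<notin> supp p"
    proof (rule notI)
      assume t: "t \<in> supp p"
      then have "mon_deg t = 1" by (rule assms(3))
      then obtain z where "t = mon z 1" unfolding mon_deg_eq_1 by (elim exE)
      moreover have "z \<in> J" using polysD[OF assms(2) t] calculation by simp
      ultimately show False using False by blast
    qed
    then show ?thesis using False by (auto simp: lookup_sum PP coef_mon in_keys_iff intro!: sum.neutral)
  qed
qed

text \<open>Apply the coefficient functional at \<open>u\<close> to the Koszul syzygy of \<open>f1\<close> and \<open>f2\<close>: the
  result is a multiple of \<open>f2\<close>, and it lies in an ideal generated by linear forms.\<close>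

lemma linear_syzygy_at_monomial:
  fixes f :: "nat \<Rightarrow> ('i, 'k::field) mpoly" and e :: "'i \<Rightarrow> 'v set"
  assumes J: "finite J" and lin: "linear_syzygies J g f"
    and f: "\<And>b. b < g \<Longrightarrow> f b \<in> toric_ideal J e"
    and f1: "f1 = (\<Sum>b<g. PConst (c1 b) * f b)" and f2: "f2 = (\<Sum>b<g. PConst (c2 b) * f b)"
    and u: "coef f1 u \<noteq> 0" "coef f2 u = 0" and t: "t \<in> supp f2"
  obtains y a Q where "y \<in> supp t" "y \<in> J" "a \<in> supp u" "a \<noteq> y" "supp Q \<subseteq> J"
    "Q \<noteq> u + mon y 1 - mon a 1" "vdeg e Q = vdeg e (u + mon y 1 - mon a 1)"
proof -
  have fp: "f b \<in> polys J" if "b < g" for b using f[OF that] by (rule toric_ideal_polys)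
  have f12: "f1 \<in> polys J" "f2 \<in> polys J" unfolding f1 f2 by (intro polys_sum polys_mult polys_PConst fp; simp)+
  \<comment> \<open>The Koszul syzygy of \<open>f1\<close> and \<open>f2\<close>, written in terms
    of the generators \<open>f b\<close>.\<close>
  define \<kappa> where "\<kappa> b = f2 * PConst (c1 b) - f1 * PConst (c2 b)" for b
  have "(\<Sum>b<g. f b * \<kappa> b) = f2 * (\<Sum>b<g. PConst (c1 b) * f b) - f1 * (\<Sum>b<g. PConst (c2 b) * f b)"
    by (simp add: \<kappa>_def sum_distrib_left sum_subtractf algebra_simps)
  also have "\<dots> = 0" by (simp flip: f1 f2)
  finally have "(\<Sum>b<g. f b * \<kappa> b) = 0" .
  moreover have "\<forall>b<g. \<kappa> b \<in> polys J" unfolding \<kappa>_def by (intro allI impI polys_diff polys_mult f12 polys_PConst)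
  ultimately have "\<exists>(r::nat) L w. (\<forall>b<g. \<kappa> b = (\<Sum>c<r. L b c * w c)) \<and>
        (\<forall>b<g. \<forall>c<r. L b c \<in> polys J \<and> (\<forall>t\<in>supp (L b c). mon_deg t = 1)) \<and>
        (\<forall>c<r. (\<Sum>b<g. f b * L b c) = 0)"
    using lin[unfolded linear_syzygies_def, rule_format, of \<kappa>] by (simp only: simp_thms)
  then obtain L w and r :: nat where
    \<kappa>: "\<And>b. b < g \<Longrightarrow> \<kappa> b = (\<Sum>c<r. L b c * w c)" and
    L: "\<And>b c. b < g \<Longrightarrow> c < r \<Longrightarrow> L b c \<in> polys J" "\<And>b c t. b < g \<Longrightarrow> c < r \<Longrightarrow> t \<in> supp (L b c) \<Longrightarrow> mon_deg t = 1" and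
    syz: "\<And>c. c < r \<Longrightarrow> (\<Sum>b<g. f b * L b c) = 0"
    by (elim exE conjE) simp
  define la where "la b = coef (f b) u" for b
  \<comment> \<open>The linear form obtained from the \<open>c\<close>-th syzygy by replacing each
    \<open>f b\<close> with its coefficient at \<open>u\<close>.\<close>
  define M where "M c = (\<Sum>b<g. PConst (la b) * L b c)" for c
  have lam: "(\<Sum>b<g. PConst (la b) * PConst (c b)) = PConst (coef (\<Sum>b<g. PConst (c b) * f b) u)" for c
  proof -
    have "PConst (\<Sum>b<g. c b * la b) = (\<Sum>b<g. PConst (la b) * PConst (c b))"
      by (induction g) (auto simp: PConst_add PConst_mult mult.commute)
    from this[symmetric] show ?thesis by (simp add: lookup_sum coef_PConst_mult la_def)
  qed
  have "(\<Sum>b<g. PConst (la b) * \<kappa> b) =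
      f2 * (\<Sum>b<g. PConst (la b) * PConst (c1 b)) - f1 * (\<Sum>b<g. PConst (la b) * PConst (c2 b))"
    by (simp add: \<kappa>_def sum_distrib_left sum_subtractf algebra_simps)
  also have "\<dots> = PConst (coef f1 u) * f2"
    unfolding lam f1[symmetric] f2[symmetric] by (simp add: u mult.commute)
  finally have "PConst (coef f1 u) * f2 = (\<Sum>b<g. PConst (la b) * \<kappa> b)" by (rule sym)
  also have "\<dots> = (\<Sum>b<g. \<Sum>c<r. PConst (la b) * L b c * w c)"
    by (simp add: \<kappa> sum_distrib_left mult.assoc)
  also have "\<dots> = (\<Sum>c<r. M c * w c)"
    unfolding M_def sum_distrib_right by (rule sum.swap)
  finally have "coef (\<Sum>c<r. M c * w c) t = coef f1 u * coef f2 t" by (metis coef_PConst_mult)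
  then have "t \<in> supp (\<Sum>c<r. M c * w c)" using u t by (auto simp: in_keys_iff)
  then have "t \<in> (\<Union>c<r. supp (M c * w c))" by (rule subsetD[OF supp_sum])
  then obtain c where c: "c < r" "t \<in> supp (M c * w c)" by auto
  from c(2) obtain s s' where s: "s \<in> supp (M c)" "t = s + s'" by (rule supp_multE)
  have Mp: "M c \<in> polys J" unfolding M_def by (intro polys_sum polys_mult polys_PConst L(1) c) simp
  from s(1) have "s \<in> (\<Union>b<g. supp (PConst (la b) * L b c))"
    unfolding M_def by (rule subsetD[OF supp_sum])
  then obtain b where b: "b < g" "s \<in> supp (PConst (la b) * L b c)" by auto
  then have "s \<in> supp (L b c)" by (auto simp: in_keys_iff coef_PConst_mult)
  then have "mon_deg s = 1" by (rule L(2)[OF b(1) c(1)])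
  then obtain y where y: "s = mon y 1" unfolding mon_deg_eq_1 by (elim exE)
  have yJ: "y \<in> J" using polysD[OF Mp s(1)] y by simp
  have yt: "y \<in> supp t" using s y by (simp add: supp_add_nat)
  \<comment> \<open>The cofactor of the variable \<open>z\<close> in the \<open>c\<close>-th syzygy:
    a scalar combination of the \<open>f b\<close>, hence in the toric ideal.\<close>
  define F where "F z = (\<Sum>b<g. PConst (coef (L b c) (mon z 1)) * f b)" for z
  have F: "F z \<in> toric_ideal J e" for z
    unfolding F_def by (intro toric_ideal_sum toric_ideal_mult f) auto
  have "(\<Sum>z\<in>J. PVar z * F z) = (\<Sum>b<g. f b * (\<Sum>z\<in>J. PVar z * PConst (coef (L b c) (mon z 1))))"
    unfolding F_def sum_distrib_left by (subst sum.swap) (simp add: mult_ac)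
  also have "\<dots> = (\<Sum>b<g. f b * L b c)"
    by (intro sum.cong refl arg_cong2[of _ _ _ _ "(*)"] linear_form_eq[OF J, symmetric])
      (use L c in auto)
  finally have sum0: "(\<Sum>z\<in>J. PVar z * F z) = 0" using syz c by simp
  let ?uy = "u + mon y 1"
  have Fy: "coef (PVar y * F y) ?uy \<noteq> 0"
  proof -
    have "coef (F y) u = (\<Sum>b<g. la b * coef (L b c) (mon y 1))"
      by (simp add: F_def lookup_sum coef_PConst_mult la_def) (simp add: mult.commute)
    also have "\<dots> = coef (M c) s" by (simp add: M_def lookup_sum coef_PConst_mult y)
    finally have "coef (F y) u \<noteq> 0" using s(1) by (simp add: in_keys_iff)
    then show ?thesis by (simp add: coef_PVar_mult supp_add_nat)
  qed
  \<comment> \<open>The term \<open>u y\<close> occurs in the summand of \<open>y\<close> and has to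
    cancel against the summand of another edge \<open>a\<close>.\<close>
  have "(\<Sum>z\<in>J. coef (PVar z * F z) ?uy) = 0" using sum0 by (metis lookup_sum lookup_zero)
  then have "(\<Sum>z\<in>J - {y}. coef (PVar z * F z) ?uy) = - coef (PVar y * F y) ?uy"
    using J yJ by (simp add: sum.remove[of J y] add_eq_0_iff)
  then have "(\<Sum>z\<in>J - {y}. coef (PVar z * F z) ?uy) \<noteq> 0" using Fy by simp
  then obtain a where "a \<in> J - {y}" and a_coef: "coef (PVar a * F a) ?uy \<noteq> 0"
    by (rule sum.not_neutral_contains_not_neutral)
  then have a: "a \<in> J" "a \<noteq> y" by auto
  then have a': "a \<in> supp ?uy" "?uy - mon a 1 \<in> supp (F a)"
    using a_coef by (auto simp: coef_PVar_mult in_keys_iff split: if_splits)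
  then have "a \<in> supp u" using a(2) by (auto simp: supp_add_nat split: if_splits)
  obtain Q where Q: "Q \<in> supp (F a)" "Q \<noteq> ?uy - mon a 1" "vdeg e Q = vdeg e (?uy - mon a 1)"
    by (rule toric_ideal_partner[OF F a'(2)])
  have "supp Q \<subseteq> J" using polysD[OF toric_ideal_polys[OF F] Q(1)] .
  then show ?thesis by (rule that[OF yt yJ \<open>a \<in> supp u\<close> a(2) _ Q(2,3)])
qed

section \<open>Generators and first syzygies of a linear resolution\<close>

text \<open>The first matrix lists the generators. Linearity places the basis of the first module in
  degree \<open>q\<close> and that of the second in degree \<open>q + 1\<close>, so the columns of
  the second matrix are the required linear syzygies.\<close>

lemma linear_resolution_generators:
  fixes I :: "('i, 'k::field) mpoly set"
  assumes "has_linear_resolution q J I"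
  shows "\<exists>g f. (\<forall>b<g. f b \<in> polys J \<and> (\<forall>t\<in>supp (f b). mon_deg t = q)) \<and>
    I = {\<Sum>b<g. f b * w b | w. \<forall>b<g. w b \<in> polys J} \<and> linear_syzygies J g f"
proof -
  obtain h d D where res: "minimal_graded_resolution J I h d D"
    and deg: "\<And>i j. i \<in> {1..h} \<Longrightarrow> j \<noteq> q + i - 1 \<Longrightarrow> count_list (d i) j = 0"
    using assms unfolding has_linear_resolution_def graded_betti_def by blast
  have h: "1 \<le> h" and d0: "d 0 = [0]" using res by (auto simp: minimal_graded_resolution_def)
  have dd: "d i ! b = q + i - 1" if "i \<in> {1..h}" "b < length (d i)" for i b
  proof (rule ccontr)
    assume "\<not> ?thesis"
    then have "count_list (d i) (d i ! b) = 0" by (rule deg[OF that(1)])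
    then show False using that(2) by (simp add: count_list_0_iff)
  qed
  have D: "D i \<in> carrier_mat (length (d (i - 1))) (length (d i))"
    "a < length (d (i - 1)) \<Longrightarrow> b < length (d i) \<Longrightarrow> D i $$ (a, b) \<in> polys J"
    "a < length (d (i - 1)) \<Longrightarrow> b < length (d i) \<Longrightarrow> t \<in> supp (D i $$ (a, b)) \<Longrightarrow>
      mon_deg t + d (i - 1) ! a = d i ! b" if "i \<in> {1..h}" for i a b t
  proof -
    have *: "D i \<in> carrier_mat (length (d (i - 1))) (length (d i))" "elements_mat (D i) \<subseteq> polys J"
      "\<forall>a < length (d (i - 1)). \<forall>b < length (d i). \<forall>t \<in> Poly_Mapping.keys (D i $$ (a, b)).
        mon_deg t + d (i - 1) ! a = d i ! b"
      using res that unfolding minimal_graded_resolution_def by blast+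
    show "D i \<in> carrier_mat (length (d (i - 1))) (length (d i))" by (rule *(1))
    show "D i $$ (a, b) \<in> polys J" if "a < length (d (i - 1))" "b < length (d i)"
      using *(2) elements_matI[OF *(1) that refl] by blast
    show "mon_deg t + d (i - 1) ! a = d i ! b"
      if "a < length (d (i - 1))" "b < length (d i)" "t \<in> supp (D i $$ (a, b))"
      using *(3) that by blast
  qed
  define g where "g = length (d 1)"
  define f where "f b = D 1 $$ (0, b)" for b
  have 1: "1 \<in> {1..h}" using h by simp
  have f: "f b \<in> polys J" "t \<in> supp (f b) \<Longrightarrow> mon_deg t = q" if "b < g" for b t
    using D(2)[OF 1, of 0 b] D(3)[OF 1, of 0 b t] dd[OF 1, of b] that d0
    by (auto simp: g_def f_def)
  have D1: "(D 1 *\<^sub>v w) $ 0 = (\<Sum>b<g. f b * w $ b)" if "w \<in> carrier_vec g" for w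
    using D(1)[OF 1] that d0
    by (auto simp: g_def f_def scalar_prod_def lessThan_atLeast0 intro!: sum.cong)
  have D1_0: "D 1 *\<^sub>v w = 0\<^sub>v (length (d 0)) \<longleftrightarrow> (\<Sum>b<g. f b * w $ b) = 0" if "w \<in> carrier_vec g" for w
  proof -
    have "dim_vec (D 1 *\<^sub>v w) = 1" using D(1)[OF 1] d0 by simp
    then have "D 1 *\<^sub>v w = 0\<^sub>v (length (d 0)) \<longleftrightarrow> (D 1 *\<^sub>v w) $ 0 = 0"
      using d0 by (auto simp: vec_eq_iff)
    then show ?thesis unfolding D1[OF that] .
  qed
  have free: "vec g w \<in> free_mod J g \<longleftrightarrow> (\<forall>b<g. w b \<in> polys J)" for w :: "nat \<Rightarrow> ('i, 'k) mpoly" and g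
    by (auto simp: free_mod_def vec_set_def)
  have free': "v \<in> free_mod J g \<longleftrightarrow> v \<in> carrier_vec g \<and> (\<forall>b<g. v $ b \<in> polys J)" for v g
    by (auto simp: free_mod_def vec_set_def)
  have I: "I = (\<lambda>w. (D 1 *\<^sub>v w) $ 0) ` free_mod J g"
    using res by (simp add: minimal_graded_resolution_def g_def)
  have "I = {\<Sum>b<g. f b * w b | w. \<forall>b<g. w b \<in> polys J}"
  proof (intro subset_antisym subsetI)
    fix p assume "p \<in> I"
    then obtain w where "w \<in> free_mod J g" "p = (D 1 *\<^sub>v w) $ 0" unfolding I by blast
    then show "p \<in> {\<Sum>b<g. f b * w b | w. \<forall>b<g. w b \<in> polys J}"
      using D1[of w] unfolding free' by blast
  next
    fix p assume "p \<in> {\<Sum>b<g. f b * w b | w. \<forall>b<g. w b \<in> polys J}"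
    then obtain w where w: "p = (\<Sum>b<g. f b * w b)" "\<forall>b<g. w b \<in> polys J" by blast
    then have "p = (D 1 *\<^sub>v vec g w) $ 0" using D1[of "vec g w"] by simp
    then show "p \<in> I" unfolding I using w(2) free by blast
  qed
  moreover have "linear_syzygies J g f"
    unfolding linear_syzygies_def
  proof (intro allI impI)
    fix \<kappa> assume \<kappa>: "(\<forall>b<g. \<kappa> b \<in> polys J) \<and> (\<Sum>b<g. f b * \<kappa> b) = 0"
    then have ker: "vec g \<kappa> \<in> {v \<in> free_mod J (length (d 1)). D 1 *\<^sub>v v = 0\<^sub>v (length (d 0))}"
      using free D1_0[of "vec g \<kappa>"] by (simp add: g_def)
    show "\<exists>(r::nat) L w. (\<forall>b<g. \<kappa> b = (\<Sum>c<r. L b c * w c)) \<and>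
        (\<forall>b<g. \<forall>c<r. L b c \<in> polys J \<and> (\<forall>t\<in>supp (L b c). mon_deg t = 1)) \<and>
        (\<forall>c<r. (\<Sum>b<g. f b * L b c) = 0)"
    proof (cases "h = 1")
      \<comment> \<open>A resolution of length one has injective \<open>D 1\<close>, so
        \<open>\<kappa>\<close> vanishes and no columns are needed.\<close>
      case True
      moreover have "{v \<in> free_mod J (length (d h)). D h *\<^sub>v v = 0\<^sub>v (length (d (h - 1)))} = {0\<^sub>v (length (d h))}"
        using res by (simp add: minimal_graded_resolution_def)
      ultimately have "{v \<in> free_mod J (length (d 1)). D 1 *\<^sub>v v = 0\<^sub>v (length (d 0))} = {0\<^sub>v (length (d 1))}"
        by simp
      then have "vec g \<kappa> = 0\<^sub>v g" using ker by (auto simp: g_def)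
      then have "\<forall>b<g. \<kappa> b = 0" by (auto simp: vec_eq_iff)
      then show ?thesis by (intro exI[of _ "0::nat"]) simp
    next
      case False
      then have h2: "1 \<in> {1..<h}" "2 \<in> {1..h}" using h by auto
      define r where "r = length (d 2)"
      have img: "{v \<in> free_mod J (length (d 1)). D 1 *\<^sub>v v = 0\<^sub>v (length (d 0))} =
          (\<lambda>w. D 2 *\<^sub>v w) ` free_mod J r"
      proof -
        have "\<forall>i\<in>{1..<h}. {v \<in> free_mod J (length (d i)). D i *\<^sub>v v = 0\<^sub>v (length (d (i - 1)))} =
          (\<lambda>w. D (i + 1) *\<^sub>v w) ` free_mod J (length (d (i + 1)))"
          using res by (simp add: minimal_graded_resolution_def)
        from bspec[OF this h2(1)] show ?thesis by (simp add: r_def numeral_2_eq_2)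
      qed
      have D2c: "D 2 \<in> carrier_mat g r" using D(1)[OF h2(2)] by (simp add: g_def r_def numeral_2_eq_2)
      have D2: "D 2 $$ (b, c) \<in> polys J" "t \<in> supp (D 2 $$ (b, c)) \<Longrightarrow> mon_deg t = 1"
        if "b < g" "c < r" for b c t
      proof -
        have b: "b < length (d (2 - 1))" "c < length (d 2)" using that by (auto simp: g_def r_def)
        show "D 2 $$ (b, c) \<in> polys J" by (rule D(2)[OF h2(2) b])
        assume t: "t \<in> supp (D 2 $$ (b, c))"
        show "mon_deg t = 1"
          using D(3)[OF h2(2) b t] dd[OF h2(2) b(2)] dd[OF 1, of b] b(1) by simp
      qed
      from ker obtain w where w: "w \<in> free_mod J r" "vec g \<kappa> = D 2 *\<^sub>v w" unfolding img by blast
      have "\<kappa> b = (\<Sum>c<r. D 2 $$ (b, c) * w $ c)" if "b < g" for b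
      proof -
        have "\<kappa> b = (D 2 *\<^sub>v w) $ b" using that by (simp flip: w(2))
        then show ?thesis using D2c w(1) that
          by (auto simp: free' scalar_prod_def lessThan_atLeast0 intro!: sum.cong)
      qed
      moreover have "(\<Sum>b<g. f b * D 2 $$ (b, c)) = 0" if c: "c < r" for c
      proof -
        have "unit_vec r c \<in> free_mod J r" using c by (auto simp: free' unit_vec_def)
        then have "D 2 *\<^sub>v unit_vec r c \<in> {v \<in> free_mod J (length (d 1)). D 1 *\<^sub>v v = 0\<^sub>v (length (d 0))}"
          unfolding img by blast
        moreover have "D 2 *\<^sub>v unit_vec r c = col (D 2) c"
          by (intro eq_vecI) (use D2c c in \<open>auto simp: scalar_prod_right_unit\<close>)
        ultimately have "D 1 *\<^sub>v col (D 2) c = 0\<^sub>v (length (d 0))" by simp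
        moreover have "col (D 2) c \<in> carrier_vec g" using D2c c by (simp add: col_carrier_vec)
        ultimately have "(\<Sum>b<g. f b * col (D 2) c $ b) = 0" using D1_0 by blast
        then show ?thesis using D2c c by simp
      qed
      ultimately show ?thesis using D2 by (intro exI[of _ r] exI[of _ "\<lambda>b c. D 2 $$ (b, c)"] exI[of _ "\<lambda>c. w $ c"]) simp
    qed
  qed
  ultimately show ?thesis using f by (intro exI[of _ g] exI[of _ f]) simp
qed

text \<open>Every nonconstant term of \<open>w\<close> raises the degree above
  \<open>q\<close>.\<close>

lemma coef_mult_homogeneous:
  fixes f w :: "('i, 'k::field) mpoly"
  assumes f: "\<And>s. s \<in> supp f \<Longrightarrow> mon_deg s = q" and t: "mon_deg t = q"
  shows "coef (f * w) t = coef w 0 * coef f t"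
proof -
  define w' where "w' = w - PConst (coef w 0)"
  have "t \<notin> supp (f * w')"
  proof
    assume "t \<in> supp (f * w')"
    then obtain a b where ab: "a \<in> supp f" "b \<in> supp w'" "t = a + b" by (rule supp_multE)
    then have "mon_deg b = 0" using f t by (simp add: mon_deg_add)
    then show False using ab(2) by (simp add: mon_deg_eq_0 w'_def in_keys_iff lookup_minus PConst_def)
  qed
  moreover have "f * w = PConst (coef w 0) * f + f * w'" by (simp add: w'_def algebra_simps)
  ultimately show ?thesis by (simp add: lookup_add coef_PConst_mult in_keys_iff)
qed

text \<open>If all generators are proportional, they are multiples of a binomial
  \<open>u - v\<close>, and one variable from each term suffices. Otherwise
  \<open>linear_syzygy_disjoint\<close> is applied twice with the same \<open>u\<close>, and the two
  edges obtained contradict each other.\<close>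

theorem toric_linear_two_variables:
  fixes e :: "'i \<Rightarrow> 'v set" and J :: "'i set" and q :: nat
  defines "I \<equiv> (toric_ideal J e :: ('i, 'k::field) mpoly set)"
  assumes q4: "4 \<le> q" and J: "finite J" "\<And>j. j \<in> J \<Longrightarrow> card (e j) = 2" "inj_on e J"
    and lin: "has_linear_resolution q J I"
  obtains x y where "x \<in> J" "y \<in> J" "x \<noteq> y"
    "\<And>p t. p \<in> I \<Longrightarrow> t \<in> supp p \<Longrightarrow> x \<in> supp t \<or> y \<in> supp t"
proof -
  from linear_resolution_generators[OF lin] obtain g f
    where f: "\<forall>b<g. f b \<in> polys J \<and> (\<forall>t\<in>supp (f b). mon_deg t = q)"
      and I: "I = {\<Sum>b<g. f b * w b | w. \<forall>b<g. w b \<in> polys J}" and syz: "linear_syzygies J g f"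
    by (elim exE conjE)
  have fJ: "f b \<in> polys J" and fq: "t \<in> supp (f b) \<Longrightarrow> mon_deg t = q" if "b < g" for b t
    using f that by auto
  have fI: "f b \<in> I" if "b < g" for b
  proof -
    have "(\<Sum>b'<g. f b' * (if b' = b then 1 else 0)) = (\<Sum>b'<g. if b' = b then f b else 0)"
      by (intro sum.cong) auto
    then have "f b = (\<Sum>b'<g. f b' * (if b' = b then 1 else 0))" using that by simp
    moreover have "\<forall>b'<g. (if b' = b then 1 else 0) \<in> (polys J :: ('i, 'k) mpoly set)" by simp
    ultimately show ?thesis unfolding I by (intro CollectI exI conjI)
  qed
  have min: "q \<le> mon_deg t" if p: "p \<in> I" and t: "t \<in> supp p" for p t
  proof -
    from p obtain w where w: "p = (\<Sum>b<g. f b * w b)" unfolding I by blast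
    have "t \<in> (\<Union>b<g. supp (f b * w b))" using t unfolding w by (rule subsetD[OF supp_sum])
    then obtain b where b: "b < g" "t \<in> supp (f b * w b)" by auto
    from b(2) obtain s s' where "s \<in> supp (f b)" "t = s + s'" by (rule supp_multE)
    then show ?thesis using fq[OF b(1)] by (simp add: mon_deg_add)
  qed
  interpret edge_lattice J e q
    by (rule edge_lattice_if_min_degree[where ?'k = 'k]) (use J min in \<open>auto simp: I_def\<close>)
  \<comment> \<open>In the lowest degree the generators span the ideal over the field.\<close>
  have combination: "\<exists>c. p = (\<Sum>b<g. PConst (c b) * f b)"
    if p: "p \<in> I" and hom: "\<forall>t\<in>supp p. mon_deg t = q" for p
  proof -
    from p obtain w where w: "p = (\<Sum>b<g. f b * w b)" unfolding I by blast
    have "p = (\<Sum>b<g. PConst (coef (w b) 0) * f b)"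
    proof (rule poly_mapping_eqI)
      fix t
      show "coef p t = coef (\<Sum>b<g. PConst (coef (w b) 0) * f b) t"
      proof (cases "mon_deg t = q")
        case True
        then show ?thesis unfolding w
          by (simp add: lookup_sum coef_PConst_mult coef_mult_homogeneous[OF fq])
      next
        case False
        then have "coef p t = 0" "\<And>b. b < g \<Longrightarrow> coef (f b) t = 0"
          using hom fq by (auto simp: in_keys_iff)
        then show ?thesis by (simp add: lookup_sum coef_PConst_mult)
      qed
    qed
    then show ?thesis by (rule exI[of _ "\<lambda>b. coef (w b) 0"])
  qed
  have "I \<noteq> {0}" using lin by (simp add: has_linear_resolution_def)
  have "\<exists>b1<g. f b1 \<noteq> 0"
  proof (rule ccontr)
    assume "\<not> ?thesis"
    then have "I \<subseteq> {0}" unfolding I by auto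
    moreover have "0 \<in> I" by (simp add: I_def toric_ideal_def)
    ultimately show False using \<open>I \<noteq> {0}\<close> by blast
  qed
  then obtain b1 where b1: "b1 < g" "f b1 \<noteq> 0" by blast
  then obtain u where u: "u \<in> supp (f b1)" by (metis keys_eq_empty ex_in_conv)
  obtain v where v: "v \<in> supp (f b1)" "v \<noteq> u" "vdeg e v = vdeg e u"
    using fI[OF b1(1)] u unfolding I_def by (rule toric_ideal_partner)
  have uvJ: "supp u \<subseteq> J" "supp v \<subseteq> J" using polysD[OF fJ[OF b1(1)]] u v by auto
  have uvq: "mon_deg u = q" "mon_deg v = q" using fq[OF b1(1)] u v by auto
  show ?thesis
  proof (cases "\<forall>b<g. \<exists>c. f b = PConst c * f b1")
    case True
    then obtain c where c: "\<And>b. b < g \<Longrightarrow> f b = PConst (c b) * f b1" by metis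
    let ?m = "mon u 1 - mon v 1 :: ('i, 'k) mpoly"
    have m_I: "?m \<in> I" unfolding I_def by (rule toric_ideal_binomial) (use uvJ v in auto)
    have m_q: "\<forall>t\<in>supp ?m. mon_deg t = q"
      using uvq by (auto simp: in_keys_iff lookup_minus coef_mon split: if_splits)
    from combination[OF m_I m_q] obtain c' where c': "?m = (\<Sum>b<g. PConst (c' b) * f b)" by (elim exE)
    have "?m = PConst (\<Sum>b<g. c' b * c b) * f b1"
    proof -
      have "PConst (\<Sum>b<g. c' b * c b) = (\<Sum>b<g. PConst (c' b) * PConst (c b) :: ('i, 'k) mpoly)" for g
        by (induction g) (auto simp: PConst_add PConst_mult)
      then show ?thesis unfolding c' by (simp add: c sum_distrib_right mult.assoc)
    qed
    then have m: "coef ?m t = (\<Sum>b<g. c' b * c b) * coef (f b1) t" for t by (simp add: coef_PConst_mult)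
    moreover have "coef ?m u \<noteq> 0" using v(2) by (simp add: lookup_minus coef_mon)
    ultimately have nz: "(\<Sum>b<g. c' b * c b) \<noteq> 0" by auto
    \<comment> \<open>The binomial is a nonzero scalar multiple of \<open>f b1\<close>, so
      \<open>f b1\<close> has no other monomials.\<close>
    have uv: "s = u \<or> s = v" if "s \<in> supp (f b1)" for s
      using m[of s] nz that by (auto simp: in_keys_iff lookup_minus coef_mon split: if_splits)
    \<comment> \<open>Otherwise both terms would be powers of one variable and coincide by
      degree.\<close>
    have "\<exists>x\<in>supp u. \<exists>y\<in>supp v. x \<noteq> y"
    proof (rule ccontr)
      assume *: "\<not> ?thesis"
      have "u \<noteq> 0" "v \<noteq> 0" using uvq q4 mon_deg_eq_0[of u] mon_deg_eq_0[of v] by auto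
      then obtain x y where xy: "x \<in> supp u" "y \<in> supp v" by (metis keys_eq_empty ex_in_conv)
      have all: "x' = y'" if "x' \<in> supp u" "y' \<in> supp v" for x' y' using * that by blast
      have s: "supp u = {x}" "supp v = {x}"
        using xy all[OF _ xy(2)] all[OF xy(1)] by blast+
      have "u = v"
      proof (rule poly_mapping_eqI)
        fix i
        have "coef u x = q" "coef v x = q" using uvq s by (simp_all add: mon_deg_def)
        moreover have "coef u i = 0" "coef v i = 0" if "i \<noteq> x"
          using s that by (simp_all flip: not_in_keys_iff_lookup_eq_zero)
        ultimately show "coef u i = coef v i" by (cases "i = x") simp_all
      qed
      then show False using v by simp
    qed
    then obtain x y where xy: "x \<in> supp u" "y \<in> supp v" "x \<noteq> y" by blast
    show ?thesis
    proof (rule that[of x y])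
      fix p t assume "p \<in> I" and t: "t \<in> supp p"
      then obtain w where "p = (\<Sum>b<g. f b * w b)" unfolding I by blast
      also have "\<dots> = f b1 * (\<Sum>b<g. PConst (c b) * w b)"
        by (simp add: c sum_distrib_left mult_ac)
      finally have "t \<in> supp (f b1 * (\<Sum>b<g. PConst (c b) * w b))" using t by simp
      then obtain s s' where "s \<in> supp (f b1)" "t = s + s'" by (rule supp_multE)
      then show "x \<in> supp t \<or> y \<in> supp t" using uv xy by (auto simp: supp_add_nat)
    qed (use xy uvJ in auto)
  next
    case False
    then obtain b2 where b2: "b2 < g" "\<And>c. f b2 \<noteq> PConst c * f b1" by blast
    have uc: "coef (f b1) u \<noteq> 0" using u by (simp add: in_keys_iff)
    \<comment> \<open>\<open>k\<close> is chosen so that \<open>u\<close> cancels in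
      \<open>f2\<close>.\<close>
    define k where "k = coef (f b2) u / coef (f b1) u"
    define f2 where "f2 = f b2 - PConst k * f b1"
    have "f2 \<noteq> 0" using b2(2)[of k] by (simp add: f2_def)
    then obtain t where t: "t \<in> supp f2" by (metis keys_eq_empty ex_in_conv)
    have f1_comb: "f b1 = (\<Sum>b<g. PConst (of_bool (b = b1)) * f b)"
    proof -
      have "(\<Sum>b<g. PConst (of_bool (b = b1)) * f b) = (\<Sum>b<g. if b = b1 then f b1 else 0)"
        by (intro sum.cong) auto
      then show ?thesis using b1(1) by simp
    qed
    have minus_supp: "set_mset (exps u - {#a#}) \<subseteq> supp u" for a
      using set_mset_mono[OF diff_subset_eq_self[of "exps u" "{#a#}"]] by simp
    \<comment> \<open>One round of the argument for any \<open>f2'\<close> in which \<open>u\<close>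
      does not occur; it is run for \<open>f2\<close> and then for the binomial formed from the
      resulting \<open>Q\<close>.\<close>
    have dest: "thesis" if A: "f2' \<in> I" "\<forall>t\<in>supp f2'. mon_deg t = q" "coef f2' u = 0" "t \<in> supp f2'"
      and B: "\<And>y a Q. y \<in> supp t \<Longrightarrow> y \<in> J \<Longrightarrow> a \<in> supp u \<Longrightarrow> a \<noteq> y \<Longrightarrow> supp Q \<subseteq> J \<Longrightarrow>
        Q \<noteq> u + mon y 1 - mon a 1 \<Longrightarrow> vdeg e Q = vdeg e (u + mon y 1 - mon a 1) \<Longrightarrow>
        supp (u + mon y 1 - mon a 1) \<subseteq> J \<Longrightarrow>
        (\<And>x. vertex_deg (exps Q) x = vertex_deg (add_mset y (exps u - {#a#})) x) \<Longrightarrow>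
        y \<notin> supp Q \<Longrightarrow> (\<And>j. j \<in> supp u \<Longrightarrow> e j \<inter> e y = {}) \<Longrightarrow> thesis" for f2' t thesis
    proof -
      from combination[OF A(1,2)] obtain c2 where c2: "f2' = (\<Sum>b<g. PConst (c2 b) * f b)" by (elim exE)
      obtain y a Q where Q: "y \<in> supp t" "y \<in> J" "a \<in> supp u" "a \<noteq> y" "supp Q \<subseteq> J"
        "Q \<noteq> u + mon y 1 - mon a 1" "vdeg e Q = vdeg e (u + mon y 1 - mon a 1)"
        by (rule linear_syzygy_at_monomial[OF J(1) syz _ f1_comb c2 uc A(3,4)])
          (use fI in \<open>auto simp: I_def\<close>)
      have R: "exps (u + mon y 1 - mon a 1) = add_mset y (exps u - {#a#})"
        using Q(3) by (simp add: exps_add exps_diff exps_single[simplified])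
      have RJ: "supp (u + mon y 1 - mon a 1) \<subseteq> J"
        unfolding set_exps[symmetric] R using uvJ(1) Q(2) minus_supp[of a] by auto
      have dgQ: "vertex_deg (exps Q) x = vertex_deg (add_mset y (exps u - {#a#})) x" for x
        unfolding R[symmetric] by (rule vertex_deg_exps_eq) (use Q RJ in auto)
      have neq: "exps Q \<noteq> add_mset y (exps u - {#a#})"
        unfolding R[symmetric] exps_eq_iff by (rule Q(6))
      have *: "y \<notin># exps Q" "j \<in># exps u \<Longrightarrow> e j \<inter> e y = {}" for j
        by (rule linear_syzygy_disjoint[OF q4 _ _ _ Q(2) _ _ _ _ Q(4) neq dgQ, of "exps v"];
          use uvJ Q v uvq in \<open>auto simp: size_exps exps_eq_iff intro!: vertex_deg_exps_eq\<close>)+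
      show thesis by (rule B[OF Q RJ dgQ]) (use * in auto)
    qed
    have False
    proof (rule dest[of f2 t])
      show "f2 \<in> I"
        unfolding f2_def I_def
        by (intro toric_ideal_diff toric_ideal_mult) (use fI b1 b2 in \<open>auto simp: I_def\<close>)
      show "\<forall>s\<in>supp f2. mon_deg s = q"
      proof
        fix s assume "s \<in> supp f2"
        then have "s \<in> supp (f b1) \<or> s \<in> supp (f b2)"
          by (auto simp: f2_def in_keys_iff lookup_minus coef_PConst_mult)
        then show "mon_deg s = q" using fq[OF b1(1), of s] fq[OF b2(1), of s] by blast
      qed
      show "coef f2 u = 0" using uc by (simp add: f2_def lookup_minus coef_PConst_mult k_def)
      show "t \<in> supp f2" by (rule t)
    next
      fix y a Q
      let ?R = "u + mon y 1 - mon a 1"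
      assume yJ: "y \<in> J" and a: "a \<in> supp u" "a \<noteq> y" and Q: "supp Q \<subseteq> J" "Q \<noteq> ?R" "vdeg e Q = vdeg e ?R"
        and RJ: "supp ?R \<subseteq> J"
        and dgQ: "\<And>x. vertex_deg (exps Q) x = vertex_deg (add_mset y (exps u - {#a#})) x"
        and yQ: "y \<notin> supp Q" and y: "\<And>j. j \<in> supp u \<Longrightarrow> e j \<inter> e y = {}"
      let ?m = "mon Q 1 - mon ?R 1 :: ('i, 'k) mpoly"
      have mI: "?m \<in> I" unfolding I_def by (rule toric_ideal_binomial) (use Q RJ in auto)
      have szR: "mon_deg ?R = q"
      proof -
        have "exps ?R = add_mset y (exps u - {#a#})"
          using a by (simp add: exps_add exps_diff exps_single[simplified])
        then have "mon_deg ?R = size (add_mset y (exps u - {#a#}))" by (simp flip: size_exps)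
        also have "\<dots> = q" using a uvq(1) q4 by (simp add: size_Diff_singleton_if size_exps)
        finally show ?thesis .
      qed
      have "vertex_deg (exps Q) x = vertex_deg (exps ?R) x" for x by (rule vertex_deg_exps_eq) (use Q RJ in auto)
      then have szQ: "mon_deg Q = q"
        using size_eq_if_vertex_deg_eq[of "exps Q" "exps ?R"] Q(1) RJ szR by (simp add: size_exps)
      \<comment> \<open>The ends of \<open>y\<close> have positive degree in \<open>Q\<close>, while
        the edges of \<open>u\<close> avoid them.\<close>
      have "Q \<noteq> u"
      proof
        assume "Q = u"
        obtain z where z: "z \<in> e y" using J(2)[OF yJ] by (fastforce simp: card_2_iff)
        then have "0 < vertex_deg (exps u) z" using dgQ[of z] \<open>Q = u\<close> by (simp add: vertex_deg_add_mset)
        then show False using y z by (auto simp: vertex_deg_pos)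
      qed
      moreover have "?R \<noteq> u"
      proof
        assume "?R = u"
        then have "coef ?R a = coef u a" by simp
        then show False using a by (auto simp: lookup_minus lookup_add coef_mon in_keys_iff)
      qed
      ultimately have mu: "coef ?m u = 0" by (simp add: lookup_minus coef_mon)
      show False
      proof (rule dest[of ?m Q, OF mI _ mu])
        show "\<forall>s\<in>supp ?m. mon_deg s = q"
          using szQ szR by (auto simp: in_keys_iff lookup_minus coef_mon split: if_splits)
        show "Q \<in> supp ?m" using Q(2) by (auto simp: in_keys_iff lookup_minus coef_mon)
      next
        fix y' assume y': "y' \<in> supp Q" "y' \<in> J" and off: "\<And>j. j \<in> supp u \<Longrightarrow> e j \<inter> e y' = {}"
        \<comment> \<open>\<open>y'\<close> divides \<open>Q\<close>, whose vertices lie on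
          \<open>y\<close> or on edges of \<open>u\<close>; the latter are disjoint from
          \<open>y'\<close>.\<close>
        have "e y' \<subseteq> e y"
        proof
          fix z assume z: "z \<in> e y'"
          then have "0 < vertex_deg (exps Q) z" using y' by (auto simp: vertex_deg_pos)
          then have "0 < vertex_deg (add_mset y (exps u - {#a#})) z" by (simp add: dgQ)
          then obtain j where "j = y \<or> j \<in> supp u" "z \<in> e j" using minus_supp[of a] by (auto simp: vertex_deg_pos)
          then show "z \<in> e y" using off z by blast
        qed
        then have "e y' = e y"
          using J(2)[OF yJ] J(2)[OF y'(2)] by (metis card_subset_eq card.infinite zero_neq_numeral)
        then have "y' = y" using J(3) yJ y'(2) by (auto dest: inj_onD)
        then show False using y'(1) yQ by simp
      qed
    qed
    then show ?thesis ..
  qed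
qed

subsection \<open>Krull dimension of edge rings\<close>

abbreviation edge_map :: "('i \<Rightarrow> 'v set) \<Rightarrow> ('i, 'k::comm_ring_1) mpoly \<Rightarrow> ('v, 'k) mpoly"
  where "edge_map e \<equiv> psubst (edge_monomial e)"

lemma type_algebra_simps [simp]:
  "carrier ring_of_type_algebra = UNIV" "x \<otimes>\<^bsub>ring_of_type_algebra\<^esub> y = x * y"
  "\<one>\<^bsub>ring_of_type_algebra\<^esub> = 1" "\<zero>\<^bsub>ring_of_type_algebra\<^esub> = 0"
  "x \<oplus>\<^bsub>ring_of_type_algebra\<^esub> y = x + y"
  by (simp_all add: ring_of_type_algebra_def)

lemma type_algebra_uminus [simp]:
  "\<ominus>\<^bsub>ring_of_type_algebra\<^esub> x = - (x :: 'a::comm_ring_1)"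
proof -
  interpret ring "ring_of_type_algebra :: 'a ring" by (rule ring_from_type_algebra)
  show ?thesis using minus_equality[of "- x" x] by simp
qed

lemma edge_ring_simps [simp]:
  "x \<otimes>\<^bsub>edge_ring J e\<^esub> y = x * y" "\<one>\<^bsub>edge_ring J e\<^esub> = 1" "\<zero>\<^bsub>edge_ring J e\<^esub> = 0"
  "x \<oplus>\<^bsub>edge_ring J e\<^esub> y = x + y"
  by (simp_all add: edge_ring_def ring_of_type_algebra_def)

lemma carrier_edge_ring:
  "carrier (edge_ring J e :: ('v, 'k::comm_ring_1) mpoly ring) = edge_map e ` polys J"
proof -
  let ?H = "PConst ` UNIV \<union> edge_monomial e ` J :: ('v, 'k) mpoly set"
  let ?G = "generate_ring ring_of_type_algebra ?H"
  have add: "a + b \<in> ?G" and mult: "a * b \<in> ?G" if "a \<in> ?G" "b \<in> ?G" for a b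
    using generate_ring.eng_add[OF that] generate_ring.eng_mult[OF that] by simp_all
  have incl: "PConst c \<in> ?G" "j \<in> J \<Longrightarrow> edge_monomial e j \<in> ?G" for c j
    by (auto intro: generate_ring.incl)
  have 0: "0 \<in> ?G" and 1: "1 \<in> ?G" using incl(1)[of 0] incl(1)[of 1] by simp_all
  have sum: "sum f A \<in> ?G" if "\<And>i. i \<in> A \<Longrightarrow> f i \<in> ?G" for A and f :: "('a \<Rightarrow>\<^sub>0 nat) \<Rightarrow> _"
    using that by (induction A rule: infinite_finite_induct) (auto simp: 0 add)
  have prod: "prod f A \<in> ?G" if "\<And>i. i \<in> A \<Longrightarrow> f i \<in> ?G" for A and f :: "'a \<Rightarrow> _"
    using that by (induction A rule: infinite_finite_induct) (auto simp: 1 mult)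
  have power: "a ^ n \<in> ?G" if "a \<in> ?G" for a n
    using that by (induction n) (auto simp: 1 mult)
  have "edge_map e p \<in> ?G" if "p \<in> polys J" for p
    unfolding psubst_def by (intro sum mult prod power incl) (use polysD[OF that] in blast)
  moreover have "h \<in> edge_map e ` polys J" if "h \<in> ?G" for h
    using that
  proof induction
    case one
    then show ?case by (auto intro!: image_eqI[of _ _ 1])
  next
    case (incl h)
    then show ?case
    proof
      assume "h \<in> range PConst"
      then obtain c where "h = PConst c" by blast
      then show ?thesis by (auto intro!: image_eqI[of _ _ "PConst c"])
    next
      assume "h \<in> edge_monomial e ` J"
      then obtain j where "j \<in> J" "h = edge_monomial e j" by blast
      then show ?thesis by (auto intro!: image_eqI[of _ _ "PVar j"])
    qed
  next
    case (a_inv h)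
    then show ?case by (auto simp flip: psubst_uminus)
  next
    case (eng_add h1 h2)
    then show ?case by (auto simp flip: psubst_add)
  next
    case (eng_mult h1 h2)
    then show ?case by (auto simp flip: psubst_mult)
  qed
  ultimately show ?thesis by (auto simp: edge_ring_def)
qed

lemma cring_edge_ring: "cring (edge_ring J e :: ('v, 'k::comm_ring_1) mpoly ring)"
proof -
  interpret T: ring "ring_of_type_algebra :: ('v, 'k) mpoly ring" by (rule ring_from_type_algebra)
  let ?R = "edge_ring J e :: ('v, 'k) mpoly ring"
  interpret R: ring ?R unfolding edge_ring_def by (rule T.generate_ring_is_ring) simp
  show ?thesis by unfold_locales (simp add: mult.commute)
qed

section \<open>Prime ideals of the edge ring\<close>

text \<open>Primality in a subring \<open>C\<close> of the ambient type, without record structures.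
  Closure under negation comes from multiplication by \<open>-1\<close> when \<open>-1\<close> lies
  in \<open>C\<close>.\<close>

definition prime_in :: "'a::comm_ring_1 set \<Rightarrow> 'a set \<Rightarrow> bool" where
  "prime_in C P \<longleftrightarrow> P \<subseteq> C \<and> 0 \<in> P \<and> 1 \<notin> P \<and> (\<forall>a\<in>P. \<forall>b\<in>P. a + b \<in> P) \<and>
    (\<forall>a\<in>P. \<forall>b\<in>C. b * a \<in> P) \<and> (\<forall>a\<in>C. \<forall>b\<in>C. a * b \<in> P \<longrightarrow> a \<in> P \<or> b \<in> P)"

lemma primeideal_edge_ring_iff:
  fixes e :: "'i \<Rightarrow> 'v set"
  shows "primeideal P (edge_ring J e :: ('v, 'k::comm_ring_1) mpoly ring) \<longleftrightarrow>
    prime_in (edge_map e ` polys J) P"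
proof
  let ?R = "edge_ring J e :: ('v, 'k) mpoly ring"
  assume "primeideal P ?R"
  then interpret P: primeideal P ?R .
  have "\<one>\<^bsub>?R\<^esub> \<notin> P" using P.one_imp_carrier P.I_notcarr by blast
  then show "prime_in (edge_map e ` polys J) P"
    unfolding prime_in_def carrier_edge_ring[symmetric]
    using P.a_subset P.zero_closed P.a_closed P.I_l_closed P.I_prime
    by (intro conjI ballI impI) (simp_all add: additive_subgroup.zero_closed[OF P.is_additive_subgroup, simplified]
        additive_subgroup.a_closed[OF P.is_additive_subgroup, simplified])
next
  let ?R = "edge_ring J e :: ('v, 'k) mpoly ring"
  assume P: "prime_in (edge_map e ` polys J) P"
  interpret R: cring ?R by (rule cring_edge_ring)
  have C: "carrier ?R = edge_map e ` polys J" by (rule carrier_edge_ring)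
  have neg: "\<ominus>\<^bsub>?R\<^esub> a = - a" if "a \<in> carrier ?R" for a
  proof (rule R.minus_equality)
    show "- a \<in> carrier ?R" using that unfolding C by (auto simp flip: psubst_uminus)
  qed (use that in auto)
  have m1: "-1 \<in> carrier ?R" unfolding C by (auto intro!: image_eqI[of _ _ "-1"] simp: psubst_uminus)
  have "subgroup P (add_monoid ?R)"
  proof (rule group.subgroupI)
    show "group (add_monoid ?R)" by (rule R.add.is_group)
    show "P \<subseteq> carrier (add_monoid ?R)" "P \<noteq> {}" using P by (auto simp: prime_in_def C)
    show "inv\<^bsub>add_monoid ?R\<^esub> a \<in> P" if "a \<in> P" for a
    proof -
      have "a \<in> carrier ?R" using P that by (auto simp: prime_in_def C)
      then have "inv\<^bsub>add_monoid ?R\<^esub> a = -1 * a" using neg[of a] by (simp add: a_inv_def)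
      moreover have "-1 * a \<in> P" using P m1 that unfolding prime_in_def C[symmetric] by blast
      ultimately show ?thesis by simp
    qed
    show "a \<otimes>\<^bsub>add_monoid ?R\<^esub> b \<in> P" if "a \<in> P" "b \<in> P" for a b
      using P that by (auto simp: prime_in_def)
  qed
  then have "ideal P ?R"
    by (rule idealI[OF R.ring_axioms]) (use P in \<open>auto simp: prime_in_def C mult.commute\<close>)
  then show "primeideal P ?R"
  proof (rule primeidealI)
    show "carrier ?R \<noteq> P" using R.one_closed P by (auto simp: prime_in_def)
  qed (use P in \<open>auto simp: prime_in_def C intro: cring_edge_ring\<close>)
qed

section \<open>Lower bound: prime ideals generated by variables\<close>

definition var_ideal :: "'i set \<Rightarrow> 'i set \<Rightarrow> ('i, 'k::comm_ring_1) mpoly set" where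
  "var_ideal J Z = {p \<in> polys J. \<forall>t\<in>supp p. supp t \<inter> Z \<noteq> {}}"

lemma var_ideal_mult: "a \<in> var_ideal J Z \<Longrightarrow> b \<in> polys J \<Longrightarrow> b * a \<in> var_ideal J Z"
  unfolding var_ideal_def by (auto simp: polys_mult elim!: supp_multE) (auto simp: supp_add_nat)

lemma var_ideal_add: "a \<in> var_ideal J Z \<Longrightarrow> b \<in> var_ideal J Z \<Longrightarrow> a + b \<in> var_ideal J Z"
  unfolding var_ideal_def using keys_add[of a b] by auto

lemma var_ideal_diff: "a \<in> var_ideal J Z \<Longrightarrow> b \<in> var_ideal J Z \<Longrightarrow> a - b \<in> var_ideal J Z"
  using var_ideal_add[of a J Z "- b"] by (auto simp: var_ideal_def polys_uminus in_keys_iff)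

text \<open>Splitting off the terms that involve \<open>Z\<close> reduces the claim to the
  polynomial ring in the variables outside \<open>Z\<close>, which has no zero divisors; the linear
  order on the variables provides this.\<close>

lemma prime_var_ideal:
  "prime_in (polys J) (var_ideal J Z :: ('i::linorder, 'k::field) mpoly set)"
proof -
  let ?I = "var_ideal J Z :: ('i, 'k) mpoly set"
  have split: "\<exists>p0 p1. p = p0 + p1 \<and> p1 \<in> ?I \<and> p0 \<in> polys (J - Z)" if "p \<in> polys J" for p :: "('i, 'k) mpoly"
  proof -
    define A where "A = {t \<in> supp p. supp t \<inter> Z = {}}"
    define p0 where "p0 = (\<Sum>t\<in>A. mon t (coef p t))"
    define p1 where "p1 = (\<Sum>t\<in>supp p - A. mon t (coef p t))"
    have "p = p0 + p1"
      unfolding p0_def p1_def using sum_mon[of "supp p" p]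
      by (metis (no_types, lifting) A_def finite_keys mem_Collect_eq order_refl subsetI sum.subset_diff add.commute)
    moreover have "supp p0 \<subseteq> A"
      unfolding p0_def using supp_sum[of "\<lambda>t. mon t (coef p t)" A] by auto
    then have "p0 \<in> polys (J - Z)" using polysD[OF that] by (fastforce simp: A_def intro: polysI)
    moreover have "supp p1 \<subseteq> supp p - A"
      unfolding p1_def using supp_sum[of "\<lambda>t. mon t (coef p t)" "supp p - A"] by auto
    then have "p1 \<in> ?I" using polysD[OF that] unfolding var_ideal_def A_def by (fastforce intro: polysI)
    ultimately show ?thesis by blast
  qed
  have "a \<in> ?I \<or> b \<in> ?I" if ab: "a \<in> polys J" "b \<in> polys J" "a * b \<in> ?I" for a b
  proof -
    obtain a0 a1 b0 b1 where s: "a = a0 + a1" "a1 \<in> ?I" "a0 \<in> polys (J - Z)"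
      "b = b0 + b1" "b1 \<in> ?I" "b0 \<in> polys (J - Z)" using split ab by metis
    have a0: "a0 \<in> polys J" using s polys_mono[of "J - Z" J] by blast
    have "a0 * b1 + b * a1 \<in> ?I"
      by (intro var_ideal_add var_ideal_mult s a0 ab)
    then have "a * b - (a0 * b1 + b * a1) \<in> ?I" by (rule var_ideal_diff[OF ab(3)])
    also have "a * b - (a0 * b1 + b * a1) = a0 * b0" by (simp add: s algebra_simps)
    finally have "supp t \<inter> Z \<noteq> {}" if "t \<in> supp (a0 * b0)" for t using that by (auto simp: var_ideal_def)
    moreover have "a0 * b0 \<in> polys (J - Z)" using s by auto
    ultimately have "supp (a0 * b0) = {}" using polysD by fastforce
    then have "a0 = 0 \<or> b0 = 0" by simp
    then show ?thesis using s by auto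
  qed
  moreover have "1 \<notin> ?I" by (simp add: var_ideal_def)
  ultimately show ?thesis
    unfolding prime_in_def by (auto intro: var_ideal_add var_ideal_mult) (auto simp: var_ideal_def)
qed

text \<open>The toric ideal is the kernel of the substitution, so a prime ideal containing it is the
  full preimage of its image.\<close>

lemma prime_edge_map_image:
  fixes e :: "'i \<Rightarrow> 'v set" and P :: "('i, 'k::field) mpoly set"
  assumes P: "prime_in (polys J) P" and I: "toric_ideal J e \<subseteq> P"
  shows "prime_in (edge_map e ` polys J) (edge_map e ` P)"
    and "p \<in> polys J \<Longrightarrow> edge_map e p \<in> edge_map e ` P \<Longrightarrow> p \<in> P"
proof -
  have PJ: "P \<subseteq> polys J" using P by (simp add: prime_in_def)
  have m: "p \<in> P" if p: "p \<in> polys J" "edge_map e p \<in> edge_map e ` P" for p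
  proof -
    obtain p' where p': "p' \<in> P" "edge_map e p = edge_map e p'" using p(2) by blast
    then have "p - p' \<in> toric_ideal J e" using p(1) PJ by (auto simp: toric_ideal_def psubst_diff)
    then have "p - p' \<in> P" using I by blast
    then have "(p - p') + p' \<in> P" using P p' by (auto simp only: prime_in_def)
    then show ?thesis by simp
  qed
  then show "p \<in> polys J \<Longrightarrow> edge_map e p \<in> edge_map e ` P \<Longrightarrow> p \<in> P" by blast
  have "1 \<notin> edge_map e ` P" using m[of 1] P by (auto simp: prime_in_def)
  moreover have "0 \<in> edge_map e ` P" using P by (auto simp: prime_in_def intro!: image_eqI[of _ _ 0])
  moreover have "edge_map e a \<in> edge_map e ` P \<or> edge_map e b \<in> edge_map e ` P"
    if "a \<in> polys J" "b \<in> polys J" "edge_map e a * edge_map e b \<in> edge_map e ` P" for a b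
  proof -
    have "a * b \<in> P" using m[of "a * b"] that by (auto simp: psubst_mult)
    then have "a \<in> P \<or> b \<in> P" using P that(1,2) unfolding prime_in_def by blast
    then show ?thesis by blast
  qed
  ultimately show "prime_in (edge_map e ` polys J) (edge_map e ` P)"
    using P PJ unfolding prime_in_def by (auto simp flip: psubst_add psubst_mult)
qed

lemma krull_dim_edge_ring_ge:
  fixes e :: "'i::linorder \<Rightarrow> 'v::linorder set"
  assumes J: "finite J" and xy: "x \<in> J" "y \<in> J" "x \<noteq> y"
    and I: "toric_ideal J e \<subseteq> (var_ideal J {x, y} :: ('i, 'k::field) mpoly set)"
  shows "enat (card J - 1) \<le> krull_dim (edge_ring J e :: ('v, 'k) mpoly ring)"
proof -
  let ?R = "edge_ring J e :: ('v, 'k) mpoly ring"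
  obtain zs where zs: "set zs = J - {x, y}" "distinct zs" using finite_distinct_list[of "J - {x, y}"] J by blast
  define Z where "Z i = {x, y} \<union> set (take i zs)" for i
  have len: "length zs + 2 = card J"
  proof -
    have "length zs = card (J - {x, y})" using zs distinct_card by metis
    also have "\<dots> + 2 = card J" using xy J card_mono[of J "{x, y}"] by (subst card_Diff_subset) auto
    finally show ?thesis .
  qed
  \<comment> \<open>Index \<open>0\<close> is the zero ideal, so the variable ideals are shifted by
    one: \<open>P 1\<close> belongs to \<open>{x, y}\<close>, and each later index up to
    \<open>card J - 1\<close> adds one variable.\<close>
  define P :: "nat \<Rightarrow> ('v, 'k) mpoly set" where
    "P i = (case i of 0 \<Rightarrow> {0} | Suc i \<Rightarrow> edge_map e ` var_ideal J (Z i))" for i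
  have IZ: "toric_ideal J e \<subseteq> (var_ideal J (Z i) :: ('i, 'k) mpoly set)" for i
    using I by (force simp: var_ideal_def Z_def)
  have "prime_in (edge_map e ` polys J) {0 :: ('v, 'k) mpoly}"
    by (auto simp: prime_in_def intro!: image_eqI[of _ _ 0])
  then have prime: "primeideal (P i) ?R" for i
    unfolding primeideal_edge_ring_iff P_def
    by (cases i) (auto intro: prime_edge_map_image(1)[OF prime_var_ideal IZ])
  have strict: "P i \<subset> P (Suc i)" if "i < card J - 1" for i
  proof (cases i)
    case 0
    have "0 \<in> P 1" using prime[of 1] unfolding primeideal_edge_ring_iff by (simp add: prime_in_def)
    moreover have "edge_map e (PVar x) \<in> P 1"
      unfolding P_def by (auto simp: var_ideal_def Z_def PVar_def xy polys_mon simp del: psubst_PVar)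
    moreover have "edge_map e (PVar x) \<noteq> (0 :: ('v, 'k) mpoly)"
    proof
      assume "edge_map e (PVar x) = (0 :: ('v, 'k) mpoly)"
      then have "coef (edge_monomial e x ^ 1 :: ('v, 'k) mpoly) (\<Sum>v\<in>e x. mon v 1) = 0" by simp
      then show False unfolding edge_monomial_power by simp
    qed
    ultimately show ?thesis using 0 by (auto simp: P_def)
  next
    case (Suc k)
    have k: "k < length zs" using Suc that len by simp
    have "Z k \<subseteq> Z (Suc k)" using k by (auto simp: Z_def take_Suc_conv_app_nth)
    then have "var_ideal J (Z k) \<subseteq> (var_ideal J (Z (Suc k)) :: ('i, 'k) mpoly set)"
      by (force simp: var_ideal_def)
    then have "P i \<subseteq> P (Suc i)" by (auto simp: P_def Suc)
    moreover have zk: "zs ! k \<in> J" "zs ! k \<in> Z (Suc k)" "zs ! k \<notin> Z k"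
      using zs k by (auto simp: Z_def take_Suc_conv_app_nth in_set_conv_nth nth_eq_iff_index_eq dest: nth_mem)
    then have "edge_map e (PVar (zs ! k)) \<in> P (Suc i)"
      unfolding P_def Suc by (auto simp: var_ideal_def PVar_def polys_mon simp del: psubst_PVar)
    moreover have "edge_map e (PVar (zs ! k)) \<notin> P i"
    proof
      assume "edge_map e (PVar (zs ! k)) \<in> P i"
      then have "PVar (zs ! k) \<in> (var_ideal J (Z k) :: ('i, 'k) mpoly set)"
        using prime_edge_map_image(2)[OF prime_var_ideal IZ, of "PVar (zs ! k)"] zk by (simp add: P_def Suc)
      then show False using zk by (simp add: var_ideal_def PVar_def)
    qed
    ultimately show ?thesis by blast
  qed
  show ?thesis unfolding krull_dim_def
    by (rule Sup_upper) (use prime strict in blast)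
qed

section \<open>Upper bound: algebraic independence along chains of primes\<close>

text \<open>For \<open>r = 0\<close> this says that \<open>P\<close> contains no nonzero constant,
  which starts the induction along a chain.\<close>

definition alg_indep :: "('v, 'k::field) mpoly set \<Rightarrow> nat \<Rightarrow> (nat \<Rightarrow> ('v, 'k) mpoly) \<Rightarrow> bool" where
  "alg_indep P r t \<longleftrightarrow> (\<forall>F\<in>polys {..<r}. psubst t F \<in> P \<longrightarrow> F = 0)"

lemma psubst_edge_image:
  assumes "\<And>i. i \<in> A \<Longrightarrow> t i \<in> edge_map e ` polys J" "F \<in> polys A"
  shows "psubst t F \<in> edge_map e ` polys J"
proof -
  have "\<forall>i\<in>A. \<exists>p. p \<in> polys J \<and> t i = edge_map e p" using assms(1) by auto
  then obtain p where p: "\<forall>i\<in>A. p i \<in> polys J \<and> t i = edge_map e (p i)"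
    by (elim bchoice[THEN exE])
  have "psubst t F = psubst (\<lambda>i. edge_map e (p i)) F"
    by (rule psubst_cong[OF assms(2)]) (simp add: p)
  also have "\<dots> = edge_map e (psubst p F)" by (rule psubst_psubst[symmetric])
  finally show ?thesis using psubst_polys[OF assms(2), of p J] p by auto
qed

lemma prime_in_add: "prime_in C P \<Longrightarrow> a \<in> P \<Longrightarrow> b \<in> P \<Longrightarrow> a + b \<in> P"
  and prime_in_mult: "prime_in C P \<Longrightarrow> a \<in> P \<Longrightarrow> b \<in> C \<Longrightarrow> b * a \<in> P"
  and prime_in_prime: "prime_in C P \<Longrightarrow> a \<in> C \<Longrightarrow> b \<in> C \<Longrightarrow> a * b \<in> P \<Longrightarrow> a \<in> P \<or> b \<in> P"
  by (auto simp: prime_in_def)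

lemma prime_in_diff:
  assumes "prime_in (edge_map e ` polys J) P" "a \<in> P" "b \<in> P" shows "a - b \<in> P"
proof -
  have "- 1 \<in> edge_map e ` polys J" by (auto intro!: image_eqI[of _ _ "-1"] simp: psubst_uminus)
  then have "- 1 * b \<in> P" by (rule prime_in_mult[OF assms(1,3)])
  then have "a + - 1 * b \<in> P" by (rule prime_in_add[OF assms(1,2)])
  then show ?thesis by simp
qed

text \<open>A relation \<open>F\<close> between \<open>t\<close> and \<open>x\<close> modulo \<open>P\<close> becomes, modulo \<open>Q\<close>, a relation between the
  \<open>t\<close> alone, because \<open>x\<close> lies in \<open>Q\<close>; hence \<open>F\<close> is divisible by the last variable, which can be
  cancelled because \<open>x\<close> does not lie in \<open>P\<close>.\<close>

lemma alg_indep_extend: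
  fixes e :: "'i \<Rightarrow> 'v set" and J :: "'i set" and P Q :: "('v, 'k::field) mpoly set"
  defines "C \<equiv> edge_map e ` polys J"
  assumes P: "prime_in C P" and Q: "prime_in C Q" and PQ: "P \<subseteq> Q" and x: "x \<in> Q" "x \<notin> P"
    and t: "\<And>i. i < r \<Longrightarrow> t i \<in> C" and ind: "alg_indep Q r t"
  shows "alg_indep P (Suc r) (t(r := x))"
proof -
  let ?t = "t(r := x)"
  have xC: "x \<in> C" using Q x(1) by (auto simp: prime_in_def)
  have tC: "?t i \<in> C" if "i \<in> {..<Suc r}" for i using t xC that by (auto simp: less_Suc_eq)
  \<comment> \<open>Induction on a bound \<open>n\<close> for the degree of \<open>F\<close> in the
    last variable.\<close>
  have "F = 0" if "F \<in> polys {..<Suc r}" "\<forall>s\<in>supp F. coef s r \<le> n" "psubst ?t F \<in> P" for n F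
    using that
  proof (induction n arbitrary: F rule: less_induct)
    case (less n)
    \<comment> \<open>\<open>F\<close> is split as \<open>PVar r * G + F0\<close>, where
      \<open>F0\<close> collects the terms free of the last variable.\<close>
    define A where "A = {s \<in> supp F. coef s r = 0}"
    define F0 where "F0 = (\<Sum>s\<in>A. mon s (coef F s))"
    define G where "G = (\<Sum>s\<in>supp F - A. mon (s - mon r 1) (coef F s))"
    have A: "A \<subseteq> supp F" by (auto simp: A_def)
    have "PVar r * G = (\<Sum>s\<in>supp F - A. mon s (coef F s))"
      unfolding G_def sum_distrib_left
    proof (intro sum.cong refl)
      fix s assume "s \<in> supp F - A"
      then have "coef s r > 0" by (auto simp: A_def)
      then have "mon r 1 + (s - mon r 1) = s"
        by (intro poly_mapping_eqI) (auto simp: lookup_add lookup_minus coef_mon)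
      then show "PVar r * mon (s - mon r 1) (coef F s) = mon s (coef F s)"
        by (simp add: PVar_def mult_single)
    qed
    moreover have "(\<Sum>s\<in>supp F. mon s (coef F s)) = (\<Sum>s\<in>supp F - A. mon s (coef F s)) + F0"
      unfolding F0_def by (rule sum.subset_diff[OF A]) simp
    ultimately have F: "F = PVar r * G + F0" by (simp add: sum_mon)
    have sF0: "supp F0 \<subseteq> A"
      unfolding F0_def using supp_sum[of "\<lambda>s. mon s (coef F s)" A] by auto
    have F0: "F0 \<in> polys {..<r}"
    proof (rule polysI)
      fix s assume "s \<in> supp F0"
      then have s: "s \<in> supp F" "coef s r = 0" using sF0 by (auto simp: A_def)
      show "supp s \<subseteq> {..<r}"
      proof
        fix i assume i: "i \<in> supp s"
        then have "i < Suc r" using polysD[OF less.prems(1) s(1)] by auto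
        moreover have "i \<noteq> r" using i s(2) by (auto simp: in_keys_iff)
        ultimately show "i \<in> {..<r}" by simp
      qed
    qed
    have "supp G \<subseteq> (\<Union>s\<in>supp F - A. {s - mon r 1})"
      unfolding G_def using supp_sum[of "\<lambda>s. mon (s - mon r 1) (coef F s)" "supp F - A"]
        supp_mon_subset by fastforce
    then have sG: "\<exists>s\<in>supp F - A. s' = s - mon r 1" if "s' \<in> supp G" for s' using that by blast
    have G: "G \<in> polys {..<Suc r}"
    proof (rule polysI)
      fix s' assume "s' \<in> supp G"
      then obtain s where s: "s \<in> supp F" "s' = s - mon r 1" using sG by blast
      have "supp s' \<subseteq> supp s" by (auto simp: s(2) in_keys_iff lookup_minus)
      then show "supp s' \<subseteq> {..<Suc r}" using polysD[OF less.prems(1) s(1)] by blast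
    qed
    have GC: "psubst ?t G \<in> C" unfolding C_def by (rule psubst_edge_image[OF _ G]) (use tC in \<open>simp add: C_def\<close>)
    have sub: "psubst ?t F = psubst ?t G * x + psubst ?t F0"
      unfolding F by (simp add: psubst_add psubst_mult mult.commute)
    have "psubst ?t G * x \<in> Q" by (rule prime_in_mult[OF Q x(1) GC])
    moreover have "psubst ?t F \<in> Q" using less.prems(3) PQ by blast
    ultimately have "psubst ?t F - psubst ?t G * x \<in> Q" by (intro prime_in_diff[OF Q[unfolded C_def]])
    then have "psubst ?t F0 \<in> Q" by (simp add: sub)
    also have "psubst ?t F0 = psubst t F0" by (rule psubst_cong[OF F0]) auto
    finally have "F0 = 0" using ind F0 by (simp add: alg_indep_def)
    then have "psubst ?t G * x = psubst ?t F" using sub by simp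
    then have "psubst ?t G * x \<in> P" using less.prems(3) by (simp only:)
    then have GP: "psubst ?t G \<in> P" using prime_in_prime[OF P GC xC] x(2) by blast
    have "G = 0"
    proof (cases n)
      case 0
      then have "supp F - A = {}" using less.prems(2) by (auto simp: A_def)
      then show ?thesis unfolding G_def by (simp only: sum.empty)
    next
      case (Suc n')
      have dG: "\<forall>s'\<in>supp G. coef s' r \<le> n'"
      proof
        fix s' assume "s' \<in> supp G"
        then obtain s where s: "s \<in> supp F" "s' = s - mon r 1" using sG by blast
        then show "coef s' r \<le> n'" using less.prems(2) Suc by (auto simp: lookup_minus coef_mon)
      qed
      show ?thesis by (rule less.IH[OF _ G dG GP]) (simp add: Suc)
    qed
    then show ?case using F \<open>F0 = 0\<close> by simp
  qed
  moreover have "\<exists>n. \<forall>s\<in>supp F. coef s r \<le> n" for F :: "(nat, 'k) mpoly"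
    by (rule exI[of _ "\<Sum>s\<in>supp F. coef s r"]) (auto intro: member_le_sum)
  ultimately show ?thesis unfolding alg_indep_def by blast
qed

text \<open>Descends from the top of the chain: \<open>r\<close> elements independent modulo
  \<open>P (l - r)\<close> are extended by an element of \<open>P (l - r)\<close> outside the next
  smaller prime.\<close>

lemma prime_chain_alg_indep:
  fixes e :: "'i \<Rightarrow> 'v set" and J :: "'i set" and P :: "nat \<Rightarrow> ('v, 'k::field) mpoly set"
  defines "C \<equiv> edge_map e ` polys J"
  assumes P: "\<And>i. i \<le> l \<Longrightarrow> prime_in C (P i)" and strict: "\<And>i. i < l \<Longrightarrow> P i \<subset> P (Suc i)"
  shows "\<exists>t. (\<forall>i<l. t i \<in> C) \<and> alg_indep (P 0) l t"
proof -
  have "\<exists>t. (\<forall>i<r. t i \<in> C) \<and> alg_indep (P (l - r)) r t" if "r \<le> l" for r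
    using that
  proof (induction r)
    case 0
    have "F = 0" if F: "F \<in> polys {..<0::nat}" "psubst t F \<in> P l" for F :: "(nat, 'k) mpoly" and t
    proof (rule ccontr)
      assume "F \<noteq> 0"
      have "supp F \<subseteq> {0}" using polysD[OF F(1)] by auto
      then have "F = PConst (coef F 0)" using sum_mon[of "{0}" F] by (simp add: PConst_def)
      then have c: "F = PConst (coef F 0)" "coef F 0 \<noteq> 0" using \<open>F \<noteq> 0\<close> by (simp, metis PConst_0)
      have "psubst t F = PConst (coef F 0)" by (subst c(1)) simp
      then have "PConst (coef F 0) \<in> P l" using F(2) by simp
      moreover have "PConst (inverse (coef F 0)) \<in> C"
        unfolding C_def by (auto intro!: image_eqI[of _ _ "PConst (inverse (coef F 0))"])
      ultimately have "PConst (inverse (coef F 0)) * PConst (coef F 0) \<in> P l"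
        by (intro prime_in_mult[OF P]) simp_all
      also have "PConst (inverse (coef F 0)) * PConst (coef F 0) = (1 :: ('v, 'k) mpoly)"
        using c(2) by (simp flip: PConst_mult)
      finally show False using P[of l] by (simp add: prime_in_def)
    qed
    then show ?case by (auto simp: alg_indep_def)
  next
    case (Suc r)
    then obtain t where t: "\<forall>i<r. t i \<in> C" "alg_indep (P (l - r)) r t" by auto
    have lr: "l - r = Suc (l - Suc r)" "l - Suc r < l" using Suc.prems by auto
    then have sub: "P (l - Suc r) \<subset> P (l - r)" using strict[OF lr(2)] by simp
    then obtain x where x: "x \<in> P (l - r)" "x \<notin> P (l - Suc r)" by blast
    have "alg_indep (P (l - Suc r)) (Suc r) (t(r := x))"
      by (rule alg_indep_extend[where e = e and J = J, OF _ _ _ x _ t(2)])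
        (use P sub t(1) in \<open>auto simp: C_def\<close>)
    moreover have "x \<in> C" using P[of "l - r"] x(1) by (auto simp: prime_in_def)
    then have "\<forall>i<Suc r. (t(r := x)) i \<in> C" using t(1) by (auto simp: less_Suc_eq)
    ultimately show ?case by blast
  qed
  from this[of l] show ?thesis by simp
qed

section \<open>Counting monomials and the growth of the Hilbert function\<close>

lemma card_exponent_box:
  assumes "finite A"
  shows "card {s. supp s \<subseteq> A \<and> (\<forall>i\<in>A. coef s i \<le> b i)} = (\<Prod>i\<in>A. Suc (b i))"
    and "finite {s. supp s \<subseteq> A \<and> (\<forall>i\<in>A. coef s i \<le> b i)}"
proof -
  let ?B = "{s. supp s \<subseteq> A \<and> (\<forall>i\<in>A. coef s i \<le> b i)}"
  let ?f = "\<lambda>s. restrict (coef s) A"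
  have inj: "inj_on ?f ?B"
  proof (rule inj_onI)
    fix s s' assume s: "s \<in> ?B" "s' \<in> ?B" and eq: "?f s = ?f s'"
    show "s = s'"
    proof (rule poly_mapping_eqI)
      fix i show "coef s i = coef s' i"
      proof (cases "i \<in> A")
        case True
        then show ?thesis using fun_cong[OF eq, of i] by simp
      next
        case False
        then have "i \<notin> supp s" "i \<notin> supp s'" using s by auto
        then show ?thesis by (simp add: in_keys_iff)
      qed
    qed
  qed
  have img: "?f ` ?B = (\<Pi>\<^sub>E i\<in>A. {..b i})"
  proof (intro equalityI subsetI)
    fix g assume g: "g \<in> (\<Pi>\<^sub>E i\<in>A. {..b i})"
    define s where "s = Abs_poly_mapping (\<lambda>i. if i \<in> A then g i else 0)"
    have s: "coef s i = (if i \<in> A then g i else 0)" for i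
      unfolding s_def by (subst lookup_Abs_poly_mapping) (auto intro: finite_subset[OF _ assms])
    have "s \<in> ?B" using g by (auto simp: s in_keys_iff PiE_iff split: if_splits)
    moreover have "g = ?f s" using g by (auto simp: s fun_eq_iff PiE_iff extensional_def)
    ultimately show "g \<in> ?f ` ?B" by blast
  qed auto
  have "finite (?f ` ?B)" unfolding img using assms by (intro finite_PiE) auto
  then show "finite ?B" using inj by (rule finite_imageD)
  have "card ?B = card (?f ` ?B)" using inj by (simp add: card_image)
  also have "\<dots> = (\<Prod>i\<in>A. Suc (b i))" unfolding img using assms by (simp add: card_PiE)
  finally show "card ?B = (\<Prod>i\<in>A. Suc (b i))" .
qed

definition deg_le :: "nat \<Rightarrow> ('i, 'k::comm_ring_1) mpoly \<Rightarrow> bool" where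
  "deg_le d p \<longleftrightarrow> (\<forall>s\<in>supp p. mon_deg s \<le> d)"

lemma deg_le_1: "deg_le d 1"
  by (auto simp: deg_le_def mon_deg_def)

lemma deg_le_mult: "deg_le a p \<Longrightarrow> deg_le b q \<Longrightarrow> deg_le (a + b) (p * q)"
  unfolding deg_le_def by (auto elim!: supp_multE simp: mon_deg_add dest!: bspec intro!: add_mono)

lemma deg_le_power: "deg_le d p \<Longrightarrow> deg_le (n * d) (p ^ n)"
  by (induction n) (auto simp: deg_le_1 intro: deg_le_mult)

lemma deg_le_prod: "finite A \<Longrightarrow> (\<And>i. i \<in> A \<Longrightarrow> deg_le (d i) (f i)) \<Longrightarrow> deg_le (\<Sum>i\<in>A. d i) (\<Prod>i\<in>A. f i)"
  by (induction A rule: finite_induct) (auto simp: deg_le_1 intro: deg_le_mult)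

text \<open>A binomial relation rewrites multiples of one of its terms \<open>a\<close> without
  changing vertex degrees. So each fibre has a representative not divisible by \<open>a\<close>, in
  which some exponent is bounded independently of \<open>K\<close>; this saves one factor
  \<open>Suc K\<close>.\<close>

lemma card_vdeg_le:
  fixes e :: "'i \<Rightarrow> 'v set"
  assumes J: "finite J" "\<And>j. j \<in> J \<Longrightarrow> card (e j) = 2" "inj_on e J"
    and uv: "supp u \<subseteq> J" "supp v \<subseteq> J" "u \<noteq> v" "vdeg e u = vdeg e v"
  shows "\<exists>c. \<forall>K. card (vdeg e ` {s. supp s \<subseteq> J \<and> mon_deg s \<le> K}) \<le> c * Suc K ^ (card J - 1)"
proof -
  \<comment> \<open>For \<open>0\<close> the minimality condition is vacuous; only the comparison of
    degrees is wanted.\<close>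
  interpret edge_lattice J e 0
  proof
    fix w :: "'i \<Rightarrow> int" and j
    assume "(\<Sum>j\<in>J. \<bar>w j\<bar>) < 2 * int 0"
    moreover have "0 \<le> (\<Sum>j\<in>J. \<bar>w j\<bar>)" by (simp add: sum_nonneg)
    ultimately show "w j = 0" by linarith
  qed (use J in auto)
  have deg: "mon_deg s = mon_deg s'" if "supp s \<subseteq> J" "supp s' \<subseteq> J" "vdeg e s = vdeg e s'" for s s'
    using size_eq_if_vertex_deg_eq[of "exps s" "exps s'"] vertex_deg_exps_eq[OF that] that by (simp add: size_exps)
  have "\<exists>x. coef u x \<noteq> coef v x" using uv(3) poly_mapping_eqI by metis
  \<comment> \<open>\<open>u\<close> and \<open>v\<close> are swapped if necessary, so that
    replacing \<open>a\<close> by \<open>b\<close> lowers the exponent of \<open>x\<close>.\<close>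
  then obtain a b x where ab: "supp a \<subseteq> J" "supp b \<subseteq> J" "vdeg e a = vdeg e b" "coef b x < coef a x"
    using uv by (metis linorder_neqE_nat)
  define c where "c = (\<Sum>i\<in>J. coef a i)"
  have ca: "coef a i \<le> c" for i
  proof (cases "i \<in> J")
    case True
    then show ?thesis unfolding c_def using J(1) by (intro member_le_sum) auto
  next
    case False
    then have "i \<notin> supp a" using ab by blast
    then show ?thesis by (simp add: in_keys_iff)
  qed
  show ?thesis
  proof (intro exI allI)
    fix K
    define A where "A = {s. supp s \<subseteq> J \<and> mon_deg s \<le> K}"
    define B where "B i = {s. supp s \<subseteq> J \<and> (\<forall>j\<in>J. coef s j \<le> (if j = i then c else K))}" for i
    \<comment> \<open>The rewriting stops because the exponent of \<open>x\<close> decreases, and it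
      stays in \<open>A\<close> because equal vertex degrees force equal degree.\<close>
    have red: "\<exists>s'\<in>A. vdeg e s' = vdeg e s \<and> (\<exists>i. coef s' i < coef a i)" if "s \<in> A" for s
      using that
    proof (induction "coef s x" arbitrary: s rule: less_induct)
      case less
      show ?case
      proof (cases "\<exists>i. coef s i < coef a i")
        case True
        then show ?thesis using less.prems by blast
      next
        case False
        then have le: "coef a i \<le> coef s i" for i by (simp add: not_less)
        define s' where "s' = s - a + b"
        have s: "s = s - a + a"
          using le by (intro poly_mapping_eqI) (simp add: lookup_add lookup_minus)
        have "vdeg e s' = vdeg e s" unfolding s'_def by (subst (2) s) (simp add: vdeg_add ab)
        moreover have "supp s' \<subseteq> J"
          using less.prems ab by (auto simp: s'_def A_def supp_add_nat in_keys_iff lookup_minus)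
        moreover have "mon_deg s' = mon_deg s"
          using deg[of s' s] calculation less.prems by (auto simp: A_def)
        ultimately have s': "s' \<in> A" "vdeg e s' = vdeg e s" using less.prems by (auto simp: A_def)
        have "coef s' x < coef s x" using ab(4) le[of x] by (simp add: s'_def lookup_add lookup_minus)
        then show ?thesis using less.hyps[OF _ s'(1)] s'(2) by auto
      qed
    qed
    have "vdeg e ` A \<subseteq> vdeg e ` (\<Union>i\<in>J. B i)"
    proof
      fix z assume "z \<in> vdeg e ` A"
      then obtain s where s: "s \<in> A" "z = vdeg e s" by blast
      obtain s' i where s': "s' \<in> A" "vdeg e s' = vdeg e s" "coef s' i < coef a i" using red[OF s(1)] by blast
      then have "i \<in> supp a" by (simp add: in_keys_iff)
      then have "i \<in> J" using ab by blast
      have "coef s' j \<le> K" if "j \<in> J" for j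
      proof -
        have "coef s' j \<le> mon_deg s'"
          unfolding mon_deg_def by (cases "j \<in> supp s'") (auto simp: in_keys_iff intro: member_le_sum)
        then show ?thesis using s'(1) by (simp add: A_def)
      qed
      moreover have "coef s' i \<le> c" using s'(3) ca[of i] by simp
      ultimately have "s' \<in> B i" using s'(1) by (auto simp: A_def B_def)
      then show "z \<in> vdeg e ` (\<Union>i\<in>J. B i)" using \<open>i \<in> J\<close> s s' by (metis UN_I image_eqI)
    qed
    moreover have B: "finite (B i)" "card (B i) = Suc c * Suc K ^ (card J - 1)" if "i \<in> J" for i
    proof -
      show "finite (B i)" unfolding B_def by (rule card_exponent_box(2)[OF J(1)])
      have "card (B i) = (\<Prod>j\<in>J. Suc (if j = i then c else K))"
        unfolding B_def by (rule card_exponent_box(1)[OF J(1)])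
      also have "\<dots> = Suc c * (\<Prod>j\<in>J - {i}. Suc (if j = i then c else K))"
        using prod.remove[OF J(1) that, of "\<lambda>j. Suc (if j = i then c else K)"] by simp
      also have "(\<Prod>j\<in>J - {i}. Suc (if j = i then c else K)) = (\<Prod>j\<in>J - {i}. Suc K)"
        by (intro prod.cong) auto
      finally show "card (B i) = Suc c * Suc K ^ (card J - 1)" using that by simp
    qed
    ultimately have "card (vdeg e ` A) \<le> card (vdeg e ` (\<Union>i\<in>J. B i))"
      using J(1) by (intro card_mono) auto
    also have "\<dots> \<le> card (\<Union>i\<in>J. B i)" using J(1) B by (intro card_image_le) auto
    also have "\<dots> \<le> (\<Sum>i\<in>J. card (B i))" by (rule card_UN_le[OF J(1)])
    also have "\<dots> = (\<Sum>i\<in>J. Suc c * Suc K ^ (card J - 1))" by (intro sum.cong refl B(2))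
    also have "\<dots> = (card J * Suc c) * Suc K ^ (card J - 1)"
      by (simp only: sum_constant of_nat_id mult.assoc)
    finally show "card (vdeg e ` {s. supp s \<subseteq> J \<and> mon_deg s \<le> K}) \<le> (card J * Suc c) * Suc K ^ (card J - 1)"
      unfolding A_def .
  qed
qed

text \<open>Algebraically independent elements have linearly independent monomials, while the
  image of the polynomials of bounded degree is spanned by few monomials.\<close>

lemma alg_indep_card_le:
  fixes e :: "'i \<Rightarrow> 'v set" and p :: "nat \<Rightarrow> ('i, 'k::field) mpoly"
  assumes J: "finite J" and p: "\<And>i. i < m \<Longrightarrow> p i \<in> polys J" "\<And>i. i < m \<Longrightarrow> deg_le d (p i)"
    and ind: "alg_indep {0} m (\<lambda>i. edge_map e (p i))"
  shows "Suc N ^ m \<le> card (vdeg e ` {s. supp s \<subseteq> J \<and> mon_deg s \<le> m * (N * d)})"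
proof -
  interpret vs: vector_space "\<lambda>(c::'k) (v::('v, 'k) mpoly). PConst c * v"
    by unfold_locales (simp_all add: PConst_add PConst_mult algebra_simps)
  let ?t = "\<lambda>i. edge_map e (p i) :: ('v, 'k) mpoly"
  \<comment> \<open>Exponents up to \<open>N\<close> in each of the \<open>m\<close> variables yield
    \<open>Suc N ^ m\<close> independent products.\<close>
  define \<Gamma> where "\<Gamma> = {s. supp s \<subseteq> {..<m} \<and> (\<forall>i\<in>{..<m}. coef s i \<le> N)}"
  have \<Gamma>: "card \<Gamma> = Suc N ^ m" "finite \<Gamma>"
    unfolding \<Gamma>_def using card_exponent_box[of "{..<m}" "\<lambda>_. N"] by simp_all
  have zero: "F = 0" if "F \<in> polys {..<m}" "psubst ?t F = 0" for F
    using ind that by (simp add: alg_indep_def)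
  have mon_t: "psubst ?t (mon s 1) = meval ?t s" for s by (simp add: psubst_mon)
  have inj: "inj_on (meval ?t) \<Gamma>"
  proof (rule inj_onI)
    fix s s' assume s: "s \<in> \<Gamma>" "s' \<in> \<Gamma>" "meval ?t s = meval ?t s'"
    have "mon s 1 - mon s' 1 = (0 :: (nat, 'k) mpoly)"
      by (rule zero) (use s in \<open>auto simp: \<Gamma>_def psubst_diff psubst_mon polys_mon\<close>)
    then have "coef (mon s 1 :: (nat, 'k) mpoly) s' = coef (mon s' 1) s'" by simp
    then show "s = s'" by (simp add: coef_mon split: if_splits)
  qed
  have indep: "\<not> vs.dependent (meval ?t ` \<Gamma>)"
  proof
    assume "vs.dependent (meval ?t ` \<Gamma>)"
    then obtain T c where T: "finite T" "T \<subseteq> meval ?t ` \<Gamma>" "(\<Sum>v\<in>T. PConst (c v) * v) = 0"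
      and nz: "\<exists>v\<in>T. c v \<noteq> 0" unfolding vs.dependent_explicit by blast
    define \<Gamma>' where "\<Gamma>' = {s \<in> \<Gamma>. meval ?t s \<in> T}"
    have T': "T = meval ?t ` \<Gamma>'" using T(2) by (auto simp: \<Gamma>'_def)
    have inj': "inj_on (meval ?t) \<Gamma>'" by (rule inj_on_subset[OF inj]) (auto simp: \<Gamma>'_def)
    have fin: "finite \<Gamma>'" unfolding \<Gamma>'_def using \<Gamma>(2) by simp
    define F where "F = (\<Sum>s\<in>\<Gamma>'. mon s (c (meval ?t s)))"
    have "F = 0"
    proof (rule zero)
      show "F \<in> polys {..<m}" unfolding F_def by (intro polys_sum polys_mon) (auto simp: \<Gamma>'_def \<Gamma>_def)
      have "psubst ?t F = (\<Sum>s\<in>\<Gamma>'. PConst (c (meval ?t s)) * meval ?t s)"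
        by (simp add: F_def psubst_sum psubst_mon)
      also have "\<dots> = (\<Sum>v\<in>T. PConst (c v) * v)"
        unfolding T' by (simp add: sum.reindex[OF inj'])
      finally show "psubst ?t F = 0" using T(3) by simp
    qed
    from nz obtain s where s: "s \<in> \<Gamma>'" "c (meval ?t s) \<noteq> 0" unfolding T' by blast
    have "coef F s = (\<Sum>s'\<in>\<Gamma>'. if s' = s then c (meval ?t s) else 0)"
      unfolding F_def lookup_sum by (intro sum.cong refl) (auto simp: coef_mon)
    also have "\<dots> = c (meval ?t s)" using fin s(1) by simp
    finally show False using \<open>F = 0\<close> s(2) by simp
  qed
  define S where "S = {s. supp s \<subseteq> J \<and> mon_deg s \<le> m * (N * d)}"
  have "S \<subseteq> {s. supp s \<subseteq> J \<and> (\<forall>i\<in>J. coef s i \<le> m * (N * d))}"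
  proof
    fix s assume s: "s \<in> S"
    have "coef s i \<le> mon_deg s" for i
      unfolding mon_deg_def by (cases "i \<in> supp s") (auto simp: in_keys_iff intro: member_le_sum)
    then show "s \<in> {s. supp s \<subseteq> J \<and> (\<forall>i\<in>J. coef s i \<le> m * (N * d))}"
      using s by (auto simp: S_def intro: order_trans)
  qed
  then have S: "finite S" using card_exponent_box(2)[OF J, of "\<lambda>_. m * (N * d)"] finite_subset by blast
  \<comment> \<open>Each such product is the image of a polynomial of degree at most
    \<open>m * (N * d)\<close>, so it lies in the span of these monomials.\<close>
  let ?B = "(\<lambda>z. mon z 1) ` vdeg e ` S :: ('v, 'k) mpoly set"
  have span: "meval ?t ` \<Gamma> \<subseteq> vs.span ?B"
  proof
    fix v assume "v \<in> meval ?t ` \<Gamma>"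
    then obtain s where s: "s \<in> \<Gamma>" "v = meval ?t s" by blast
    define r where "r = meval p s"
    have "v = edge_map e r"
      by (simp add: s(2) r_def meval_def psubst_prod psubst_power)
    also have "\<dots> = (\<Sum>t\<in>supp r. PConst (coef r t) * mon (vdeg e t) 1)"
      by (simp add: psubst_def meval_def[symmetric] meval_edge)
    also have "\<dots> \<in> vs.span ?B"
    proof (rule vs.span_sum, rule vs.span_scale, rule vs.span_base)
      fix t assume t: "t \<in> supp r"
      have lt: "i < m" "coef s i \<le> N" if "i \<in> supp s" for i using s(1) that by (auto simp: \<Gamma>_def)
      have "r \<in> polys J" unfolding r_def meval_def by (intro polys_prod polys_power p lt)
      moreover have "deg_le (\<Sum>i\<in>supp s. coef s i * d) r"
        unfolding r_def meval_def by (intro deg_le_prod deg_le_power p lt) simp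
      moreover have "(\<Sum>i\<in>supp s. coef s i * d) \<le> m * (N * d)"
      proof -
        have "(\<Sum>i\<in>supp s. coef s i * d) \<le> (\<Sum>i\<in>supp s. N * d)" by (intro sum_mono) (simp add: lt)
        also have "\<dots> = card (supp s) * (N * d)" by simp
        also have "\<dots> \<le> m * (N * d)"
          using card_mono[of "{..<m}" "supp s"] lt by (intro mult_right_mono) auto
        finally show ?thesis .
      qed
      ultimately have "t \<in> S" using t by (auto simp: S_def deg_le_def dest: polysD intro: order_trans)
      then show "mon (vdeg e t) 1 \<in> ?B" by blast
    qed
    finally show "v \<in> vs.span ?B" .
  qed
  have "Suc N ^ m = card (meval ?t ` \<Gamma>)" using inj \<Gamma> by (simp add: card_image)
  also have "\<dots> \<le> card ?B" using vs.independent_span_bound[OF _ indep span] S by simp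
  also have "\<dots> \<le> card (vdeg e ` S)" using S by (intro card_image_le) simp
  finally show ?thesis by (simp add: S_def)
qed

text \<open>In \<open>N\<close>, the left side has degree \<open>m\<close> and the right side degree
  \<open>m - 1\<close>. The witness is the constant left after bounding
  \<open>Suc (m * (N * d))\<close> by \<open>Suc (m * d) * Suc N\<close>.\<close>

lemma polynomial_growth:
  assumes "\<And>N::nat. Suc N ^ m \<le> c * Suc (m * (N * d)) ^ (m - 1)" shows "m = 0"
proof (rule ccontr)
  assume "m \<noteq> 0"
  define N where "N = c * Suc (m * d) ^ (m - 1)"
  have "Suc (m * (N * d)) \<le> Suc (m * d) * Suc N" by (simp add: algebra_simps)
  then have "c * Suc (m * (N * d)) ^ (m - 1) \<le> c * (Suc (m * d) * Suc N) ^ (m - 1)"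
    by (intro mult_left_mono power_mono) auto
  also have "\<dots> = N * Suc N ^ (m - 1)" by (simp only: power_mult_distrib N_def mult.assoc)
  also have "\<dots> < Suc N * Suc N ^ (m - 1)" by simp
  also have "\<dots> = Suc N ^ m" using \<open>m \<noteq> 0\<close> by (simp flip: power_Suc)
  finally show False using assms[of N] by simp
qed

text \<open>A longer chain would give \<open>card J\<close> algebraically independent elements,
  whose products outnumber the bound of \<open>card_vdeg_le\<close>.\<close>

lemma krull_dim_edge_ring_le:
  fixes e :: "'i \<Rightarrow> 'v set"
  assumes J: "finite J" "\<And>j. j \<in> J \<Longrightarrow> card (e j) = 2" "inj_on e J"
    and uv: "supp u \<subseteq> J" "supp v \<subseteq> J" "u \<noteq> v" "vdeg e u = vdeg e v"
  shows "krull_dim (edge_ring J e :: ('v, 'k::field) mpoly ring) \<le> enat (card J - 1)"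
proof -
  let ?R = "edge_ring J e :: ('v, 'k) mpoly ring"
  let ?C = "edge_map e ` polys J :: ('v, 'k) mpoly set"
  have "l \<le> card J - 1"
    if P: "\<forall>i\<le>l. primeideal (P i) ?R" "\<forall>i<l. P i \<subset> P (Suc i)" for l and P :: "nat \<Rightarrow> ('v, 'k) mpoly set"
  proof (rule ccontr)
    assume l: "\<not> ?thesis"
    define m where "m = card J"
    have prime: "prime_in ?C (P i)" if "i \<le> l" for i
      using P(1) that by (simp add: primeideal_edge_ring_iff)
    \<comment> \<open>Only the first \<open>m + 1\<close> primes of the chain are used.\<close>
    have "\<exists>t. (\<forall>i<m. t i \<in> ?C) \<and> alg_indep (P 0) m t"
      by (rule prime_chain_alg_indep) (use prime P(2) l in \<open>auto simp: m_def\<close>)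
    then obtain t where t: "\<forall>i<m. t i \<in> ?C" "alg_indep (P 0) m t" by blast
    have "\<forall>i\<in>{..<m}. \<exists>p. p \<in> polys J \<and> t i = edge_map e p" using t(1) by auto
    then obtain p where p: "\<forall>i\<in>{..<m}. p i \<in> polys J \<and> t i = edge_map e (p i)"
      by (elim bchoice[THEN exE])
    have "0 \<in> P 0" using prime[of 0] by (simp add: prime_in_def)
    have ind: "alg_indep {0} m (\<lambda>i. edge_map e (p i) :: ('v, 'k) mpoly)"
      unfolding alg_indep_def
    proof (intro ballI impI)
      fix F :: "(nat, 'k) mpoly"
      assume F: "F \<in> polys {..<m}" and "psubst (\<lambda>i. edge_map e (p i)) F \<in> {0 :: ('v, 'k) mpoly}"
      moreover have "psubst t F = psubst (\<lambda>i. edge_map e (p i)) F"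
        by (rule psubst_cong[OF F]) (use p in simp)
      ultimately have "psubst t F \<in> P 0" using \<open>0 \<in> P 0\<close> by simp
      then show "F = 0" using t(2) F by (simp add: alg_indep_def)
    qed
    define d where "d = (\<Sum>i<m. \<Sum>s\<in>supp (p i). mon_deg s)"
    have d: "deg_le d (p i)" if "i < m" for i
      unfolding deg_le_def
    proof
      fix s assume "s \<in> supp (p i)"
      then have "mon_deg s \<le> (\<Sum>s\<in>supp (p i). mon_deg s)" by (intro member_le_sum) auto
      also have "\<dots> \<le> d" unfolding d_def using that by (intro member_le_sum) auto
      finally show "mon_deg s \<le> d" .
    qed
    obtain c where c: "\<forall>K. card (vdeg e ` {s. supp s \<subseteq> J \<and> mon_deg s \<le> K}) \<le> c * Suc K ^ (card J - 1)"
      using card_vdeg_le[OF J uv] by blast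
    have "Suc N ^ m \<le> c * Suc (m * (N * d)) ^ (m - 1)" for N
    proof -
      have "Suc N ^ m \<le> card (vdeg e ` {s. supp s \<subseteq> J \<and> mon_deg s \<le> m * (N * d)})"
        by (rule alg_indep_card_le[OF J(1) _ d ind]) (use p in auto)
      also have "\<dots> \<le> c * Suc (m * (N * d)) ^ (m - 1)" using c unfolding m_def by blast
      finally show ?thesis .
    qed
    then have "m = 0" by (rule polynomial_growth)
    \<comment> \<open>Without edges there is only the trivial monomial, against
      \<open>u \<noteq> v\<close>.\<close>
    then have "J = {}" using J(1) by (simp add: m_def)
    then have "u = v" using uv(1,2) by (auto intro!: poly_mapping_eqI simp: in_keys_iff)
    then show False using uv(3) by simp
  qed
  then show ?thesis unfolding krull_dim_def by (intro Sup_least) auto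
qed

section \<open>The two dimension bounds combined\<close>

theorem theorem1p3:
  fixes n m q :: nat and e :: "nat \<Rightarrow> nat set"
  assumes "q \<ge> 4"
    and "simple_graph {1..n} {1..m} e"
    and "connected_graph {1..n} {1..m} e"
    and "has_linear_resolution q {1..m} (toric_ideal {1..m} e :: (nat, 'k::field) mpoly set)"
  shows "hypersurface m (edge_ring {1..m} e :: (nat, 'k) mpoly ring)"
proof -
  let ?J = "{1..m}"
  let ?I = "toric_ideal ?J e :: (nat, 'k) mpoly set"
  have J: "finite ?J" "\<And>j. j \<in> ?J \<Longrightarrow> card (e j) = 2" "inj_on e ?J"
    using assms(2) by (auto simp: simple_graph_def)
  obtain x y where xy: "x \<in> ?J" "y \<in> ?J" "x \<noteq> y"
    and I: "\<And>p t. p \<in> ?I \<Longrightarrow> t \<in> supp p \<Longrightarrow> x \<in> supp t \<or> y \<in> supp t"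
    using toric_linear_two_variables[OF assms(1) J assms(4)] by blast
  have "?I \<subseteq> var_ideal ?J {x, y}"
    using I by (auto simp: var_ideal_def toric_ideal_polys)
  then have ge: "enat (m - 1) \<le> krull_dim (edge_ring ?J e :: (nat, 'k) mpoly ring)"
    using krull_dim_edge_ring_ge[OF J(1) xy] by simp
  have "?I \<noteq> {0}" "0 \<in> ?I"
    using assms(4) by (auto simp: has_linear_resolution_def toric_ideal_def)
  then obtain p where p: "p \<in> ?I" "p \<noteq> 0" by blast
  then obtain u where u: "u \<in> supp p" by (metis keys_eq_empty ex_in_conv)
  obtain v where v: "v \<in> supp p" "v \<noteq> u" "vdeg e v = vdeg e u"
    by (rule toric_ideal_partner[OF p(1) u])
  have "krull_dim (edge_ring ?J e :: (nat, 'k) mpoly ring) \<le> enat (m - 1)"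
    using krull_dim_edge_ring_le[OF J, of v u] polysD[OF toric_ideal_polys[OF p(1)]] u v by simp
  with ge have "krull_dim (edge_ring ?J e :: (nat, 'k) mpoly ring) = enat (m - 1)" by (rule antisym[rotated])
  \<comment> \<open>The existence of \<open>x\<close> gives \<open>1 \<le> m\<close>, so the
    truncated subtraction is exact.\<close>
  moreover have "m - (m - 1) = 1" using xy by auto
  ultimately show ?thesis by (simp add: hypersurface_def codim_def one_enat_def)
qed

end
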